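(* Let $\mathcal S$ be a fixed nonempty set of non-negative integers. Let $\lambda_n\to\lambda>0$ and suppose that $E(\lambda)$ contains a unique element $\widehat\mu=\widehat\mu(\lambda)$ that maximizes $\psi_{\mathcal S}(\mu)$ (or, equivalently, $\psi_{\mathcal S,1}(\mu;\lambda)$) over $E(\lambda)$. Then the following hold as $n\to\infty$ for the random graph $G_n:=G_{n,\lambda_n/n;\mathcal S}$. (i) $\boldsymbol\pi(G_n)\to \mathrm{Po}_{\mathcal S}(\widehat\mu)$ in probability. In other words, for every $j\in\mathcal S$, $$\frac{n_j(G_n)}{n}\overset{\mathrm p}{\longrightarrow}\mathrm{Po}_{\mathcal S}(\widehat\mu)\{j\}=\frac{\widehat\mu^j/j!}{\phi_{\mathcal S}(\widehat\mu)}.$$ (ii) All moments of the random distribution $\boldsymbol\pi(G_n)$ converge to the corresponding moments of $\mathrm{Po}_{\mathcal S}(\widehat\mu)$: if $d_1,\dots,d_n$ is the degree sequence of $G_n$ and $X_\mu\sim\mathrm{Po}(\mu)$, then for every $r\in(0,\infty)$, $$\sum_{i=1}^n\frac{d_i^r}{n}=\sum_{j=0}^\infty\frac{j^r n_j(G_n)}{n}\overset{\mathrm p}{\longrightarrow}\sum_{j=0}^\infty j^r\,\mathrm{Po}_{\mathcal S}(\widehat\mu)\{j\}=\mathbb E(X_{\widehat\mu}^r\mid X_{\widehat\mu}\in\mathcal S).$$ In particular, with $\mathrm e(G_n)$ the number of edges, $$\frac{\mathrm e(G_n)}{n}\overset{\mathrm p}{\longrightarrow}\tfrac12\mathbb E(X_{\widehat\mu}\mid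 X_{\widehat\mu}\in\mathcal S)=\frac{\widehat\mu\,\phi_{\mathcal S}'(\widehat\mu)}{2\phi_{\mathcal S}(\widehat\mu)}.$$ (iii) For every $\varepsilon>0$ there exists a constant $c=c(\varepsilon,\lambda,\mathcal S)>0$ such that, for all large $n$, $$\mathbb P\bigl(d_{\mathrm{TV}}(\boldsymbol\pi(G_n),\mathrm{Po}_{\mathcal S}(\widehat\mu))\ge\varepsilon\bigr)\le e^{-cn}.$$ (iv) $$\frac1n\log\mathbb P\bigl(G_{n,\lambda_n/n}\text{ is an }\mathcal S\text{-graph}\bigr)\to\psi_{\mathcal S}(\widehat\mu)-\tfrac12\lambda .$$
   Context: An $\mathcal S$-graph is a (simple) graph all of whose vertex degrees belong to $\mathcal S$. $G_{n,p}$, $p\in(0,1)$, is the random graph on $n$ labelled vertices in which each of the $\binom n2$ possible edges is present independently with probability $p$. $G_{n,p;\mathcal S}$ is $G_{n,p}$ conditioned on being an $\mathcal S$-graph. Only those $n$ for which an $\mathcal S$-graph on $n$ vertices exists (and $n$ large enough that $\lambda_n/n\in(0,1)$) are considered; thus if $\mathcal S$ contains only odd integers, $n$ is even. For a graph $G$ with $n$ vertices, $n_j(G)$ is the number of vertices of degree $j$, and $\boldsymbol\pi(G)=(n_j(G)/n)_{j\ge0}$, regarded as a probability distribution on $\mathbb Z_{\ge0}$. The space of probability distributions on $\mathbb Z_{\ge 0}$ has the topology of weak convergence, metrised by $d_{\mathrm{TV}}(\pi,\pi')=\frac12\sum_j|\pi_j-\pi_j'|$. $\phi_{\mathcal S}(\mu)=\sum_{j\in\mathcal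 S}\mu^j/j!$ (with $0^0=1$). $\mathrm{Po}_{\mathcal S}(\mu)$ is the law of a $\mathrm{Po}(\mu)$ variable conditioned to lie in $\mathcal S$: $\mathrm{Po}_{\mathcal S}(\mu)\{k\}=\frac{\mu^k/k!}{\phi_{\mathcal S}(\mu)}$ for $k\in\mathcal S$ and $0$ otherwise; it is defined for $\mu>0$, and also for $\mu=0$ if $0\in\mathcal S$ (a point mass at $0$). For $\lambda>0$, $$E(\lambda)=\Bigl\{\mu\ge0:\frac{\mu\phi_{\mathcal S}'(\mu)}{\phi_{\mathcal S}(\mu)}=\frac{\mu^2}{\lambda}\Bigr\},$$ where $\mu=0$ is allowed only if $0\in\mathcal S$. Further $\psi_{\mathcal S}(\mu)=\log\phi_{\mathcal S}(\mu)-\frac{\mu\phi_{\mathcal S}'(\mu)}{2\phi_{\mathcal S}(\mu)}$ and $\psi_{\mathcal S,1}(\mu;\lambda)=\log\phi_{\mathcal S}(\mu)-\frac{\mu^2}{2\lambda}$; these two coincide for $\mu\in E(\lambda)$. Logarithms are natural. *)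

theory Defs
  imports "HOL-Probability.Probability"
begin

text \<open>
  A simple graph on the vertex set \<open>{..<n}\<close> is represented by its set of edges,
  an edge being a two-element set of vertices.
\<close>

definition all_edges :: "nat \<Rightarrow> nat set set" where
  "all_edges n = {e. e \<subseteq> {..<n} \<and> card e = 2}"

definition vdegree :: "nat set set \<Rightarrow> nat \<Rightarrow> nat" where
  "vdegree G v = card {e \<in> G. v \<in> e}"

definition S_graphs :: "nat set \<Rightarrow> nat \<Rightarrow> nat set set set" where
  "S_graphs S n = {G. G \<subseteq> all_edges n \<and> (\<forall>v<n. vdegree G v \<in> S)}"

definition gnp :: "nat \<Rightarrow> real \<Rightarrow> nat set set pmf" where
  "gnp n p = map_pmf (\<lambda>f. {e \<in> all_edges n. f e})
     (Pi_pmf (all_edges n) False (\<lambda>_. bernoulli_pmf p))"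

text \<open>The conditioning is meaningful when \<open>0 < p < 1\<close> and \<open>S_graphs S n \<noteq> {}\<close>.\<close>

definition gnpS :: "nat \<Rightarrow> real \<Rightarrow> nat set \<Rightarrow> nat set set pmf" where
  "gnpS n p S = cond_pmf (gnp n p) (S_graphs S n)"

text \<open>
  ``\<open>n \<rightarrow> \<infinity>\<close>'' through those \<open>n\<close> for which an \<open>S\<close>-graph on \<open>n\<close> vertices exists.
  If \<open>lams n\<close> converges to a positive limit along this filter, then
  \<open>lams n / n \<in> {0<..<1}\<close> holds eventually.
\<close>

definition S_sequentially :: "nat set \<Rightarrow> nat filter" where
  "S_sequentially S = inf sequentially (principal {n. S_graphs S n \<noteq> {}})"

definition n_deg :: "nat \<Rightarrow> nat set set \<Rightarrow> nat \<Rightarrow> nat" where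
  "n_deg n G j = card {v \<in> {..<n}. vdegree G v = j}"

definition deg_dist :: "nat \<Rightarrow> nat set set \<Rightarrow> nat pmf" where
  "deg_dist n G = embed_pmf (\<lambda>j. real (n_deg n G j) / real n)"

lemma pmf_deg_dist:
  assumes "n > 0"
  shows "pmf (deg_dist n G) j = real (n_deg n G j) / real n"
proof -
  let ?p = "map_pmf (vdegree G) (pmf_of_set {..<n})"
  have "pmf ?p i = real (n_deg n G i) / real n" for i
  proof -
    have "vdegree G -` {i} \<inter> {..<n} = {v \<in> {..<n}. vdegree G v = i}"
      by auto
    moreover have "{..<n} \<noteq> {}"
      using assms by auto
    ultimately show ?thesis
      by (simp add: pmf_map measure_pmf_of_set n_deg_def Int_commute)
  qed
  hence "pmf ?p = (\<lambda>j. real (n_deg n G j) / real n)"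
    by (rule ext)
  hence "deg_dist n G = ?p"
    unfolding deg_dist_def using type_definition.Rep_inverse[OF td_pmf_embed_pmf, of ?p] by simp
  thus ?thesis
    using \<open>pmf ?p = _\<close> by simp
qed

definition dTV :: "nat pmf \<Rightarrow> nat pmf \<Rightarrow> real" where
  "dTV p q = 1/2 * (\<Sum>j. \<bar>pmf p j - pmf q j\<bar>)"

text \<open>
  Convergence in probability, along the filter \<open>F\<close>, of the random variables \<open>X n\<close> (each on
  its own probability space \<open>P n\<close>) to a constant \<open>c\<close>, with respect to the metric \<open>d\<close>.
\<close>

definition conv_in_prob ::
  "('b \<Rightarrow> 'b \<Rightarrow> real) \<Rightarrow> nat filter \<Rightarrow> (nat \<Rightarrow> 'a pmf) \<Rightarrow> (nat \<Rightarrow> 'a \<Rightarrow> 'b) \<Rightarrow> 'b \<Rightarrow> bool" where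
  "conv_in_prob d F P X c \<longleftrightarrow>
     (\<forall>\<epsilon>>0. ((\<lambda>n. measure_pmf.prob (P n) {\<omega>. d (X n \<omega>) c \<ge> \<epsilon>}) \<longlongrightarrow> 0) F)"

definition phi :: "nat set \<Rightarrow> real \<Rightarrow> real" where
  "phi S \<mu> = (\<Sum>\<^sub>\<infinity>j\<in>S. \<mu> ^ j / fact j)"

text \<open>The library's \<open>poisson_pmf\<close> is only specified for a positive rate.\<close>

definition Po :: "real \<Rightarrow> nat pmf" where
  "Po \<mu> = (if \<mu> = 0 then return_pmf 0 else poisson_pmf \<mu>)"

definition PoS :: "nat set \<Rightarrow> real \<Rightarrow> nat pmf" where
  "PoS S \<mu> = cond_pmf (Po \<mu>) S"

text \<open>\<open>E(f(X) | X \<in> A)\<close> for a random variable \<open>X\<close> with law \<open>p\<close>.\<close>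

definition cond_expectation :: "'a pmf \<Rightarrow> 'a set \<Rightarrow> ('a \<Rightarrow> real) \<Rightarrow> real" where
  "cond_expectation p A f =
     measure_pmf.expectation p (\<lambda>x. f x * indicator A x) / measure_pmf.prob p A"

definition Eset :: "nat set \<Rightarrow> real \<Rightarrow> real set" where
  "Eset S lam = {\<mu>. \<mu> \<ge> 0 \<and> (\<mu> = 0 \<longrightarrow> 0 \<in> S) \<and>
     \<mu> * deriv (phi S) \<mu> / phi S \<mu> = \<mu>\<^sup>2 / lam}"

definition psi :: "nat set \<Rightarrow> real \<Rightarrow> real" where
  "psi S \<mu> = ln (phi S \<mu>) - \<mu> * deriv (phi S) \<mu> / (2 * phi S \<mu>)"

definition psi1 :: "nat set \<Rightarrow> real \<Rightarrow> real \<Rightarrow> real" where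
  "psi1 S \<mu> lam = ln (phi S \<mu>) - \<mu>\<^sup>2 / (2 * lam)"

lemma psi_eq_psi1:
  assumes "\<mu> \<in> Eset S lam"
  shows "psi S \<mu> = psi1 S \<mu> lam"
proof -
  have "\<mu> * deriv (phi S) \<mu> / phi S \<mu> / 2 = \<mu>\<^sup>2 / lam / 2"
    using assms by (simp add: Eset_def)
  thus ?thesis
    by (simp add: psi_def psi1_def mult.commute)
qed

lemma is_arg_max_psi_iff_psi1:
  "is_arg_max (psi S) (\<lambda>\<mu>. \<mu> \<in> Eset S lam) \<mu> \<longleftrightarrow>
   is_arg_max (\<lambda>\<mu>. psi1 S \<mu> lam) (\<lambda>\<mu>. \<mu> \<in> Eset S lam) \<mu>"
  unfolding is_arg_max_def by (metis psi_eq_psi1)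

lemma pmf_PoS:
  assumes "\<mu> \<ge> 0" "S \<noteq> {}" "\<mu> = 0 \<Longrightarrow> 0 \<in> S"
  shows "pmf (PoS S \<mu>) k = (if k \<in> S then \<mu> ^ k / fact k / phi S \<mu> else 0)"
proof -
  have pmf: "pmf (Po \<mu>) j = \<mu> ^ j / fact j * exp (-\<mu>)" for j
    using assms(1) by (cases "\<mu> = 0"; cases j) (simp_all add: Po_def)
  have "measure_pmf.prob (Po \<mu>) S = infsetsum (pmf (Po \<mu>)) S"
    by (rule measure_pmf_conv_infsetsum)
  also have "\<dots> = infsum (pmf (Po \<mu>)) S"
    by (rule infsetsum_infsum) (rule pmf_abs_summable)
  also have "\<dots> = phi S \<mu> * exp (-\<mu>)"
    unfolding pmf phi_def by (rule infsum_cmult_left') 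
  finally have prob: "measure_pmf.prob (Po \<mu>) S = phi S \<mu> * exp (-\<mu>)" .
  have "set_pmf (Po \<mu>) \<inter> S \<noteq> {}"
    using assms by (auto simp: Po_def)
  from pmf_cond[OF this] show ?thesis
    unfolding PoS_def by (simp add: pmf prob)
qed

end

theory Submission
  imports Defs "HOL-Combinatorics.Multiset_Permutations" "HOL-Real_Asymp.Real_Asymp"
begin

text \<open>
  With \<open>q = p / (1 - p)\<close> the graph \<open>G\<close> has probability proportional to \<open>q ^ e(G)\<close>. A degree sequence
  \<open>d\<close> with sum \<open>2m\<close> is realised by at most \<open>(2m)! / (2^m m! (\<Prod>v. d v!))\<close> graphs (configuration model),
  and, if its maximum is at most \<open>\<Delta>\<close>, by at least a fraction \<open>m ^ (- O(\<Delta>\<^sup>2))\<close> of that number: a random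
  configuration has \<open>O(\<Delta>\<^sup>2)\<close> loops and repeated edges on average, and each can be switched away at the
  cost of a factor \<open>m\<^sup>2\<close>. As \<open>(2m)! / (2^m m!)\<close> is the moment of order \<open>2m\<close> of a standard normal
  variable \<open>N\<close>, the sum over all \<open>d\<close> with values in \<open>S\<close> is (up to parity) the expectation of
  \<open>phi S (sqrt q * \<bar>N\<bar>) ^ n\<close>, that is, an integral of the \<open>n\<close>-th power of
  \<open>phi S \<mu> * exp (- \<mu>\<^sup>2 / (2 * lam))\<close>, which concentrates at the unique maximizer \<open>\<mu>h\<close>.
  For fixed \<open>\<mu>\<close> the degrees are independent with law \<open>Po\<^sub>S(\<mu>)\<close>, so events are estimated by
  exponential tilting uniformly for \<open>\<mu>\<close> near \<open>\<mu>h\<close>. The total loss is only \<open>exp (O((ln n)^5))\<close>,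
  which is why even bounds of order \<open>exp (- n^a)\<close>, needed for high moments, survive.
\<close>

section \<open>Configurations and graphs\<close>

text \<open>The variable \<open>sqrt q * \<bar>N\<bar>\<close> has density proportional to
  exp(-\<mu>^2 / (2 q)), and n q tends to \<open>lam\<close>: this is the penalty \<mu>^2 / (2 lam)
  in \<open>psi1\<close>, and the equation of \<open>Eset\<close> is the stationarity condition of
  the integrand. Once \<mu> is fixed, the constraint on the degree sum has disappeared, and Chernoff
  bounds for independent degrees apply. Two obstacles remain, both in the lower bound for the
  partition function. Switching costs m to a power of order \<Delta>^2, so degrees are truncated at
  a level that grows with n: slowly because of this cost, yet fast enough that the n-th power of the
  truncated \<open>phi\<close> is comparable with that of \<open>phi\<close>. And only even degree
  sums occur, so \<open>phi S \<mu> ^ n\<close> is replaced by its even part in \<mu>, which could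
  nearly vanish if n were odd and \<open>phi S (- \<mu>)\<close> close to
  \<open>- phi S \<mu>\<close>. Upper bounds for events meet neither obstacle: configurations
  overcount graphs, and the even part of a polynomial with nonnegative coefficients is at most its
  value at \<bar>\<mu>\<bar>.\<close>

lemma finite_all_edges [simp]: "finite (all_edges n)"
  unfolding all_edges_def by (rule finite_subset[of _ "Pow {..<n}"]) auto

lemma card_all_edges: "card (all_edges n) = n choose 2"
  unfolding all_edges_def using n_subsets[of "{..<n}" 2] by simp

lemma finite_S_graphs [simp]: "finite (S_graphs S n)"
  unfolding S_graphs_def by (rule finite_subset[of _ "Pow (all_edges n)"]) auto

lemma vdegree_eq_0:
  assumes "G \<subseteq> all_edges n" "v \<ge> n"
  shows "vdegree G v = 0"
proof -
  have "{e \<in> G. v \<in> e} = {}"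
    using assms by (fastforce simp: all_edges_def)
  thus ?thesis unfolding vdegree_def by (simp only: card.empty)
qed

lemma handshake:
  assumes "G \<subseteq> all_edges n"
  shows "(\<Sum>v<n. vdegree G v) = 2 * card G"
proof -
  have fin: "finite G" using assms finite_all_edges finite_subset by blast
  have "(\<Sum>v<n. vdegree G v) = (\<Sum>v<n. \<Sum>e\<in>G. if v \<in> e then 1 else 0)"
    unfolding vdegree_def using fin by (intro sum.cong) (simp_all add: sum.If_cases Int_def)
  also have "\<dots> = (\<Sum>e\<in>G. \<Sum>v<n. if v \<in> e then 1 else 0)"
    by (rule sum.swap)
  also have "\<dots> = (\<Sum>e\<in>G. 2)"
  proof (intro sum.cong refl)
    fix e assume "e \<in> G"
    hence e: "e \<subseteq> {..<n}" "card e = 2" using assms by (auto simp: all_edges_def)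
    hence "{..<n} \<inter> {v. v \<in> e} = e" by auto
    thus "(\<Sum>v<n. if v \<in> e then 1 else 0) = (2::nat)"
      using e by (simp add: sum.If_cases)
  qed
  finally show ?thesis by simp
qed

lemma vdegree_le:
  assumes "G \<subseteq> all_edges n"
  shows "vdegree G v \<le> n - 1"
proof (cases "v < n")
  case False
  thus ?thesis using vdegree_eq_0[OF assms] by simp
next
  case True
  have "{e \<in> G. v \<in> e} \<subseteq> (\<lambda>w. {v, w}) ` ({..<n} - {v})"
  proof
    fix e assume "e \<in> {e \<in> G. v \<in> e}"
    hence e: "e \<subseteq> {..<n}" "card e = 2" "v \<in> e" using assms by (auto simp: all_edges_def)
    then obtain a b where "e = {a, b}" "a \<noteq> b" by (meson card_2_iff)
    thus "e \<in> (\<lambda>w. {v, w}) ` ({..<n} - {v})" using e by auto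
  qed
  hence "vdegree G v \<le> card ((\<lambda>w. {v, w}) ` ({..<n} - {v}))"
    unfolding vdegree_def by (intro card_mono) auto
  also have "\<dots> \<le> card ({..<n} - {v})" by (rule card_image_le) simp
  finally show ?thesis using True by simp
qed

lemma count_mset_nth: "count (mset xs) v = card {i. i < length xs \<and> xs ! i = v}"
  by (simp add: count_mset count_list_eq_length_filter length_filter_conv_card eq_commute[of v])

text \<open>
  Configurations are words of length \<open>2m\<close>: position \<open>k\<close> is matched with position \<open>m + k\<close>.
\<close>

definition edge_at :: "nat \<Rightarrow> nat list \<Rightarrow> nat \<Rightarrow> nat set" where
  "edge_at m xs k = {xs ! k, xs ! (m + k)}"

definition simple_word :: "nat \<Rightarrow> nat list \<Rightarrow> bool" where
  "simple_word m xs \<longleftrightarrow> (\<forall>k<m. xs ! k \<noteq> xs ! (m + k)) \<and> inj_on (edge_at m xs) {..<m}"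

text \<open>Each entry of the list is lifted independently. In the application \<open>u\<close>
  forgets the order of a pair, so an enumeration of m edges has 2^m orientations.\<close>

lemma card_lists_map_eq:
  assumes "\<And>y. y \<in> set ys \<Longrightarrow> card {e. u e = y} = c"
  shows "card {es. map u es = ys} = c ^ length ys"
  using assms
proof (induction ys)
  case Nil
  thus ?case by simp
next
  case (Cons y ys)
  have "{es. map u es = y # ys} = (\<lambda>(e, es). e # es) ` ({e. u e = y} \<times> {es. map u es = ys})"
    by (auto simp: map_eq_Cons_conv)
  moreover have "inj_on (\<lambda>(e, es). e # es) ({e. u e = y} \<times> {es. map u es = ys})"
    by (auto simp: inj_on_def)
  ultimately have "card {es. map u es = y # ys} = card {e. u e = y} * card {es. map u es = ys}"
    by (simp add: card_image card_cartesian_product)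
  thus ?case using Cons by simp
qed

lemma card_ordered_pairs:
  assumes "card e = 2"
  shows "card {p. {fst p, snd p} = e} = 2"
proof -
  obtain a b where ab: "e = {a, b}" "a \<noteq> b" using assms by (meson card_2_iff)
  have "{p. {fst p, snd p} = e} = {(a, b), (b, a)}"
    using ab by (auto simp: doubleton_eq_iff)
  thus ?thesis using ab by simp
qed

text \<open>A simple word for \<open>G\<close> is an enumeration of its edges (m! ways) with an
  orientation of each (2^m ways). That this number is the same for every simple graph with m edges
  allows words to be counted in place of graphs.\<close>

lemma card_words_of_graph:
  assumes "finite G" "\<And>e. e \<in> G \<Longrightarrow> card e = 2" "card G = m"
  shows "card {xs. length xs = 2 * m \<and> simple_word m xs \<and> edge_at m xs ` {..<m} = G} = 2 ^ m * fact m"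
    (is "card ?X = _")
proof -
  define u :: "nat \<times> nat \<Rightarrow> nat set" where "u = (\<lambda>p. {fst p, snd p})"
  \<comment> \<open>Edge number k has to occupy the positions k and m + k, hence all first ends
    precede all second ends.\<close>
  define h :: "(nat \<times> nat) list \<Rightarrow> nat list" where "h = (\<lambda>es. map fst es @ map snd es)"
  define Y where "Y = {es. map u es \<in> permutations_of_set G}"
  have len: "length es = m" if "es \<in> Y" for es
    using that assms length_finite_permutations_of_set unfolding Y_def
    by (metis length_map mem_Collect_eq)
  have edge: "edge_at m (h es) k = u (es ! k)" if "length es = m" "k < m" for es k
    using that by (simp add: edge_at_def h_def u_def nth_append)
  have inj: "inj_on h Y"
  proof (rule inj_onI)
    fix es es' assume *: "es \<in> Y" "es' \<in> Y" "h es = h es'"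
    hence "map fst es = map fst es'" "map snd es = map snd es'"
      using len by (simp_all add: h_def)
    thus "es = es'" by (metis pair_list_eqI)
  qed
  have "h ` Y = ?X"
  proof (intro set_eqI iffI)
    fix xs assume "xs \<in> h ` Y"
    then obtain es where es: "es \<in> Y" "xs = h es" by auto
    have l: "length es = m" using len es by simp
    have d: "distinct (map u es)" and s: "set (map u es) = G"
      using es by (auto simp: Y_def permutations_of_set_def)
    have "edge_at m xs ` {..<m} = (\<lambda>k. u (es ! k)) ` {..<m}"
      using l es edge by (intro image_cong) auto
    also have "\<dots> = u ` set es"
      unfolding l[symmetric] set_conv_nth by blast
    also have "\<dots> = set (map u es)" by simp
    finally have G: "edge_at m xs ` {..<m} = G" using s by simp
    have "inj_on (edge_at m xs) {..<m}"
      using d l edge es by (auto simp: inj_on_def distinct_conv_nth)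
    moreover have "xs ! k \<noteq> xs ! (m + k)" if "k < m" for k
    proof
      assume "xs ! k = xs ! (m + k)"
      hence "card (edge_at m xs k) = 1" by (simp add: edge_at_def)
      moreover have "edge_at m xs k \<in> G" using G that by auto
      ultimately show False using assms(2) by fastforce
    qed
    ultimately show "xs \<in> ?X" using G l es by (simp add: simple_word_def h_def)
  next
    fix xs assume "xs \<in> ?X"
    hence x: "length xs = 2 * m" "simple_word m xs" "edge_at m xs ` {..<m} = G" by auto
    define es where "es = zip (take m xs) (drop m xs)"
    have l: "length es = m" using x by (simp add: es_def)
    have h: "h es = xs" using x by (simp add: h_def es_def)
    have "map u es = map (edge_at m xs) [0..<m]"
      using l edge[of es] h by (intro nth_equalityI) auto
    hence "map u es \<in> permutations_of_set G"
      using x by (auto simp: permutations_of_set_def distinct_map simple_word_def atLeast0LessThan)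
    thus "xs \<in> h ` Y" using h by (auto simp: Y_def)
  qed
  hence "card ?X = card Y" using card_image[OF inj] by simp
  also have "Y = (\<Union>ys\<in>permutations_of_set G. {es. map u es = ys})"
    by (auto simp: Y_def)
  also have "card \<dots> = (\<Sum>ys\<in>permutations_of_set G. card {es. map u es = ys})"
  proof (rule card_UN_disjoint)
    show "finite (permutations_of_set G)" by simp
    show "\<forall>ys\<in>permutations_of_set G. finite {es. map u es = ys}"
    proof
      fix ys assume "ys \<in> permutations_of_set G"
      hence "card {es. map u es = ys} = 2 ^ length ys"
        using assms(2) by (intro card_lists_map_eq)
          (auto simp: permutations_of_set_def u_def intro!: card_ordered_pairs)
      thus "finite {es. map u es = ys}" by (intro card_ge_0_finite) simp
    qed
  qed auto
  also have "\<dots> = (\<Sum>ys\<in>permutations_of_set G. 2 ^ m)"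
  proof (intro sum.cong refl)
    fix ys assume ys: "ys \<in> permutations_of_set G"
    hence "length ys = m" using assms length_finite_permutations_of_set by metis
    moreover have "card {es. map u es = ys} = 2 ^ length ys"
      using assms(2) ys by (intro card_lists_map_eq)
        (auto simp: permutations_of_set_def u_def intro!: card_ordered_pairs)
    ultimately show "card {es. map u es = ys} = 2 ^ m" by simp
  qed
  also have "\<dots> = 2 ^ m * fact m" using assms by simp
  finally show ?thesis .
qed

text \<open>Both halves of simplicity enter: distinct edges allow indices to be counted in place of
  edges, and without loops \<open>v\<close> is never at both ends of an index, so the counts over
  the two halves of the word add up to its multiplicity.\<close>

lemma vdegree_simple_word:
  assumes "length xs = 2 * m" "simple_word m xs"
  shows "vdegree (edge_at m xs ` {..<m}) v = count (mset xs) v"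
proof -
  have inj: "inj_on (edge_at m xs) {..<m}" using assms by (simp add: simple_word_def)
  have "{e \<in> edge_at m xs ` {..<m}. v \<in> e} = edge_at m xs ` {k. k < m \<and> v \<in> edge_at m xs k}"
    by auto
  hence "vdegree (edge_at m xs ` {..<m}) v = card {k. k < m \<and> v \<in> edge_at m xs k}"
    unfolding vdegree_def using inj by (simp add: card_image inj_on_def)
  also have "{k. k < m \<and> v \<in> edge_at m xs k} = {k. k < m \<and> xs ! k = v} \<union> {k. k < m \<and> xs ! (m + k) = v}"
    by (auto simp: edge_at_def)
  also have "card \<dots> = card {k. k < m \<and> xs ! k = v} + card {k. k < m \<and> xs ! (m + k) = v}"
    using assms by (intro card_Un_disjoint) (auto simp: simple_word_def)
  also have "card {k. k < m \<and> xs ! (m + k) = v} = card ((\<lambda>k. m + k) ` {k. k < m \<and> xs ! (m + k) = v})"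
    by (intro card_image[symmetric]) (auto simp: inj_on_def)
  also have "card {k. k < m \<and> xs ! k = v} + \<dots> =
      card ({k. k < m \<and> xs ! k = v} \<union> (\<lambda>k. m + k) ` {k. k < m \<and> xs ! (m + k) = v})"
    by (intro card_Un_disjoint[symmetric]) auto
  also have "{k. k < m \<and> xs ! k = v} \<union> (\<lambda>k. m + k) ` {k. k < m \<and> xs ! (m + k) = v} =
      {i. i < length xs \<and> xs ! i = v}" (is "?L = ?R")
  proof (intro set_eqI iffI)
    fix i assume "i \<in> ?R"
    show "i \<in> ?L"
    proof (cases "i < m")
      case False
      hence "i = m + (i - m)" "i - m < m" using \<open>i \<in> ?R\<close> assms by auto
      thus ?thesis using \<open>i \<in> ?R\<close> by (intro UnI2 image_eqI[of _ _ "i - m"]) auto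
    qed (use \<open>i \<in> ?R\<close> in auto)
  qed (use assms in auto)
  finally show ?thesis by (simp add: count_mset_nth)
qed

text \<open>The degree sequence is encoded as a multiset that repeats each vertex as often as its
  degree, because the permutations of this multiset are the configurations.\<close>

definition graphs_with_degrees :: "nat \<Rightarrow> nat multiset \<Rightarrow> nat set set set" where
  "graphs_with_degrees n A = {G. G \<subseteq> all_edges n \<and> (\<forall>v. vdegree G v = count A v)}"

lemma card_simple_words:
  assumes "set_mset A \<subseteq> {..<n}" "size A = 2 * m"
  shows "card {xs \<in> permutations_of_multiset A. simple_word m xs} =
    card (graphs_with_degrees n A) * (2 ^ m * fact m)"
proof -
  let ?F = "\<lambda>G. {xs. length xs = 2 * m \<and> simple_word m xs \<and> edge_at m xs ` {..<m} = G}"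
  have fin: "finite (graphs_with_degrees n A)"
    unfolding graphs_with_degrees_def by (rule finite_subset[of _ "Pow (all_edges n)"]) auto
  have cardF: "card (?F G) = 2 ^ m * fact m" if "G \<in> graphs_with_degrees n A" for G
  proof (rule card_words_of_graph)
    have G: "G \<subseteq> all_edges n" "\<And>v. vdegree G v = count A v"
      using that by (auto simp: graphs_with_degrees_def)
    show "finite G" using G finite_all_edges finite_subset by blast
    show "card e = 2" if "e \<in> G" for e using G that by (auto simp: all_edges_def)
    have "2 * card G = (\<Sum>v<n. count A v)" using handshake[OF G(1)] G(2) by simp
    also have "\<dots> = size A"
      unfolding size_multiset_overloaded_eq using assms
      by (intro sum.mono_neutral_right) (auto simp: count_eq_zero_iff)
    finally show "card G = m" using assms by simp
  qed
  have "{xs \<in> permutations_of_multiset A. simple_word m xs} = (\<Union>G\<in>graphs_with_degrees n A. ?F G)"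
  proof (intro set_eqI iffI)
    fix xs assume "xs \<in> {xs \<in> permutations_of_multiset A. simple_word m xs}"
    hence x: "mset xs = A" "simple_word m xs" by (auto simp: permutations_of_multiset_def)
    hence l: "length xs = 2 * m" using assms by (metis size_mset)
    have "edge_at m xs ` {..<m} \<subseteq> all_edges n"
    proof
      fix e assume "e \<in> edge_at m xs ` {..<m}"
      then obtain k where k: "k < m" "e = {xs ! k, xs ! (m + k)}" by (auto simp: edge_at_def)
      hence "xs ! k \<in> set xs" "xs ! (m + k) \<in> set xs" using l by auto
      hence "xs ! k < n" "xs ! (m + k) < n" using x assms by auto
      hence "e \<subseteq> {..<n}" using k by auto
      moreover have "card e = 2" using k x by (simp add: simple_word_def)
      ultimately show "e \<in> all_edges n" by (simp add: all_edges_def)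
    qed
    thus "xs \<in> (\<Union>G\<in>graphs_with_degrees n A. ?F G)"
      using x l vdegree_simple_word[OF l x(2)] by (auto simp: graphs_with_degrees_def)
  next
    fix xs assume "xs \<in> (\<Union>G\<in>graphs_with_degrees n A. ?F G)"
    then obtain G where G: "G \<in> graphs_with_degrees n A" "xs \<in> ?F G" by blast
    have "mset xs = A"
      using vdegree_simple_word[of xs m] G
      by (intro multiset_eqI) (auto simp: graphs_with_degrees_def)
    thus "xs \<in> {xs \<in> permutations_of_multiset A. simple_word m xs}"
      using G by (auto simp: permutations_of_multiset_def)
  qed
  also have "card \<dots> = (\<Sum>G\<in>graphs_with_degrees n A. card (?F G))"
  proof (rule card_UN_disjoint)
    show "\<forall>G\<in>graphs_with_degrees n A. finite (?F G)"
    proof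
      fix G assume "G \<in> graphs_with_degrees n A"
      from cardF[OF this] show "finite (?F G)" by (intro card_ge_0_finite) simp
    qed
  qed (use fin in auto)
  also have "\<dots> = card (graphs_with_degrees n A) * (2 ^ m * fact m)"
    using cardF by simp
  finally show ?thesis .
qed

section \<open>Switching away loops and repeated edges\<close>

text \<open>Every index in a group of parallel edges is bad, the first one included. This keeps the
  notion symmetric in the indices, and a word is simple exactly when no index is bad.\<close>

definition bad_idx :: "nat \<Rightarrow> nat list \<Rightarrow> nat set" where
  "bad_idx m xs = {k. k < m \<and> (xs ! k = xs ! (m + k) \<or>
     (\<exists>l<m. l \<noteq> k \<and> edge_at m xs l = edge_at m xs k))}"

lemma finite_bad_idx [simp]: "finite (bad_idx m xs)"
  unfolding bad_idx_def by auto

lemma simple_word_iff_bad: "simple_word m xs \<longleftrightarrow> bad_idx m xs = {}"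
  unfolding simple_word_def bad_idx_def inj_on_def by auto

text \<open>The switching of two edges {a, b}, {c, d} into {a, d}, {c, b}. It only permutes
  positions, so degrees are preserved, and it is its own inverse, so a word can be recovered from
  its image and the pair (k, l).\<close>

definition swap_snd :: "nat \<Rightarrow> nat \<Rightarrow> nat \<Rightarrow> nat list \<Rightarrow> nat list" where
  "swap_snd m k l xs = xs[m + k := xs ! (m + l), m + l := xs ! (m + k)]"

lemma mset_swap_snd:
  assumes "length xs = 2 * m" "k < m" "l < m"
  shows "mset (swap_snd m k l xs) = mset xs"
  unfolding swap_snd_def using mset_swap[of "m + l" xs "m + k"] assms by simp

lemma swap_snd_swap_snd:
  assumes "length xs = 2 * m" "k < m" "l < m"
  shows "swap_snd m k l (swap_snd m k l xs) = xs"
  unfolding swap_snd_def using assms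
  by (intro nth_equalityI) (auto simp: nth_list_update)

text \<open>
  The index \<open>l\<close> is chosen so that no end of its edge equals or is adjacent to an end of the edge \<open>k\<close>
  that it would be joined to; then both edges created by the switch are new, and no index becomes bad.
\<close>

lemma switching:
  assumes len: "length xs = 2 * m"
    and deg: "\<And>v. count (mset xs) v \<le> \<Delta>"
    and k: "k \<in> bad_idx m xs"
    and m: "m > 2 * ((\<Delta> + 1) * \<Delta>) + card (bad_idx m xs)"
  obtains l where "l < m" "bad_idx m (swap_snd m k l xs) \<subset> bad_idx m xs"
proof -
  define a b where "a = xs ! k" and "b = xs ! (m + k)"
  \<comment> \<open>The neighbourhood of x in the multigraph of the word; it contains x itself if
    there is a loop at x.\<close>
  define N where "N = (\<lambda>x. {y. \<exists>j<m. edge_at m xs j = {x, y}})"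
  have km: "k < m" using k by (simp add: bad_idx_def)
  have pos: "card {i. i < 2 * m \<and> xs ! i = v} \<le> \<Delta>" for v
    using deg[of v] len by (simp add: count_mset_nth)
  have N: "finite (N x)" "card (N x) \<le> \<Delta>" for x
  proof -
    \<comment> \<open>\<open>?p i\<close> is the vertex at the position matched with i, so the
      neighbours of x are bounded by the occurrences of x.\<close>
    let ?p = "\<lambda>i. if i < m then xs ! (m + i) else xs ! (i - m)"
    have sub: "N x \<subseteq> ?p ` {i. i < 2 * m \<and> xs ! i = x}"
    proof
      fix y assume "y \<in> N x"
      then obtain j where j: "j < m" "{xs ! j, xs ! (m + j)} = {x, y}"
        by (auto simp: N_def edge_at_def)
      hence "xs ! j = x \<and> xs ! (m + j) = y \<or> xs ! j = y \<and> xs ! (m + j) = x"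
        by (auto simp: doubleton_eq_iff)
      thus "y \<in> ?p ` {i. i < 2 * m \<and> xs ! i = x}"
      proof
        assume "xs ! j = x \<and> xs ! (m + j) = y"
        thus ?thesis using j by (intro image_eqI[of _ _ j]) auto
      next
        assume "xs ! j = y \<and> xs ! (m + j) = x"
        thus ?thesis using j by (intro image_eqI[of _ _ "m + j"]) auto
      qed
    qed
    show "finite (N x)" by (rule finite_subset[OF sub]) auto
    have "card (N x) \<le> card (?p ` {i. i < 2 * m \<and> xs ! i = x})"
      by (rule card_mono[OF _ sub]) auto
    also have "\<dots> \<le> card {i. i < 2 * m \<and> xs ! i = x}" by (rule card_image_le) auto
    finally show "card (N x) \<le> \<Delta>" using pos[of x] by simp
  qed
  have few: "card {l. l < m \<and> h l < 2 * m \<and> xs ! h l \<in> insert x (N x)} \<le> (\<Delta> + 1) * \<Delta>"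
    if "inj h" for h :: "nat \<Rightarrow> nat" and x
  proof -
    have "card {l. l < m \<and> h l < 2 * m \<and> xs ! h l \<in> insert x (N x)}
       \<le> card (\<Union>v\<in>insert x (N x). {l. l < m \<and> h l < 2 * m \<and> xs ! h l = v})"
      by (rule card_mono) (use N in auto)
    also have "\<dots> \<le> (\<Sum>v\<in>insert x (N x). card {l. l < m \<and> h l < 2 * m \<and> xs ! h l = v})"
      by (rule card_UN_le) (use N in auto)
    also have "\<dots> \<le> (\<Sum>v\<in>insert x (N x). \<Delta>)"
    proof (rule sum_mono)
      fix v
      have "card {l. l < m \<and> h l < 2 * m \<and> xs ! h l = v} =
          card (h ` {l. l < m \<and> h l < 2 * m \<and> xs ! h l = v})"
        by (rule card_image[symmetric]) (use that in \<open>auto simp: inj_on_def inj_def\<close>)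
      also have "\<dots> \<le> card {i. i < 2 * m \<and> xs ! i = v}" by (rule card_mono) auto
      finally show "card {l. l < m \<and> h l < 2 * m \<and> xs ! h l = v} \<le> \<Delta>" using pos[of v] by simp
    qed
    also have "\<dots> = card (insert x (N x)) * \<Delta>" by simp
    also have "\<dots> \<le> (\<Delta> + 1) * \<Delta>"
      using N[of x] by (intro mult_right_mono) (auto simp: card_insert_if)
    finally show ?thesis .
  qed
  \<comment> \<open>The counts behind the assumption on \<open>m\<close>: for each of
    \<open>F1\<close> and \<open>F2\<close> at most \<Delta> + 1 vertices are forbidden (an end and
    its neighbours), each occupying at most \<Delta> positions.\<close>
  define F1 where "F1 = {l. l < m \<and> m + l < 2 * m \<and> xs ! (m + l) \<in> insert a (N a)}"
  define F2 where "F2 = {l. l < m \<and> l < 2 * m \<and> xs ! l \<in> insert b (N b)}"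
  have F: "card F1 \<le> (\<Delta> + 1) * \<Delta>" "card F2 \<le> (\<Delta> + 1) * \<Delta>"
    unfolding F1_def F2_def using few[of "\<lambda>l. m + l" a] few[of "\<lambda>l. l" b] by (auto simp: inj_def)
  have "card (F1 \<union> F2 \<union> bad_idx m xs) \<le> card F1 + card F2 + card (bad_idx m xs)"
    by (meson add_le_mono card_Un_le le_refl order_trans)
  hence "card (F1 \<union> F2 \<union> bad_idx m xs) < card {..<m}" using F m by simp
  moreover have "finite (F1 \<union> F2 \<union> bad_idx m xs)" by (auto simp: F1_def F2_def)
  ultimately obtain l where l: "l < m" "l \<notin> F1" "l \<notin> F2" "l \<notin> bad_idx m xs"
    by (metis (no_types, lifting) UnCI card_mono leD lessThan_iff subsetI)
  define c d where "c = xs ! l" and "d = xs ! (m + l)"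
  define ys where "ys = swap_snd m k l xs"
  have lk: "l \<noteq> k" using l k by auto
  have cd: "c \<noteq> d" using l by (auto simp: bad_idx_def c_def d_def)
  have dN: "d \<noteq> a" "d \<notin> N a" and cN: "c \<noteq> b" "c \<notin> N b"
    using l by (auto simp: F1_def F2_def c_def d_def)
  have y: "ys ! j = xs ! j" if "j < m" for j
    using that len by (simp add: ys_def swap_snd_def nth_list_update)
  have y': "ys ! (m + j) = (if j = l then b else if j = k then d else xs ! (m + j))" if "j < m" for j
    using that len km l by (auto simp: ys_def swap_snd_def nth_list_update b_def d_def)
  have ek: "edge_at m ys k = {a, d}" and el: "edge_at m ys l = {c, b}"
    using y y' km l lk by (auto simp: edge_at_def a_def c_def)
  have ej: "edge_at m ys j = edge_at m xs j" if "j < m" "j \<noteq> k" "j \<noteq> l" for j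
    using y y' that by (auto simp: edge_at_def)
  have new_k: "edge_at m xs j \<noteq> {a, d}" if "j < m" for j
    using dN that by (auto simp: N_def)
  have new_l: "edge_at m xs j \<noteq> {c, b}" if "j < m" for j
    using cN that by (auto simp: N_def insert_commute)
  \<comment> \<open>The two new edges cannot coincide: as c and d differ, this would force a = c,
    and edge l itself would be {a, d}, against its choice.\<close>
  have kl: "{a, d} \<noteq> {c, b}"
  proof
    assume "{a, d} = {c, b}"
    hence "a = c \<or> d = c" by (auto simp: doubleton_eq_iff)
    hence "edge_at m xs l = {a, d}" using cd by (auto simp: edge_at_def c_def d_def)
    thus False using new_k l by auto
  qed
  have "k \<notin> bad_idx m ys"
  proof
    assume "k \<in> bad_idx m ys"
    then consider "ys ! k = ys ! (m + k)" | j where "j < m" "j \<noteq> k" "edge_at m ys j = {a, d}"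
      using ek by (auto simp: bad_idx_def)
    thus False
    proof cases
      case 1
      thus False using y y' km lk dN by (auto simp: a_def)
    next
      case 2
      thus False using ej[of j] el kl new_k by (cases "j = l") auto
    qed
  qed
  moreover have "bad_idx m ys \<subseteq> bad_idx m xs"
  proof
    fix i assume i: "i \<in> bad_idx m ys"
    hence im: "i < m" "i \<noteq> k" using \<open>k \<notin> bad_idx m ys\<close> by (auto simp: bad_idx_def)
    have il: "i \<noteq> l"
    proof
      assume "i = l"
      then consider "ys ! l = ys ! (m + l)" | j where "j < m" "j \<noteq> l" "edge_at m ys j = {c, b}"
        using el i by (auto simp: bad_idx_def)
      thus False
      proof cases
        case 1
        thus False using y y' l cN by (auto simp: c_def)
      next
        case 2
        thus False using ej[of j] ek kl new_l by (cases "j = k") auto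
      qed
    qed
    from i consider "ys ! i = ys ! (m + i)" | j where "j < m" "j \<noteq> i" "edge_at m ys j = edge_at m ys i"
      by (auto simp: bad_idx_def)
    thus "i \<in> bad_idx m xs"
    proof cases
      case 1
      thus ?thesis using y y' im il by (auto simp: bad_idx_def)
    next
      case 2
      have "j \<noteq> k" using 2 ek ej[of i] new_k[of i] im il by auto
      moreover have "j \<noteq> l" using 2 el ej[of i] new_l[of i] im il by auto
      ultimately show ?thesis using 2 ej[of i] ej[of j] im il by (auto simp: bad_idx_def)
    qed
  qed
  ultimately have "bad_idx m ys \<subset> bad_idx m xs" using k by auto
  thus ?thesis using that l ys_def by blast
qed

text \<open>A switching lowers the number of bad indices and is undone by the same pair (k, l).
  Hence words with at most b + 1 bad indices are images of words with at most b under one of m * m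
  switchings.\<close>

lemma card_few_bad_le:
  fixes A :: "nat multiset"
  assumes size: "size A = 2 * m" and deg: "\<And>v. count A v \<le> \<Delta>"
    and m: "m > 2 * ((\<Delta> + 1) * \<Delta>) + B"
  defines "P \<equiv> permutations_of_multiset A"
  assumes b: "b \<le> B"
  shows "card {xs \<in> P. card (bad_idx m xs) \<le> b} \<le> (m * m) ^ b * card {xs \<in> P. simple_word m xs}"
  using b
proof (induction b)
  case 0
  have "{xs \<in> P. card (bad_idx m xs) \<le> 0} = {xs \<in> P. simple_word m xs}"
    by (auto simp: simple_word_iff_bad)
  thus ?case by simp
next
  case (Suc b)
  let ?W = "\<lambda>b. {xs \<in> P. card (bad_idx m xs) \<le> b}"
  have P: "length xs = 2 * m" "mset xs = A" if "xs \<in> P" for xs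
    using that size by (auto simp: P_def permutations_of_multiset_def)
  have fin: "finite P" by (simp add: P_def)
  have "?W (Suc b) \<subseteq> (\<lambda>(ys, k, l). swap_snd m k l ys) ` (?W b \<times> {..<m} \<times> {..<m})"
  proof
    fix xs assume xs: "xs \<in> ?W (Suc b)"
    have "\<exists>k<m. \<exists>l<m. card (bad_idx m (swap_snd m k l xs)) \<le> b"
    proof (cases "card (bad_idx m xs) \<le> b")
      case True
      \<comment> \<open>Words that already have at most b bad indices are covered by the trivial
        switching.\<close>
      have "swap_snd m 0 0 xs = xs" by (simp add: swap_snd_def)
      moreover have "0 < m" using m by simp
      ultimately show ?thesis using True by metis
    next
      case False
      hence c: "card (bad_idx m xs) = Suc b" using xs by auto
      hence "bad_idx m xs \<noteq> {}" by force
      then obtain k where k: "k \<in> bad_idx m xs" by blast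
      obtain l where l: "l < m" "bad_idx m (swap_snd m k l xs) \<subset> bad_idx m xs"
        by (rule switching[of xs m \<Delta> k]) (use P xs deg k m c Suc.prems in auto)
      have "card (bad_idx m (swap_snd m k l xs)) < card (bad_idx m xs)"
        using l by (intro psubset_card_mono) auto
      moreover have "k < m" using k by (simp add: bad_idx_def)
      ultimately show ?thesis using c l by (metis less_Suc_eq_le)
    qed
    then obtain k l where kl: "k < m" "l < m" "card (bad_idx m (swap_snd m k l xs)) \<le> b" by blast
    have "swap_snd m k l xs \<in> P"
      using mset_swap_snd[of xs m k l] P[of xs] xs kl by (simp add: P_def permutations_of_multiset_def)
    thus "xs \<in> (\<lambda>(ys, k, l). swap_snd m k l ys) ` (?W b \<times> {..<m} \<times> {..<m})"
      using swap_snd_swap_snd[of xs m k l] P[of xs] xs kl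
      by (intro image_eqI[of _ _ "(swap_snd m k l xs, k, l)"]) auto
  qed
  hence "card (?W (Suc b)) \<le> card ((\<lambda>(ys, k, l). swap_snd m k l ys) ` (?W b \<times> {..<m} \<times> {..<m}))"
    by (rule card_mono[rotated]) (use fin in auto)
  also have "\<dots> \<le> card (?W b \<times> {..<m} \<times> {..<m})"
    by (rule card_image_le) (use fin in auto)
  also have "\<dots> = (m * m) * card (?W b)"
    by (simp add: card_cartesian_product)
  also have "\<dots> \<le> (m * m) * ((m * m) ^ b * card {xs \<in> P. simple_word m xs})"
    using Suc by (intro mult_left_mono) auto
  finally show ?case by (simp add: mult_ac)
qed

text \<open>
  Exchangeability of the positions in \<open>L\<close> turns a count over words into a count over positions.
\<close>

lemma card_coincidence_le:
  fixes X :: "nat list set"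
  assumes fin: "finite X" "finite L"
    and len: "\<And>xs. xs \<in> X \<Longrightarrow> length xs = N"
    and deg: "\<And>xs v. xs \<in> X \<Longrightarrow> count (mset xs) v \<le> \<Delta>"
    and swap: "\<And>xs i j. xs \<in> X \<Longrightarrow> i \<in> L \<Longrightarrow> j \<in> L \<Longrightarrow> xs[i := xs ! j, j := xs ! i] \<in> X"
    and L: "L \<subseteq> {..<N}" "k \<notin> L" "l \<in> L"
  shows "card L * card {xs \<in> X. xs ! l = xs ! k} \<le> \<Delta> * card X"
proof -
  let ?s = "\<lambda>i j (xs :: nat list). xs[i := xs ! j, j := xs ! i]"
  have le: "card {xs \<in> X. xs ! i = xs ! k} \<le> card {xs \<in> X. xs ! j = xs ! k}"
    if ij: "i \<in> L" "j \<in> L" for i j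
  proof (rule card_inj_on_le[of "?s i j"])
    have inv: "?s i j (?s i j xs) = xs" if "xs \<in> X" for xs
    proof -
      have "i < length xs" "j < length xs" using len[OF that] ij L by auto
      thus ?thesis by (cases "i = j") (auto intro!: nth_equalityI simp: nth_list_update)
    qed
    show "inj_on (?s i j) {xs \<in> X. xs ! i = xs ! k}"
      by (rule inj_on_inverseI[of _ "?s i j"]) (rule inv, simp)
    show "?s i j ` {xs \<in> X. xs ! i = xs ! k} \<subseteq> {xs \<in> X. xs ! j = xs ! k}"
    proof clarify
      fix xs assume xs: "xs \<in> X" "xs ! i = xs ! k"
      have "j < length xs" "k \<noteq> i" "k \<noteq> j" using ij L len[OF xs(1)] by auto
      thus "?s i j xs \<in> X \<and> ?s i j xs ! j = ?s i j xs ! k"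
        using xs swap[OF xs(1) ij] by simp
    qed
  qed (use fin in auto)
  have "card L * card {xs \<in> X. xs ! l = xs ! k} = (\<Sum>i\<in>L. card {xs \<in> X. xs ! l = xs ! k})"
    by simp
  also have "\<dots> = (\<Sum>i\<in>L. card {xs \<in> X. xs ! i = xs ! k})"
    using le L by (intro sum.cong refl antisym) auto
  also have "\<dots> = (\<Sum>i\<in>L. \<Sum>xs\<in>X. if xs ! i = xs ! k then 1 else 0)"
    using fin by (intro sum.cong refl) (simp add: sum.If_cases Int_def)
  also have "\<dots> = (\<Sum>xs\<in>X. \<Sum>i\<in>L. if xs ! i = xs ! k then 1 else 0)"
    by (rule sum.swap)
  also have "\<dots> = (\<Sum>xs\<in>X. card {i \<in> L. xs ! i = xs ! k})"
    using fin by (intro sum.cong refl) (simp add: sum.If_cases Int_def)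
  also have "\<dots> \<le> (\<Sum>xs\<in>X. \<Delta>)"
  proof (rule sum_mono)
    fix xs assume xs: "xs \<in> X"
    have "card {i \<in> L. xs ! i = xs ! k} \<le> card {i. i < length xs \<and> xs ! i = xs ! k}"
      by (rule card_mono) (use L len[OF xs] in auto)
    thus "card {i \<in> L. xs ! i = xs ! k} \<le> \<Delta>" using deg[OF xs, of "xs ! k"] by (simp add: count_mset_nth)
  qed
  finally show ?thesis by (simp add: mult.commute)
qed

text \<open>First moment of the number of bad indices in a uniform word. A loop at a given index has
  probability at most \<Delta> / (2m - 1), and a coincidence of two given edges, in either
  orientation, at most \<Delta>^2 / ((2m - 1)(2m - 3)). Summing contributes \<Delta>^2 for loops and
  2 \<Delta>^2 for repeated edges.\<close>

lemma sum_card_bad_le: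
  fixes A :: "nat multiset"
  assumes size: "size A = 2 * m" and deg: "\<And>v. count A v \<le> \<Delta>" and m: "m \<ge> 2" and D: "\<Delta> \<ge> 1"
  defines "P \<equiv> permutations_of_multiset A"
  shows "(\<Sum>xs\<in>P. card (bad_idx m xs)) \<le> 3 * \<Delta>\<^sup>2 * card P"
proof -
  have P: "length xs = 2 * m" "mset xs = A" if "xs \<in> P" for xs
    using that size by (auto simp: P_def permutations_of_multiset_def)
  have fin: "finite P" by (simp add: P_def)
  have swapP: "xs[i := xs ! j, j := xs ! i] \<in> P" if "xs \<in> P" "i < 2 * m" "j < 2 * m" for xs i j
    using that P[of xs] mset_swap[of j xs i] by (simp add: P_def permutations_of_multiset_def)
  have e2: "real (card {xs \<in> P. xs ! i = xs ! j}) \<le> real \<Delta> * real (card P) / (2 * real m - 1)"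
    if "i < 2 * m" "j < 2 * m" "i \<noteq> j" for i j
  proof -
    have "card ({..<2 * m} - {j}) * card {xs \<in> P. xs ! i = xs ! j} \<le> \<Delta> * card P"
      by (rule card_coincidence_le[where N = "2 * m"]) (use that P deg fin swapP in auto)
    also have "card ({..<2 * m} - {j}) = 2 * m - 1" using that by (subst card_Diff_subset) auto
    finally have "real ((2 * m - 1) * card {xs \<in> P. xs ! i = xs ! j}) \<le> real (\<Delta> * card P)"
      by (rule of_nat_mono)
    thus ?thesis using m by (simp add: field_simps of_nat_diff)
  qed
  \<comment> \<open>The first coincidence freezes i and j, and l is the reference position for k;
    the remaining 2m - 3 positions are still exchangeable.\<close>
  have e4: "real (card {xs \<in> P. xs ! i = xs ! j \<and> xs ! k = xs ! l}) \<le>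
      real \<Delta> * (real \<Delta> * real (card P) / (2 * real m - 1)) / (2 * real m - 3)"
    if d: "distinct [i, j, k, l]" "set [i, j, k, l] \<subseteq> {..<2 * m}" for i j k l
  proof -
    have eq: "{xs \<in> {xs \<in> P. xs ! i = xs ! j}. xs ! k = xs ! l} = {xs \<in> P. xs ! i = xs ! j \<and> xs ! k = xs ! l}"
      by auto
    have "card ({..<2 * m} - {i, j, l}) * card {xs \<in> {xs \<in> P. xs ! i = xs ! j}. xs ! k = xs ! l}
        \<le> \<Delta> * card {xs \<in> P. xs ! i = xs ! j}"
    proof (rule card_coincidence_le[where N = "2 * m"])
      fix xs i' j' assume *: "xs \<in> {xs \<in> P. xs ! i = xs ! j}"
        "i' \<in> {..<2 * m} - {i, j, l}" "j' \<in> {..<2 * m} - {i, j, l}"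
      thus "xs[i' := xs ! j', j' := xs ! i'] \<in> {xs \<in> P. xs ! i = xs ! j}"
        using swapP[of xs i' j'] by auto
    qed (use that P deg fin in auto)
    also have "card ({..<2 * m} - {i, j, l}) = 2 * m - 3" using d by (subst card_Diff_subset) auto
    finally have "real ((2 * m - 3) * card {xs \<in> P. xs ! i = xs ! j \<and> xs ! k = xs ! l})
        \<le> real (\<Delta> * card {xs \<in> P. xs ! i = xs ! j})"
      unfolding eq by (rule of_nat_mono)
    hence "real (card {xs \<in> P. xs ! i = xs ! j \<and> xs ! k = xs ! l}) \<le>
        \<Delta> * real (card {xs \<in> P. xs ! i = xs ! j}) / (2 * real m - 3)"
      using m by (simp add: field_simps of_nat_diff)
    also have "\<dots> \<le> real \<Delta> * (real \<Delta> * real (card P) / (2 * real m - 1)) / (2 * real m - 3)"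
      using m d by (intro divide_right_mono mult_left_mono e2) auto
    finally show ?thesis .
  qed
  let ?I = "\<lambda>Q. if Q then 1 else 0 :: nat"
  \<comment> \<open>A union bound: two edges agree as unordered pairs either straight or
    crossed.\<close>
  have bad: "card (bad_idx m xs) \<le> (\<Sum>k<m. ?I (xs ! k = xs ! (m + k))) +
      (\<Sum>k<m. \<Sum>l\<in>{..<m} - {k}. ?I (xs ! k = xs ! l \<and> xs ! (m + k) = xs ! (m + l)) +
         ?I (xs ! k = xs ! (m + l) \<and> xs ! (m + k) = xs ! l))" for xs
  proof -
    let ?g = "\<lambda>k l. ?I (xs ! k = xs ! l \<and> xs ! (m + k) = xs ! (m + l)) +
         ?I (xs ! k = xs ! (m + l) \<and> xs ! (m + k) = xs ! l)"
    have "card (bad_idx m xs) = (\<Sum>k<m. ?I (k \<in> bad_idx m xs))"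
      by (subst sum.If_cases) (auto intro!: arg_cong[of _ _ card] simp: bad_idx_def)
    also have "\<dots> \<le> (\<Sum>k<m. ?I (xs ! k = xs ! (m + k)) + (\<Sum>l\<in>{..<m} - {k}. ?g k l))"
    proof (rule sum_mono)
      fix k assume k: "k \<in> {..<m}"
      show "?I (k \<in> bad_idx m xs) \<le> ?I (xs ! k = xs ! (m + k)) + (\<Sum>l\<in>{..<m} - {k}. ?g k l)"
      proof (cases "k \<in> bad_idx m xs \<and> xs ! k \<noteq> xs ! (m + k)")
        case True
        then obtain l where l: "l < m" "l \<noteq> k" "edge_at m xs l = edge_at m xs k"
          by (auto simp: bad_idx_def)
        hence "?g k l \<ge> 1" by (auto simp: edge_at_def doubleton_eq_iff)
        also have "?g k l \<le> (\<Sum>l\<in>{..<m} - {k}. ?g k l)"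
          using l by (intro member_le_sum) auto
        finally show ?thesis using True by simp
      qed auto
    qed
    finally show ?thesis by (simp add: sum.distrib)
  qed
  have card_eq: "(\<Sum>xs\<in>P. real (?I (Q xs))) = real (card {xs \<in> P. Q xs})" for Q
    using fin by (simp add: sum.If_cases Int_def flip: of_nat_sum)
  define c where "c = real \<Delta> * (real \<Delta> * real (card P) / (2 * real m - 1)) / (2 * real m - 3)"
  have "real (\<Sum>xs\<in>P. card (bad_idx m xs)) \<le> (\<Sum>xs\<in>P. real ((\<Sum>k<m. ?I (xs ! k = xs ! (m + k))) +
      (\<Sum>k<m. \<Sum>l\<in>{..<m} - {k}. ?I (xs ! k = xs ! l \<and> xs ! (m + k) = xs ! (m + l)) +
         ?I (xs ! k = xs ! (m + l) \<and> xs ! (m + k) = xs ! l))))"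
    unfolding of_nat_sum by (intro sum_mono of_nat_mono bad)
  also have "\<dots> = (\<Sum>k<m. \<Sum>xs\<in>P. real (?I (xs ! k = xs ! (m + k)))) +
      (\<Sum>k<m. \<Sum>l\<in>{..<m} - {k}. (\<Sum>xs\<in>P. real (?I (xs ! k = xs ! l \<and> xs ! (m + k) = xs ! (m + l)))) +
         (\<Sum>xs\<in>P. real (?I (xs ! k = xs ! (m + l) \<and> xs ! (m + k) = xs ! l))))"
    unfolding of_nat_add of_nat_sum sum.distrib sum.swap[of _ _ P] by simp
  also have "\<dots> \<le> (\<Sum>k<m. real \<Delta> * real (card P) / (2 * real m - 1)) + (\<Sum>k<m. \<Sum>l\<in>{..<m} - {k}. c + c)"
    unfolding card_eq
  proof (intro add_mono sum_mono)
    fix k assume k: "k \<in> {..<m}"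
    thus "real (card {xs \<in> P. xs ! k = xs ! (m + k)}) \<le> real \<Delta> * real (card P) / (2 * real m - 1)"
      using e2[of k "m + k"] m by auto
    fix l assume l: "l \<in> {..<m} - {k}"
    show "real (card {xs \<in> P. xs ! k = xs ! l \<and> xs ! (m + k) = xs ! (m + l)}) \<le> c"
      unfolding c_def by (rule e4) (use k l in auto)
    show "real (card {xs \<in> P. xs ! k = xs ! (m + l) \<and> xs ! (m + k) = xs ! l}) \<le> c"
      unfolding c_def by (rule e4) (use k l in auto)
  qed
  also have "\<dots> = real m * (real \<Delta> * real (card P) / (2 * real m - 1)) + real m * ((real m - 1) * (2 * c))"
    using m by (simp add: card_Diff_subset of_nat_diff)
  also have "\<dots> \<le> real (\<Delta>\<^sup>2 * card P) + real (2 * \<Delta>\<^sup>2 * card P)"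
  proof (rule add_mono)
    have "real m * (real \<Delta> * real (card P) / (2 * real m - 1)) = (m / (2 * real m - 1)) * (real \<Delta> * real (card P))" by simp
    also have "\<dots> \<le> 1 * (real (\<Delta>\<^sup>2) * card P)"
      using m D by (intro mult_mono mult_right_mono) (auto simp: power2_eq_square divide_simps)
    finally show "real m * (real \<Delta> * real (card P) / (2 * real m - 1)) \<le> real (\<Delta>\<^sup>2 * card P)" by simp
    have "2 * real m * (real m - 1) \<le> 2 * ((2 * real m - 1) * (2 * real m - 3))"
    proof -
      obtain j where "m = j + 2" using m by (metis add.commute le_Suc_ex)
      thus ?thesis by (simp add: algebra_simps)
    qed
    hence q: "2 * real m * (real m - 1) / ((2 * real m - 1) * (2 * real m - 3)) \<le> 2"
      using m by (subst pos_divide_le_eq) auto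
    have "real m * ((real m - 1) * (2 * c)) = 2 * real m * (real m - 1) / ((2 * real m - 1) * (2 * real m - 3)) * real (\<Delta>\<^sup>2 * card P)"
      using m by (simp add: c_def power2_eq_square field_simps of_nat_diff)
    also have "\<dots> \<le> 2 * real (\<Delta>\<^sup>2 * card P)"
      by (intro mult_right_mono q) auto
    finally show "real m * ((real m - 1) * (2 * c)) \<le> real (2 * \<Delta>\<^sup>2 * card P)" by simp
  qed
  finally have "real (\<Sum>xs\<in>P. card (bad_idx m xs)) \<le> real (3 * \<Delta>\<^sup>2 * card P)" by (simp add: mult_ac)
  thus ?thesis by (simp only: of_nat_le_iff)
qed

text \<open>The threshold \<open>B\<close> is twice the mean 3 \<Delta>^2, so by Markov's inequality
  at least half of the words have at most \<open>B\<close> bad indices. Removing these costs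
  (m^2)^B, which is the exponent 12 \<Delta>^2.\<close>

lemma card_le_simple_words:
  fixes A :: "nat multiset"
  assumes size: "size A = 2 * m" and deg: "\<And>v. count A v \<le> \<Delta>" and D: "\<Delta> \<ge> 1"
    and m: "m > 2 * ((\<Delta> + 1) * \<Delta>) + 6 * \<Delta>\<^sup>2"
  defines "P \<equiv> permutations_of_multiset A"
  shows "card P \<le> 2 * m ^ (12 * \<Delta>\<^sup>2) * card {xs \<in> P. simple_word m xs}"
proof -
  define B where "B = 6 * \<Delta>\<^sup>2"
  have fin: "finite P" by (simp add: P_def)
  have "m \<ge> 2" using m D by (cases \<Delta>) auto
  have "B * card {xs \<in> P. card (bad_idx m xs) > B} = (\<Sum>xs\<in>{xs \<in> P. card (bad_idx m xs) > B}. B)"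
    by simp
  also have "\<dots> \<le> (\<Sum>xs\<in>{xs \<in> P. card (bad_idx m xs) > B}. card (bad_idx m xs))"
    by (intro sum_mono) auto
  also have "\<dots> \<le> (\<Sum>xs\<in>P. card (bad_idx m xs))"
    using fin by (intro sum_mono2) auto
  also have "\<dots> \<le> 3 * \<Delta>\<^sup>2 * card P"
    unfolding P_def by (rule sum_card_bad_le[OF size deg \<open>m \<ge> 2\<close> D])
  finally have "B * card {xs \<in> P. card (bad_idx m xs) > B} \<le> 3 * \<Delta>\<^sup>2 * card P" .
  hence few: "2 * card {xs \<in> P. card (bad_idx m xs) > B} \<le> card P" using D by (simp add: B_def)
  have "card P = card ({xs \<in> P. card (bad_idx m xs) > B} \<union> {xs \<in> P. card (bad_idx m xs) \<le> B})"
    by (intro arg_cong[of _ _ card]) auto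
  also have "\<dots> \<le> card {xs \<in> P. card (bad_idx m xs) > B} + card {xs \<in> P. card (bad_idx m xs) \<le> B}"
    by (rule card_Un_le)
  finally have "card P \<le> 2 * card {xs \<in> P. card (bad_idx m xs) \<le> B}" using few by simp
  also have "\<dots> \<le> 2 * ((m * m) ^ B * card {xs \<in> P. simple_word m xs})"
    unfolding P_def using size deg m by (intro mult_left_mono card_few_bad_le[of A m \<Delta> B B]) (auto simp: B_def)
  also have "(m * m) ^ B = m ^ (12 * \<Delta>\<^sup>2)"
    by (simp add: B_def power_mult power2_eq_square flip: power_mult_distrib) (simp add: mult.commute flip: power_mult power_add power2_eq_square)
  finally show ?thesis by (simp add: mult_ac)
qed

section \<open>Degree sequences and the random graph\<close>

definition degree_mset :: "nat \<Rightarrow> (nat \<Rightarrow> nat) \<Rightarrow> nat multiset" where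
  "degree_mset n d = (\<Sum>v<n. replicate_mset (d v) v)"

lemma count_degree_mset: "count (degree_mset n d) v = (if v < n then d v else 0)"
  by (simp add: degree_mset_def count_sum)

lemma size_degree_mset: "size (degree_mset n d) = (\<Sum>v<n. d v)"
  by (simp add: degree_mset_def size_multiset_sum)

lemma set_degree_mset: "set_mset (degree_mset n d) \<subseteq> {..<n}"
  by (auto simp: count_degree_mset simp flip: count_greater_zero_iff split: if_splits)

lemma card_permutations_degree_mset:
  "real (card (permutations_of_multiset (degree_mset n d))) =
     fact (\<Sum>v<n. d v) / (\<Prod>v<n. fact (d v))"
proof -
  let ?A = "degree_mset n d"
  have "(\<Prod>x\<in>set_mset ?A. fact (count ?A x)) = (\<Prod>x<n. fact (count ?A x) :: nat)"
    using set_degree_mset[of n d] by (intro prod.mono_neutral_left) (auto simp: not_in_iff)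
  also have "\<dots> = (\<Prod>x<n. fact (d x))" by (intro prod.cong) (auto simp: count_degree_mset)
  finally have "card (permutations_of_multiset ?A) * (\<Prod>x<n. fact (d x)) = fact (\<Sum>v<n. d v)"
    using card_permutations_of_multiset_aux[of ?A] by (simp add: size_degree_mset)
  from arg_cong[OF this, of real]
  have "real (card (permutations_of_multiset ?A)) * (\<Prod>x<n. fact (d x)) = fact (\<Sum>v<n. d v)"
    by simp
  thus ?thesis by (simp add: field_simps)
qed

text \<open>Made extensional, so that degree sequences are elements of \<open>PiE\<close> and equal
  as functions once they agree on the vertices.\<close>

definition deg_fun :: "nat \<Rightarrow> nat set set \<Rightarrow> nat \<Rightarrow> nat" where
  "deg_fun n G = restrict (vdegree G) {..<n}"

lemma graphs_with_degrees_eq: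
  assumes "d \<in> extensional {..<n}"
  shows "graphs_with_degrees n (degree_mset n d) = {G. G \<subseteq> all_edges n \<and> deg_fun n G = d}"
proof (intro set_eqI iffI)
  fix G assume "G \<in> {G. G \<subseteq> all_edges n \<and> deg_fun n G = d}"
  thus "G \<in> graphs_with_degrees n (degree_mset n d)"
    by (auto simp: graphs_with_degrees_def count_degree_mset deg_fun_def vdegree_eq_0)
next
  fix G assume "G \<in> graphs_with_degrees n (degree_mset n d)"
  hence G: "G \<subseteq> all_edges n" "\<And>v. v < n \<Longrightarrow> vdegree G v = d v"
    by (auto simp: graphs_with_degrees_def count_degree_mset)
  have "deg_fun n G = d"
    unfolding deg_fun_def by (rule extensionalityI[of _ "{..<n}"]) (use G assms in auto)
  thus "G \<in> {G. G \<subseteq> all_edges n \<and> deg_fun n G = d}" using G by simp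
qed

text \<open>Also (2m - 1)!!, the number of perfect matchings of 2m half-edges.\<close>

definition gauss_moment :: "nat \<Rightarrow> real" where
  "gauss_moment m = fact (2 * m) / (2 ^ m * fact m)"

lemma gauss_moment_pos: "gauss_moment m > 0" by (simp add: gauss_moment_def)

lemma card_graphs_with_degrees_le:
  assumes "(\<Sum>v<n. d v) = 2 * m"
  shows "real (card (graphs_with_degrees n (degree_mset n d))) \<le> gauss_moment m / (\<Prod>v<n. fact (d v))"
proof -
  let ?A = "degree_mset n d"
  have "card (graphs_with_degrees n ?A) * (2 ^ m * fact m) \<le> card (permutations_of_multiset ?A)"
    by (subst card_simple_words[symmetric])
      (use assms set_degree_mset in \<open>auto simp: size_degree_mset intro!: card_mono\<close>)
  hence "real (card (graphs_with_degrees n ?A) * (2 ^ m * fact m)) \<le> real (card (permutations_of_multiset ?A))"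
    by (rule of_nat_mono)
  hence h: "real (card (graphs_with_degrees n ?A)) * (2 ^ m * fact m) \<le> fact (2 * m) / (\<Prod>v<n. fact (d v))"
    unfolding card_permutations_degree_mset assms by simp
  have K: "(2 ^ m * fact m :: real) > 0" by simp
  have "gauss_moment m / (\<Prod>v<n. fact (d v)) = fact (2 * m) / (\<Prod>v<n. fact (d v)) / (2 ^ m * fact m)"
    by (simp add: gauss_moment_def)
  thus ?thesis using h by (simp only: pos_le_divide_eq[OF K])
qed

lemma le_card_graphs_with_degrees:
  assumes "(\<Sum>v<n. d v) = 2 * m" "\<And>v. v < n \<Longrightarrow> d v \<le> \<Delta>" "\<Delta> \<ge> 1"
    and "m > 2 * ((\<Delta> + 1) * \<Delta>) + 6 * \<Delta>\<^sup>2"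
  shows "gauss_moment m / (\<Prod>v<n. fact (d v)) \<le>
    2 * real m ^ (12 * \<Delta>\<^sup>2) * real (card (graphs_with_degrees n (degree_mset n d)))"
proof -
  let ?A = "degree_mset n d"
  have "card (permutations_of_multiset ?A) \<le>
      2 * m ^ (12 * \<Delta>\<^sup>2) * (card (graphs_with_degrees n ?A) * (2 ^ m * fact m))"
    by (subst card_simple_words[symmetric, OF set_degree_mset], simp add: size_degree_mset assms)
      (intro card_le_simple_words; use assms in \<open>auto simp: size_degree_mset count_degree_mset\<close>)
  hence "real (card (permutations_of_multiset ?A)) \<le>
      real (2 * m ^ (12 * \<Delta>\<^sup>2) * (card (graphs_with_degrees n ?A) * (2 ^ m * fact m)))"
    by (rule of_nat_mono)
  hence h: "fact (2 * m) / (\<Prod>v<n. fact (d v)) \<le>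
      2 * real m ^ (12 * \<Delta>\<^sup>2) * real (card (graphs_with_degrees n ?A)) * (2 ^ m * fact m)"
    unfolding card_permutations_degree_mset assms by (simp add: mult_ac)
  have K: "(2 ^ m * fact m :: real) > 0" by simp
  have "gauss_moment m / (\<Prod>v<n. fact (d v)) = fact (2 * m) / (\<Prod>v<n. fact (d v)) / (2 ^ m * fact m)"
    by (simp add: gauss_moment_def)
  thus ?thesis using h by (simp only: pos_divide_le_eq[OF K])
qed

section \<open>The law of the random graph as a weight in the odds q\<close>

lemma pmf_gnp:
  assumes p: "0 < p" "p < 1" and G: "G \<subseteq> all_edges n"
  shows "pmf (gnp n p) G = (1 - p) ^ (n choose 2) * (p / (1 - p)) ^ card G"
proof -
  let ?E = "all_edges n" and ?P = "Pi_pmf (all_edges n) False (\<lambda>_. bernoulli_pmf p)"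
  let ?f = "\<lambda>e. e \<in> G"
  have supp: "set_pmf ?P = PiE_dflt ?E False (\<lambda>_. UNIV)"
    using p by (subst set_Pi_pmf) (auto simp: comp_def PiE_dflt_def)
  have "inj_on (\<lambda>f. {e \<in> ?E. f e}) (set_pmf ?P)"
    unfolding supp by (auto simp: inj_on_def PiE_dflt_def fun_eq_iff)
  moreover have "?f \<in> set_pmf ?P" unfolding supp using G by (auto simp: PiE_dflt_def)
  ultimately have "pmf (gnp n p) {e \<in> ?E. ?f e} = pmf ?P ?f"
    unfolding gnp_def by (rule pmf_map_inj)
  moreover have "{e \<in> ?E. ?f e} = G" using G by auto
  moreover have "pmf ?P ?f = (\<Prod>e\<in>?E. if e \<in> G then p else 1 - p)"
    using p G by (subst pmf_Pi') (auto intro!: prod.cong)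
  moreover have "\<dots> = p ^ card G * (1 - p) ^ card (?E - G)"
    using G by (simp add: prod.If_cases Int_absorb1 Diff_eq Compl_eq)
  moreover have "card (?E - G) = (n choose 2) - card G"
    using G finite_subset[OF G] by (simp add: card_Diff_subset card_all_edges)
  moreover have "card G \<le> n choose 2"
    using G by (metis card_all_edges card_mono finite_all_edges)
  ultimately show ?thesis using p by (simp add: power_divide power_diff)
qed

definition graph_weight :: "real \<Rightarrow> nat set set set \<Rightarrow> real" where
  "graph_weight q X = (\<Sum>G\<in>X. q ^ card G)"

lemma prob_gnp:
  assumes "0 < p" "p < 1" "X \<subseteq> Pow (all_edges n)"
  shows "measure_pmf.prob (gnp n p) X = (1 - p) ^ (n choose 2) * graph_weight (p / (1 - p)) X"
proof -
  have "finite X" by (rule finite_subset[OF assms(3)]) simp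
  hence "measure_pmf.prob (gnp n p) X = (\<Sum>G\<in>X. pmf (gnp n p) G)"
    by (rule measure_measure_pmf_finite)
  also have "\<dots> = (\<Sum>G\<in>X. (1 - p) ^ (n choose 2) * (p / (1 - p)) ^ card G)"
    by (intro sum.cong refl pmf_gnp) (use assms in auto)
  finally show ?thesis by (simp add: graph_weight_def sum_distrib_left)
qed

text \<open>All graphs on n vertices share the factor (1 - p)^(n choose 2); it cancels, and
  conditional probabilities become quotients of weights in q = p / (1 - p).\<close>

lemma prob_gnpS:
  assumes p: "0 < p" "p < 1" and ne: "S_graphs S n \<noteq> {}"
  shows "measure_pmf.prob (gnpS n p S) X =
    graph_weight (p / (1 - p)) (X \<inter> S_graphs S n) / graph_weight (p / (1 - p)) (S_graphs S n)"
proof -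
  have sub: "S_graphs S n \<subseteq> Pow (all_edges n)" by (auto simp: S_graphs_def)
  have "set_pmf (gnp n p) \<inter> S_graphs S n \<noteq> {}"
  proof -
    obtain G where G: "G \<in> S_graphs S n" using ne by blast
    hence "pmf (gnp n p) G > 0" using p sub by (subst pmf_gnp) auto
    hence "G \<in> set_pmf (gnp n p)" by (simp add: set_pmf_iff)
    thus ?thesis using G by blast
  qed
  note ne' = this
  let ?Y = "X \<inter> S_graphs S n"
  have "measure_pmf.prob (gnpS n p S) X = measure_pmf.prob (gnpS n p S) (X \<inter> set_pmf (gnpS n p S))"
    by (rule measure_Int_set_pmf[symmetric])
  also have "X \<inter> set_pmf (gnpS n p S) = ?Y \<inter> set_pmf (gnpS n p S)"
    using ne' by (auto simp: gnpS_def set_cond_pmf)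
  also have "measure_pmf.prob (gnpS n p S) \<dots> = measure_pmf.prob (gnpS n p S) ?Y"
    by (rule measure_Int_set_pmf)
  also have "\<dots> = (\<Sum>G\<in>?Y. pmf (gnpS n p S) G)"
    by (rule measure_measure_pmf_finite) simp
  also have "\<dots> = (\<Sum>G\<in>?Y. pmf (gnp n p) G / measure_pmf.prob (gnp n p) (S_graphs S n))"
    using ne' by (intro sum.cong refl) (simp add: gnpS_def pmf_cond)
  also have "\<dots> = measure_pmf.prob (gnp n p) ?Y / measure_pmf.prob (gnp n p) (S_graphs S n)"
    by (subst measure_measure_pmf_finite[of ?Y]) (simp_all add: sum_divide_distrib)
  also have "measure_pmf.prob (gnp n p) ?Y = (1 - p) ^ (n choose 2) * graph_weight (p / (1 - p)) ?Y"
    using p sub by (intro prob_gnp) auto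
  also have "measure_pmf.prob (gnp n p) (S_graphs S n) =
      (1 - p) ^ (n choose 2) * graph_weight (p / (1 - p)) (S_graphs S n)"
    using p sub by (intro prob_gnp) auto
  finally show ?thesis using p by simp
qed

text \<open>For \<open>D\<close> consisting of sequences with values in S, the quotient by
  \<open>phi S x ^ n\<close> is the probability that n independent degrees with law Po_S(x) form a
  sequence in \<open>D\<close>.\<close>

definition deg_poly :: "nat \<Rightarrow> (nat \<Rightarrow> nat) set \<Rightarrow> real \<Rightarrow> real" where
  "deg_poly n D x = (\<Sum>d\<in>D. x ^ (\<Sum>v<n. d v) / (\<Prod>v<n. fact (d v)))"

text \<open>The graph weight with the number of simple graphs of each degree sequence replaced by
  its configuration count, loops and repeated edges included.\<close>

definition config_weight :: "nat \<Rightarrow> real \<Rightarrow> (nat \<Rightarrow> nat) set \<Rightarrow> real" where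
  "config_weight n q D = (\<Sum>d\<in>D. if even (\<Sum>v<n. d v)
     then q ^ ((\<Sum>v<n. d v) div 2) * gauss_moment ((\<Sum>v<n. d v) div 2) / (\<Prod>v<n. fact (d v)) else 0)"

text \<open>
  Odd Gaussian moments vanish, so only the even part of \<open>deg_poly\<close> enters.
\<close>

lemma has_bochner_integral_config_weight:
  assumes "q \<ge> 0"
  shows "has_bochner_integral lborel
    (\<lambda>z. std_normal_density z * ((deg_poly n D (sqrt q * z) + deg_poly n D (- (sqrt q * z))) / 2))
    (config_weight n q D)"
proof -
  have *: "has_bochner_integral lborel
    (\<lambda>z. std_normal_density z * (((sqrt q * z) ^ N + (- (sqrt q * z)) ^ N) / 2))
    (if even N then q ^ (N div 2) * gauss_moment (N div 2) else 0)" for N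
  proof (cases "even N")
    case True
    then obtain m where m: "N = 2 * m" by auto
    have "has_bochner_integral lborel (\<lambda>z. q ^ m * (std_normal_density z * z ^ (2 * m))) (q ^ m * gauss_moment m)"
      unfolding gauss_moment_def by (intro has_bochner_integral_mult_right std_normal_moment_even)
    moreover have "std_normal_density z * (((sqrt q * z) ^ N + (- (sqrt q * z)) ^ N) / 2) =
        q ^ m * (std_normal_density z * z ^ (2 * m))" for z
      using assms by (simp add: m power_mult_distrib) (simp add: power_mult)
    ultimately have "has_bochner_integral lborel
      (\<lambda>z. std_normal_density z * (((sqrt q * z) ^ N + (- (sqrt q * z)) ^ N) / 2)) (q ^ m * gauss_moment m)"
      by presburger
    thus ?thesis by (simp add: m)
  next
    case False
    hence "((sqrt q * z) ^ N + (- (sqrt q * z)) ^ N) = 0" for z by simp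
    thus ?thesis using False by (simp add: has_bochner_integral_zero)
  qed
  have "has_bochner_integral lborel
    (\<lambda>z. \<Sum>d\<in>D. (std_normal_density z * (((sqrt q * z) ^ (\<Sum>v<n. d v) + (- (sqrt q * z)) ^ (\<Sum>v<n. d v)) / 2)) / (\<Prod>v<n. fact (d v)))
    (\<Sum>d\<in>D. (if even (\<Sum>v<n. d v) then q ^ ((\<Sum>v<n. d v) div 2) * gauss_moment ((\<Sum>v<n. d v) div 2) else 0) / (\<Prod>v<n. fact (d v)))"
    by (intro has_bochner_integral_sum has_bochner_integral_divide_zero *)
  moreover have "(\<Sum>d\<in>D. (std_normal_density z * (((sqrt q * z) ^ (\<Sum>v<n. d v) + (- (sqrt q * z)) ^ (\<Sum>v<n. d v)) / 2)) / (\<Prod>v<n. fact (d v)))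
    = std_normal_density z * ((deg_poly n D (sqrt q * z) + deg_poly n D (- (sqrt q * z))) / 2)" for z
    unfolding deg_poly_def sum.distrib[symmetric] sum_divide_distrib sum_distrib_left
    by (intro sum.cong refl) (simp add: field_simps)
  moreover have "(\<Sum>d\<in>D. (if even (\<Sum>v<n. d v) then q ^ ((\<Sum>v<n. d v) div 2) * gauss_moment ((\<Sum>v<n. d v) div 2) else 0) / (\<Prod>v<n. fact (d v)))
    = config_weight n q D"
    unfolding config_weight_def by (intro sum.cong) auto
  ultimately show ?thesis by (simp only:)
qed

lemma sum_deg_fun:
  assumes "G \<subseteq> all_edges n"
  shows "(\<Sum>v<n. deg_fun n G v) = 2 * card G"
  using handshake[OF assms] by (simp add: deg_fun_def)

text \<open>Graphs with the same degree sequence have the same number of edges and hence the same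
  weight, so grouping by degree sequence leaves only the counting bound.\<close>

lemma graph_weight_le_config_weight:
  assumes X: "X \<subseteq> Pow (all_edges n)" and q: "q \<ge> 0"
  shows "graph_weight q X \<le> config_weight n q (deg_fun n ` X)"
proof -
  have fin: "finite X" by (rule finite_subset[OF X]) simp
  have "graph_weight q X = (\<Sum>d\<in>deg_fun n ` X. \<Sum>G\<in>{G \<in> X. deg_fun n G = d}. q ^ card G)"
    unfolding graph_weight_def by (rule sum.image_gen[OF fin])
  also have "\<dots> \<le> config_weight n q (deg_fun n ` X)"
    unfolding config_weight_def
  proof (rule sum_mono)
    fix d assume "d \<in> deg_fun n ` X"
    then obtain G0 where G0: "G0 \<in> X" "d = deg_fun n G0" by auto
    define m where "m = card G0"
    have m: "(\<Sum>v<n. d v) = 2 * m" unfolding m_def G0(2) by (rule sum_deg_fun) (use G0 X in auto)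
    have ext: "d \<in> extensional {..<n}" using G0 by (simp add: deg_fun_def)
    have "card G = m" if "G \<in> X" "deg_fun n G = d" for G
      using sum_deg_fun[of G n] that X m by auto
    hence "(\<Sum>G\<in>{G \<in> X. deg_fun n G = d}. q ^ card G) = card {G \<in> X. deg_fun n G = d} * q ^ m"
      by simp
    also have "\<dots> \<le> real (card (graphs_with_degrees n (degree_mset n d))) * q ^ m"
      unfolding graphs_with_degrees_eq[OF ext]
      by (intro mult_right_mono of_nat_mono card_mono)
        (use X q in \<open>auto intro: finite_subset[of _ "Pow (all_edges n)"]\<close>)
    also have "\<dots> \<le> (gauss_moment m / (\<Prod>v<n. fact (d v))) * q ^ m"
      by (intro mult_right_mono card_graphs_with_degrees_le m) (use q in auto)
    finally show "(\<Sum>G\<in>{G \<in> X. deg_fun n G = d}. q ^ card G) \<le> (if even (\<Sum>v<n. d v)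
     then q ^ ((\<Sum>v<n. d v) div 2) * gauss_moment ((\<Sum>v<n. d v) div 2) / (\<Prod>v<n. fact (d v)) else 0)"
      using m by (simp add: mult.commute)
  qed
  finally show ?thesis .
qed

text \<open>The summand counts the words of length N with letter frequencies d. Different d count
  different words, and there are n^N words in all.\<close>

lemma sum_multinomial_le:
  assumes "finite D" "D \<subseteq> extensional {..<n}" "\<And>d. d \<in> D \<Longrightarrow> (\<Sum>v<n. d v) = N"
  shows "(\<Sum>d\<in>D. fact N / (\<Prod>v<n. fact (d v))) \<le> real n ^ N"
proof -
  have "(\<Sum>d\<in>D. fact N / (\<Prod>v<n. fact (d v))) =
      real (\<Sum>d\<in>D. card (permutations_of_multiset (degree_mset n d)))"
    unfolding of_nat_sum card_permutations_degree_mset using assms by (intro sum.cong) auto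
  also have "(\<Sum>d\<in>D. card (permutations_of_multiset (degree_mset n d))) =
      card (\<Union>d\<in>D. permutations_of_multiset (degree_mset n d))"
  proof (rule card_UN_disjoint[symmetric])
    show "\<forall>i\<in>D. \<forall>j\<in>D. i \<noteq> j \<longrightarrow>
        permutations_of_multiset (degree_mset n i) \<inter> permutations_of_multiset (degree_mset n j) = {}"
    proof (intro ballI impI)
      fix i j assume ij: "i \<in> D" "j \<in> D" "i \<noteq> j"
      have "degree_mset n i \<noteq> degree_mset n j"
      proof
        assume "degree_mset n i = degree_mset n j"
        hence "i v = j v" if "v < n" for v using count_degree_mset that by metis
        hence "i = j" using ij assms by (intro extensionalityI[of i "{..<n}"]) auto
        thus False using ij by simp
      qed
      thus "permutations_of_multiset (degree_mset n i) \<inter> permutations_of_multiset (degree_mset n j) = {}"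
        by (auto simp: permutations_of_multiset_def)
    qed
  qed (use assms in auto)
  also have "\<dots> \<le> card {xs. set xs \<subseteq> {..<n} \<and> length xs = N}"
  proof (rule card_mono)
    show "(\<Union>d\<in>D. permutations_of_multiset (degree_mset n d)) \<subseteq> {xs. set xs \<subseteq> {..<n} \<and> length xs = N}"
    proof clarify
      fix d xs assume d: "d \<in> D" "xs \<in> permutations_of_multiset (degree_mset n d)"
      hence m: "mset xs = degree_mset n d" by (simp add: permutations_of_multiset_def)
      have "length xs = N" using size_degree_mset[of n d] assms d m by (metis size_mset)
      moreover have "set xs \<subseteq> {..<n}" using set_degree_mset[of n d] m by (metis set_mset_mset)
      ultimately show "set xs \<subseteq> {..<n} \<and> length xs = N" by simp
    qed
  qed (simp add: finite_lists_length_eq)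
  finally show ?thesis by (simp add: card_lists_length_eq)
qed

text \<open>
  Switching needs at least \<open>m0\<close> edges. With fewer edges a crude bound suffices: if \<open>0 \<in> S\<close> the empty
  graph already has weight 1, and otherwise every degree sequence has at least \<open>n / 2\<close> edges.
\<close>

lemma config_weight_le_graph_weight:
  fixes S T :: "nat set"
  assumes T: "T \<subseteq> S" "T \<subseteq> {..\<Delta>}" and \<Delta>: "\<Delta> \<ge> 1" and q: "q \<ge> 0"
    and m0: "m0 > 2 * ((\<Delta> + 1) * \<Delta>) + 6 * \<Delta>\<^sup>2" and n: "0 \<in> S \<or> 2 * m0 \<le> n"
  shows "config_weight n q ({..<n} \<rightarrow>\<^sub>E T) \<le>
    (2 * real (n * \<Delta>) ^ (12 * \<Delta>\<^sup>2) + m0 * (1 + q * real n ^ 2) ^ m0) * graph_weight q (S_graphs S n)"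
proof -
  define D where "D = ({..<n} \<rightarrow>\<^sub>E T)"
  define s where "s = (\<lambda>d :: nat \<Rightarrow> nat. \<Sum>v<n. d v)"
  define t where "t = (\<lambda>d. q ^ (s d div 2) * gauss_moment (s d div 2) / (\<Prod>v<n. fact (d v)))"
  have fT: "finite T" by (rule finite_subset[OF T(2)]) simp
  have fD: "finite D" unfolding D_def using fT by (simp add: finite_PiE)
  have t0: "t d \<ge> 0" for d
    unfolding t_def using q gauss_moment_pos by (simp add: prod_nonneg less_imp_le)
  have dT: "d v \<in> T" if "d \<in> D" "v < n" for d v using that by (auto simp: D_def)
  define Db where "Db = {d \<in> D. even (s d) \<and> s d \<ge> 2 * m0}"
  define Ds where "Ds = {d \<in> D. even (s d) \<and> s d < 2 * m0}"
  have W0: "graph_weight q (S_graphs S n) \<ge> 0"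
    unfolding graph_weight_def using q by (intro sum_nonneg) auto
  have "config_weight n q D = (\<Sum>d\<in>{d \<in> D. even (s d)}. t d)"
    unfolding config_weight_def t_def s_def using fD by (simp add: sum.If_cases Int_def)
  also have "{d \<in> D. even (s d)} = Db \<union> Ds" by (auto simp: Db_def Ds_def)
  also have "(\<Sum>d\<in>Db \<union> Ds. t d) = (\<Sum>d\<in>Db. t d) + (\<Sum>d\<in>Ds. t d)"
    using fD by (intro sum.union_disjoint) (auto simp: Db_def Ds_def)
  also have "(\<Sum>d\<in>Db. t d) \<le> 2 * real (n * \<Delta>) ^ (12 * \<Delta>\<^sup>2) * graph_weight q (S_graphs S n)"
  proof -
    let ?C = "2 * real (n * \<Delta>) ^ (12 * \<Delta>\<^sup>2)"
    let ?F = "\<lambda>d. graphs_with_degrees n (degree_mset n d)"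
    have ext: "d \<in> extensional {..<n}" if "d \<in> D" for d using that by (auto simp: D_def PiE_def)
    have "(\<Sum>d\<in>Db. t d) \<le> (\<Sum>d\<in>Db. ?C * (\<Sum>G\<in>?F d. q ^ card G))"
    proof (rule sum_mono)
      fix d assume "d \<in> Db"
      hence d: "d \<in> D" "even (s d)" "2 * m0 \<le> s d" by (auto simp: Db_def)
      then obtain m where m: "s d = 2 * m" by auto
      \<comment> \<open>Bounding m by n * \<Delta> makes the switching cost independent of
        d.\<close>
      have "s d \<le> (\<Sum>v<n. \<Delta>)" unfolding s_def using dT[OF d(1)] T by (intro sum_mono) auto
      hence mn: "m \<le> n * \<Delta>" using m by simp
      have "gauss_moment m / (\<Prod>v<n. fact (d v)) \<le> 2 * real m ^ (12 * \<Delta>\<^sup>2) * real (card (?F d))"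
        by (rule le_card_graphs_with_degrees) (use m dT[OF d(1)] T \<Delta> m0 d in \<open>auto simp: s_def\<close>)
      also have "\<dots> \<le> ?C * real (card (?F d))"
        using mn by (intro mult_right_mono mult_left_mono power_mono of_nat_mono) simp_all
      finally have "q ^ m * (gauss_moment m / (\<Prod>v<n. fact (d v))) \<le> q ^ m * (?C * real (card (?F d)))"
        using q by (intro mult_left_mono) auto
      also have "real (card (?F d)) = (\<Sum>G\<in>?F d. 1)" by simp
      also have "q ^ m * (?C * (\<Sum>G\<in>?F d. 1)) = ?C * (\<Sum>G\<in>?F d. q ^ m)"
        by (simp only: sum_constant mult_1_right) (simp only: mult_ac)
      also have "(\<Sum>G\<in>?F d. q ^ m) = (\<Sum>G\<in>?F d. q ^ card G)"
      proof (rule sum.cong)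
        fix G assume "G \<in> ?F d"
        hence "G \<subseteq> all_edges n" "deg_fun n G = d" by (auto simp: graphs_with_degrees_eq[OF ext[OF d(1)]])
        thus "q ^ m = q ^ card G" using sum_deg_fun[of G n] m by (simp add: s_def)
      qed simp
      finally show "t d \<le> ?C * (\<Sum>G\<in>?F d. q ^ card G)"
        by (simp add: t_def m)
    qed
    also have "\<dots> = ?C * (\<Sum>d\<in>Db. \<Sum>G\<in>?F d. q ^ card G)" by (simp add: sum_distrib_left)
    also have "(\<Sum>d\<in>Db. \<Sum>G\<in>?F d. q ^ card G) = (\<Sum>G\<in>(\<Union>d\<in>Db. ?F d). q ^ card G)"
    proof (rule sum.UNION_disjoint[symmetric])
      show "\<forall>d\<in>Db. finite (?F d)"
        by (auto simp: graphs_with_degrees_def intro!: finite_subset[of _ "Pow (all_edges n)"])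
      show "\<forall>i\<in>Db. \<forall>j\<in>Db. i \<noteq> j \<longrightarrow> ?F i \<inter> ?F j = {}"
        using ext by (auto simp: graphs_with_degrees_eq Db_def)
    qed (use fD in \<open>auto simp: Db_def\<close>)
    also have "\<dots> \<le> graph_weight q (S_graphs S n)"
      unfolding graph_weight_def
    proof (rule sum_mono2)
      show "(\<Union>d\<in>Db. ?F d) \<subseteq> S_graphs S n"
      proof clarify
        fix d G assume d: "d \<in> Db" and G: "G \<in> ?F d"
        have "vdegree G v \<in> S" if "v < n" for v
          using d G that dT[of d v] T by (auto simp: Db_def graphs_with_degrees_def count_degree_mset)
        thus "G \<in> S_graphs S n" using G by (auto simp: S_graphs_def graphs_with_degrees_def)
      qed
    qed (use q in auto)
    finally show ?thesis by (simp add: mult_left_mono)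
  qed
  also have "(\<Sum>d\<in>Ds. t d) \<le> m0 * (1 + q * real n ^ 2) ^ m0 * graph_weight q (S_graphs S n)"
  proof (cases "0 \<in> S")
    case True
    have "vdegree {} v = 0" for v by (simp add: vdegree_def)
    hence "{} \<in> S_graphs S n" using True by (auto simp: S_graphs_def)
    hence "(\<Sum>G\<in>{{} :: nat set set}. q ^ card G) \<le> graph_weight q (S_graphs S n)"
      unfolding graph_weight_def using q by (intro sum_mono2) auto
    hence W1: "graph_weight q (S_graphs S n) \<ge> 1" by simp
    have "(\<Sum>d\<in>Ds. t d) = (\<Sum>m<m0. \<Sum>d\<in>{d \<in> Ds. s d div 2 = m}. t d)"
      by (rule sum.group[symmetric]) (use fD in \<open>auto simp: Ds_def\<close>)
    also have "\<dots> \<le> (\<Sum>m<m0. (1 + q * real n ^ 2) ^ m0)"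
    proof (rule sum_mono)
      fix m assume m: "m \<in> {..<m0}"
      \<comment> \<open>Few edges: the multinomial bound shows that all sequences with m edges
        together weigh at most (q n^2)^m.\<close>
      have "(\<Sum>d\<in>{d \<in> Ds. s d div 2 = m}. t d) =
          (\<Sum>d\<in>{d \<in> Ds. s d div 2 = m}. q ^ m / (2 ^ m * fact m) * (fact (2 * m) / (\<Prod>v<n. fact (d v))))"
        by (intro sum.cong refl) (auto simp: t_def gauss_moment_def)
      also have "\<dots> = q ^ m / (2 ^ m * fact m) *
          (\<Sum>d\<in>{d \<in> Ds. s d div 2 = m}. fact (2 * m) / (\<Prod>v<n. fact (d v)))"
        by (simp add: sum_distrib_left)
      also have "\<dots> \<le> q ^ m / (2 ^ m * fact m) * real n ^ (2 * m)"
      proof (intro mult_left_mono sum_multinomial_le)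
        show "finite {d \<in> Ds. s d div 2 = m}" using fD by (simp add: Ds_def)
      qed (use q in \<open>auto simp: Ds_def s_def D_def PiE_def elim!: evenE\<close>)
      also have "\<dots> \<le> q ^ m / 1 * real n ^ (2 * m)"
      proof -
        have "(1::real) * 1 \<le> 2 ^ m * fact m" by (intro mult_mono) auto
        thus ?thesis using q by (intro mult_right_mono divide_left_mono) auto
      qed
      also have "\<dots> = (q * real n ^ 2) ^ m" by (simp add: power_mult_distrib power_mult)
      also have "\<dots> \<le> (1 + q * real n ^ 2) ^ m" using q by (intro power_mono) auto
      also have "\<dots> \<le> (1 + q * real n ^ 2) ^ m0" using q m by (intro power_increasing) auto
      finally show "(\<Sum>d\<in>{d \<in> Ds. s d div 2 = m}. t d) \<le> (1 + q * real n ^ 2) ^ m0" .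
    qed
    also have "\<dots> = m0 * (1 + q * real n ^ 2) ^ m0 * 1" by simp
    also have "\<dots> \<le> m0 * (1 + q * real n ^ 2) ^ m0 * graph_weight q (S_graphs S n)"
      using W1 q by (intro mult_left_mono) auto
    finally show ?thesis .
  next
    case False
    have "Ds = {}"
    proof -
      have "s d \<ge> n" if "d \<in> D" for d
      proof -
        have "(\<Sum>v<n. 1) \<le> s d" unfolding s_def
        proof (rule sum_mono)
          fix v assume "v \<in> {..<n}"
          hence "d v \<in> S" using dT that T by auto
          thus "1 \<le> d v" using False by (cases "d v") auto
        qed
        thus ?thesis by simp
      qed
      thus ?thesis using False n by (force simp: Ds_def)
    qed
    thus ?thesis using W0 q by simp
  qed
  finally show ?thesis unfolding D_def by (simp add: algebra_simps)
qed

section \<open>The power series and its maximizer\<close>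

definition phi_coeff :: "nat set \<Rightarrow> nat \<Rightarrow> real" where
  "phi_coeff S k = (if k \<in> S then 1 / fact k else 0)"

lemma abs_summable_phi: "summable (\<lambda>k. norm (phi_coeff S k * x ^ k))"
proof (rule summable_comparison_test[OF _ summable_norm_exp[of x]])
  show "\<exists>N. \<forall>k\<ge>N. norm (norm (phi_coeff S k * x ^ k)) \<le> norm (x ^ k /\<^sub>R fact k)"
    by (intro exI[of _ 0]) (auto simp: phi_coeff_def norm_mult norm_power norm_divide divide_inverse mult.commute)
qed

text \<open>Extends the sum over S by zero coefficients to a power series over all naturals, for
  which termwise differentiation is available.\<close>

lemma phi_sums: "(\<lambda>k. phi_coeff S k * x ^ k) sums phi S x"
proof -
  have "((\<lambda>k. phi_coeff S k * x ^ k) has_sum (\<Sum>k. phi_coeff S k * x ^ k)) UNIV"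
    using norm_summable_imp_has_sum[OF abs_summable_phi[of S x] summable_sums]
      summable_norm_cancel[OF abs_summable_phi[of S x]] by blast
  hence "((\<lambda>k. x ^ k / fact k) has_sum (\<Sum>k. phi_coeff S k * x ^ k)) S"
    by (subst has_sum_cong_neutral[where T = UNIV and g = "\<lambda>k. phi_coeff S k * x ^ k"])
      (auto simp: phi_coeff_def)
  hence "phi S x = (\<Sum>k. phi_coeff S k * x ^ k)"
    unfolding phi_def by (rule infsumI)
  thus ?thesis using summable_norm_cancel[OF abs_summable_phi[of S x]] by (simp add: summable_sums)
qed

lemma phi_eq_suminf: "phi S = (\<lambda>x. \<Sum>k. phi_coeff S k * x ^ k)"
  using phi_sums by (auto simp: fun_eq_iff sums_iff)

lemma phi_has_derivative: "(phi S has_real_derivative (\<Sum>k. diffs (phi_coeff S) k * x ^ k)) (at x)"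
  unfolding phi_eq_suminf
  by (rule termdiffs_strong_converges_everywhere) (rule summable_norm_cancel[OF abs_summable_phi])

lemma DERIV_phi: "(phi S has_real_derivative deriv (phi S) x) (at x)"
  using phi_has_derivative[of S x] DERIV_imp_deriv by metis

lemma isCont_phi [simp]: "isCont (phi S) x"
  using DERIV_phi DERIV_isCont by blast

lemma continuous_on_phi [continuous_intros]:
  assumes "continuous_on A f" shows "continuous_on A (\<lambda>x. phi S (f x))"
  by (rule continuous_on_compose2[OF continuous_at_imp_continuous_on assms, of UNIV]) auto

lemma tendsto_phi [tendsto_intros]:
  assumes "(f \<longlongrightarrow> a) F" shows "((\<lambda>x. phi S (f x)) \<longlongrightarrow> phi S a) F"
  by (rule isCont_tendsto_compose[OF isCont_phi assms])

text \<open>The factor x undoes the index shift of the derivative. Divided by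
  \<open>phi S x\<close>, the series is the mean of Po_S(x).\<close>

lemma deriv_phi_sums: "(\<lambda>k. real k * (phi_coeff S k * x ^ k)) sums (x * deriv (phi S) x)"
proof -
  have s: "summable (\<lambda>k. diffs (phi_coeff S) k * x ^ k)"
    by (rule termdiff_converges_all) (rule summable_norm_cancel[OF abs_summable_phi])
  have "deriv (phi S) x = (\<Sum>k. diffs (phi_coeff S) k * x ^ k)"
    using phi_has_derivative[of S x] DERIV_imp_deriv by metis
  hence "(\<lambda>k. x * (diffs (phi_coeff S) k * x ^ k)) sums (x * deriv (phi S) x)"
    using s by (intro sums_mult) (simp add: summable_sums)
  hence "(\<lambda>k. real (Suc k) * (phi_coeff S (Suc k) * x ^ Suc k)) sums (x * deriv (phi S) x)"
    by (simp add: diffs_def mult_ac)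
  thus ?thesis by (subst (asm) sums_Suc_iff) simp
qed

lemma phi_coeff_nonneg: "phi_coeff S k \<ge> 0" by (simp add: phi_coeff_def)

lemma phi_mono:
  assumes "A \<subseteq> B" "x \<ge> 0" shows "phi A x \<le> phi B x"
  by (rule sums_le[OF _ phi_sums phi_sums]) (use assms in \<open>auto simp: phi_coeff_def\<close>)

lemma phi_nonneg: "x \<ge> 0 \<Longrightarrow> phi S x \<ge> 0"
  by (rule sums_le[OF _ sums_zero phi_sums]) (auto simp: phi_coeff_nonneg)

lemma phi_finite:
  assumes "finite T" shows "phi T x = (\<Sum>k\<in>T. x ^ k / fact k)"
  unfolding phi_def using assms by simp

lemma phi_term_le:
  assumes "k \<in> S" "x \<ge> 0" shows "x ^ k / fact k \<le> phi S x"
  using phi_mono[of "{k}" S x] assms by (simp add: phi_finite)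

lemma phi_pos:
  assumes "x > 0" "S \<noteq> {}" shows "phi S x > 0"
proof -
  obtain k where "k \<in> S" using assms by auto
  moreover have "x ^ k / fact k > 0" using assms by simp
  ultimately show ?thesis using phi_term_le[of k S x] assms by linarith
qed

lemma phi_0: "phi S 0 = (if 0 \<in> S then 1 else 0)"
proof -
  have "(\<lambda>k. phi_coeff S k * 0 ^ k) sums phi_coeff S 0"
    using powser_sums_zero by blast
  thus ?thesis using phi_sums[of S 0] sums_unique2 by (fastforce simp: phi_coeff_def)
qed

lemma phi_le_exp:
  assumes "x \<ge> 0" shows "phi S x \<le> exp x"
proof (rule sums_le[OF _ phi_sums])
  show "(\<lambda>k. x ^ k /\<^sub>R fact k) sums exp x" by (rule exp_converges)
  show "phi_coeff S k * x ^ k \<le> x ^ k /\<^sub>R fact k" for k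
    using assms by (simp add: phi_coeff_def divide_inverse mult.commute)
qed

text \<open>Beyond \<Delta> each term may be multiplied by exp(k - \<Delta>), which is at least 1;
  the tail is then at most exp(-\<Delta>) times the exponential series at e * x.\<close>

lemma phi_le_truncated:
  assumes "x \<ge> 0"
  shows "phi S x \<le> phi (S \<inter> {..\<Delta>}) x + exp (- real \<Delta>) * exp (exp 1 * x)"
proof (rule sums_le[OF _ phi_sums])
  show "(\<lambda>k. phi_coeff (S \<inter> {..\<Delta>}) k * x ^ k + exp (- real \<Delta>) * ((exp 1 * x) ^ k /\<^sub>R fact k)) sums
      (phi (S \<inter> {..\<Delta>}) x + exp (- real \<Delta>) * exp (exp 1 * x))"
    by (intro sums_add sums_mult phi_sums exp_converges)
  fix k
  show "phi_coeff S k * x ^ k \<le> phi_coeff (S \<inter> {..\<Delta>}) k * x ^ k + exp (- real \<Delta>) * ((exp 1 * x) ^ k /\<^sub>R fact k)"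
  proof (cases "k \<le> \<Delta>")
    case True
    thus ?thesis using assms by (simp add: phi_coeff_def)
  next
    case False
    have "1 * (x ^ k / fact k) \<le> exp (real k - real \<Delta>) * (x ^ k / fact k)"
      using False assms by (intro mult_right_mono) auto
    also have "\<dots> = exp (- real \<Delta>) * ((exp 1 * x) ^ k /\<^sub>R fact k)"
      by (simp add: power_mult_distrib exp_diff exp_minus divide_inverse exp_of_nat_mult[symmetric] mult_ac)
    finally show ?thesis using False assms by (simp add: phi_coeff_def)
  qed
qed

text \<open>The exponential of \<open>psi1 S \<mu> L\<close> wherever \<open>phi S \<mu>\<close> is
  positive. This form stays continuous at \<mu> = 0 when 0 is not in S, where \<open>phi\<close>
  vanishes.\<close>

definition rate :: "nat set \<Rightarrow> real \<Rightarrow> real \<Rightarrow> real" where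
  "rate S L \<mu> = phi S \<mu> * exp (- (\<mu>\<^sup>2 / (2 * L)))"

lemma rate_nonneg: "\<mu> \<ge> 0 \<Longrightarrow> rate S L \<mu> \<ge> 0"
  by (simp add: rate_def phi_nonneg)

lemma continuous_on_rate: "continuous_on A (rate S L)"
  unfolding rate_def by (cases "L = 0") (auto intro!: continuous_intros)

lemma rate_le_exp:
  assumes "\<mu> \<ge> 0" shows "rate S L \<mu> \<le> exp (\<mu> - \<mu>\<^sup>2 / (2 * L))"
proof -
  have "rate S L \<mu> \<le> exp \<mu> * exp (- (\<mu>\<^sup>2 / (2 * L)))"
    unfolding rate_def by (intro mult_right_mono phi_le_exp assms) simp
  thus ?thesis by (simp flip: exp_add)
qed

lemma rate_small_at_infinity:
  assumes "L > 0" "t > 0"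
  obtains M where "M > 0" "\<And>\<mu>. \<mu> \<ge> M \<Longrightarrow> rate S L \<mu> \<le> t"
proof -
  have "((\<lambda>\<mu>. exp (\<mu> - \<mu>\<^sup>2 / (2 * L))) \<longlongrightarrow> 0) at_top"
    using assms by real_asymp
  hence "\<forall>\<^sub>F \<mu> in at_top. exp (\<mu> - \<mu>\<^sup>2 / (2 * L)) < t"
    using assms by (intro order_tendstoD)
  then obtain M where M: "\<And>\<mu>. \<mu> \<ge> M \<Longrightarrow> exp (\<mu> - \<mu>\<^sup>2 / (2 * L)) < t"
    by (auto simp: eventually_at_top_linorder)
  show ?thesis
  proof (rule that[of "max M 1"])
    fix \<mu> assume "\<mu> \<ge> max M 1"
    thus "rate S L \<mu> \<le> t" using rate_le_exp[of \<mu> S L] M[of \<mu>] by auto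
  qed simp
qed

lemma rate_mono_L:
  assumes "0 < L" "L \<le> L'" "\<mu> \<ge> 0"
  shows "rate S L \<mu> \<le> rate S L' \<mu>"
proof -
  have "\<mu>\<^sup>2 / (2 * L') \<le> \<mu>\<^sup>2 / (2 * L)"
    using assms by (intro divide_left_mono) auto
  thus ?thesis unfolding rate_def using assms phi_nonneg[of \<mu> S] by (intro mult_left_mono) auto
qed

section \<open>From the maximizer over stationary points to a strict global maximizer\<close>

locale unique_maximizer =
  fixes S :: "nat set" and lam \<mu>h :: real
  assumes S_nonempty: "S \<noteq> {}" and lam_pos: "lam > 0"
    and is_max: "is_arg_max (psi S) (\<lambda>\<mu>. \<mu> \<in> Eset S lam) \<mu>h"
    and unique: "\<And>\<mu>. is_arg_max (psi S) (\<lambda>\<mu>. \<mu> \<in> Eset S lam) \<mu> \<Longrightarrow> \<mu> = \<mu>h"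
begin

lemma rate_pos_Eset:
  assumes "\<mu> \<in> Eset S lam" shows "phi S \<mu> > 0" "rate S lam \<mu> > 0" "psi S \<mu> = ln (rate S lam \<mu>)"
proof -
  show p: "phi S \<mu> > 0"
    using assms phi_pos[of \<mu> S] S_nonempty by (cases "\<mu> = 0") (auto simp: Eset_def phi_0)
  thus "rate S lam \<mu> > 0" by (simp add: rate_def)
  show "psi S \<mu> = ln (rate S lam \<mu>)"
    using p psi_eq_psi1[OF assms] by (simp add: rate_def psi1_def ln_mult)
qed

lemma \<mu>h_in_Eset: "\<mu>h \<in> Eset S lam" using is_max by (simp add: is_arg_max_def)

lemma \<mu>h_nonneg: "\<mu>h \<ge> 0" and \<mu>h_0: "\<mu>h = 0 \<Longrightarrow> 0 \<in> S"
  using \<mu>h_in_Eset by (auto simp: Eset_def)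

lemma phi_\<mu>h_pos: "phi S \<mu>h > 0" and rate_\<mu>h_pos: "rate S lam \<mu>h > 0"
  using rate_pos_Eset \<mu>h_in_Eset by auto

text \<open>At an interior maximum the derivative vanishes, that is phi' / phi = \<mu> / lam, the
  equation of \<open>Eset\<close> for \<mu> > 0. At the boundary point 0 that equation is trivial
  and 0 \<in> S is required; it holds because the maximal value is positive.\<close>

lemma global_max_in_Eset:
  assumes x: "x \<ge> 0" and max: "\<And>\<mu>. \<mu> \<ge> 0 \<Longrightarrow> rate S lam \<mu> \<le> rate S lam x"
  shows "x \<in> Eset S lam"
proof (cases "x = 0")
  case True
  have "rate S lam 1 > 0" using S_nonempty by (simp add: rate_def phi_pos)
  hence "rate S lam 0 > 0" using max[of 1] True by auto
  hence "0 \<in> S" by (auto simp: rate_def phi_0 split: if_splits)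
  thus ?thesis using True by (simp add: Eset_def)
next
  case False
  hence x0: "x > 0" using x by simp
  define e where "e = exp (- (x\<^sup>2 / (2 * lam)))"
  have "(rate S lam has_real_derivative (deriv (phi S) x * e + e * - (x / lam) * phi S x)) (at x)"
    unfolding rate_def e_def using lam_pos
    by (auto intro!: derivative_eq_intros DERIV_phi simp: field_simps power2_eq_square)
  moreover have "\<forall>y. \<bar>x - y\<bar> < x \<longrightarrow> rate S lam y \<le> rate S lam x"
    using max by (auto simp: abs_if split: if_splits)
  ultimately have "deriv (phi S) x * e + e * - (x / lam) * phi S x = 0"
    using x0 by (intro DERIV_local_max) auto
  hence "e * (deriv (phi S) x - (x / lam) * phi S x) = 0" by (simp add: algebra_simps)
  hence "deriv (phi S) x = (x / lam) * phi S x" by (simp add: e_def)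
  moreover have "phi S x > 0" using x0 S_nonempty by (rule phi_pos)
  ultimately show ?thesis using x0 by (simp add: Eset_def power2_eq_square)
qed

text \<open>As the rate is small at infinity, its maximum over all \<mu> \<ge> 0 is attained. Any
  point where it is attained lies in \<open>Eset\<close> and maximizes \<open>psi\<close> there, so
  by uniqueness it is \<open>\<mu>h\<close>.\<close>

lemma rate_less:
  assumes "\<mu> \<ge> 0" "\<mu> \<noteq> \<mu>h" shows "rate S lam \<mu> < rate S lam \<mu>h"
proof -
  obtain M where M: "M > 0" "\<And>\<mu>. \<mu> \<ge> M \<Longrightarrow> rate S lam \<mu> \<le> rate S lam \<mu>h"
    using rate_small_at_infinity[OF lam_pos rate_\<mu>h_pos] by blast
  obtain x where x: "x \<in> {0..max M \<mu>h}" "\<And>y. y \<in> {0..max M \<mu>h} \<Longrightarrow> rate S lam y \<le> rate S lam x"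
    using continuous_attains_sup[of "{0..max M \<mu>h}" "rate S lam"] continuous_on_rate M(1)
    by (auto simp: le_max_iff_disj)
  have max: "rate S lam y \<le> rate S lam x" if "y \<ge> 0" for y
  proof (cases "y \<le> max M \<mu>h")
    case False
    hence "rate S lam y \<le> rate S lam \<mu>h" using M by simp
    also have "\<dots> \<le> rate S lam x" using x(2)[of \<mu>h] \<mu>h_nonneg by simp
    finally show ?thesis .
  qed (use x that in auto)
  have eq: "z = \<mu>h" if z: "z \<ge> 0" and zmax: "\<And>\<mu>. \<mu> \<ge> 0 \<Longrightarrow> rate S lam \<mu> \<le> rate S lam z" for z
  proof (rule unique)
    have zE: "z \<in> Eset S lam" using global_max_in_Eset[OF z zmax] by simp
    have "psi S y \<le> psi S z" if "y \<in> Eset S lam" for y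
      using rate_pos_Eset[OF that] rate_pos_Eset[OF zE] zmax[of y] that by (simp add: Eset_def)
    thus "is_arg_max (psi S) (\<lambda>\<mu>. \<mu> \<in> Eset S lam) z"
      using zE by (auto simp: is_arg_max_def not_less)
  qed
  have "x = \<mu>h" using eq[of x] max x by auto
  show ?thesis
  proof (rule ccontr)
    assume "\<not> rate S lam \<mu> < rate S lam \<mu>h"
    hence "\<mu> = \<mu>h" using eq[of \<mu>] assms(1) max \<open>x = \<mu>h\<close> by (meson dual_order.trans not_less)
    thus False using assms by simp
  qed
qed

lemma rate_le: "\<mu> \<ge> 0 \<Longrightarrow> rate S lam \<mu> \<le> rate S lam \<mu>h"
  using rate_less[of \<mu>] by (cases "\<mu> = \<mu>h") auto

text \<open>The slack is needed in two places at once: \<open>t' < t\<close> will give exponential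
  decay, and the enlarged parameter \<open>lam + \<kappa>\<close> convergence of the
  integral.\<close>

lemma rate_uniform_bound:
  assumes C: "closed C" "C \<subseteq> {0..}" and t: "t > 0" "\<And>\<mu>. \<mu> \<in> C \<Longrightarrow> rate S lam \<mu> < t"
  obtains \<kappa> t' where "\<kappa> > 0" "0 < t'" "t' < t" "\<And>\<mu>. \<mu> \<in> C \<Longrightarrow> rate S (lam + \<kappa>) \<mu> \<le> t'"
proof -
  \<comment> \<open>The parameter \<open>2 * lam\<close> dominates every
    \<open>lam + \<kappa>\<close> with \<kappa> < \<open>lam\<close>, so one M serves all of
    them.\<close>
  obtain M where M: "M > 0" "\<And>\<mu>. \<mu> \<ge> M \<Longrightarrow> rate S (2 * lam) \<mu> \<le> t / 2"
    using rate_small_at_infinity[of "2 * lam" "t / 2" S] lam_pos t by auto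
  define K where "K = C \<inter> {0..M}"
  have "compact K" unfolding K_def using C by (simp add: closed_Int_compact)
  obtain s where s: "0 \<le> s" "s < t" "\<And>\<mu>. \<mu> \<in> K \<Longrightarrow> rate S lam \<mu> \<le> s"
  proof (cases "K = {}")
    case True
    thus ?thesis using that[of 0] t by auto
  next
    case False
    then obtain x where x: "x \<in> K" "\<And>y. y \<in> K \<Longrightarrow> rate S lam y \<le> rate S lam x"
      using continuous_attains_sup[OF \<open>compact K\<close> False continuous_on_rate, of S lam] by blast
    show ?thesis
      by (rule that[of "rate S lam x"]) (use x t rate_nonneg in \<open>auto simp: K_def\<close>)
  qed
  define t' where "t' = max ((s + t) / 2) (t / 2)"
  have t': "0 < t'" "t' < t" "s < t'" using s t by (auto simp: t'_def)
  \<comment> \<open>On the compact part the enlarged parameter multiplies the rate by at most the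
    factor belonging to \<mu> = M, and this factor tends to 1 with \<kappa>.\<close>
  have "((\<lambda>\<kappa>. s * exp (M\<^sup>2 / (2 * lam) - M\<^sup>2 / (2 * (lam + \<kappa>)))) \<longlongrightarrow>
      s * exp (M\<^sup>2 / (2 * lam) - M\<^sup>2 / (2 * (lam + 0)))) (at_right 0)"
    using lam_pos by (intro tendsto_intros) auto
  hence "\<forall>\<^sub>F \<kappa> in at_right 0. s * exp (M\<^sup>2 / (2 * lam) - M\<^sup>2 / (2 * (lam + \<kappa>))) < t'"
    by (rule order_tendstoD) (use t' in auto)
  moreover have "\<forall>\<^sub>F \<kappa> in at_right 0. \<kappa> \<in> {0<..<lam}"
    using lam_pos by (rule eventually_at_right_real)
  ultimately have "\<forall>\<^sub>F \<kappa> in at_right (0::real). s * exp (M\<^sup>2 / (2 * lam) - M\<^sup>2 / (2 * (lam + \<kappa>))) < t' \<and> \<kappa> \<in> {0<..<lam}"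
    by (rule eventually_conj)
  then obtain \<kappa> where \<kappa>: "s * exp (M\<^sup>2 / (2 * lam) - M\<^sup>2 / (2 * (lam + \<kappa>))) < t'" "0 < \<kappa>" "\<kappa> < lam"
    using eventually_happens'[OF trivial_limit_at_right_real] by auto
  show ?thesis
  proof (rule that[OF \<kappa>(2) t'(1,2)])
    fix \<mu> assume \<mu>: "\<mu> \<in> C"
    hence \<mu>0: "\<mu> \<ge> 0" using C by auto
    show "rate S (lam + \<kappa>) \<mu> \<le> t'"
    proof (cases "\<mu> \<le> M")
      case False
      have "rate S (lam + \<kappa>) \<mu> \<le> rate S (2 * lam) \<mu>"
        using \<kappa> lam_pos \<mu>0 by (intro rate_mono_L) auto
      also have "\<dots> \<le> t / 2" using M False by simp
      finally show ?thesis by (simp add: t'_def)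
    next
      case True
      define a where "a = 1 / (2 * lam) - 1 / (2 * (lam + \<kappa>))"
      have a: "a \<ge> 0" using \<kappa> lam_pos by (simp add: a_def field_simps)
      have "rate S (lam + \<kappa>) \<mu> = rate S lam \<mu> * exp (\<mu>\<^sup>2 * a)"
        unfolding rate_def a_def mult.assoc exp_add[symmetric]
        by (simp only: right_diff_distrib) simp
      also have "\<dots> \<le> s * exp (M\<^sup>2 * a)"
        using s \<mu> \<mu>0 True a
        by (intro mult_mono) (auto simp: K_def intro!: mult_right_mono power_mono)
      also have "\<dots> = s * exp (M\<^sup>2 / (2 * lam) - M\<^sup>2 / (2 * (lam + \<kappa>)))"
        by (simp add: a_def right_diff_distrib)
      finally show ?thesis using \<kappa> by simp
    qed
  qed
qed

text \<open>Joint continuity in the parameter and in \<mu>: for finite n the parameter is n q, not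
  \<open>lam\<close>. An interval to the right of \<open>\<mu>h\<close> stays in the admissible
  range even when \<open>\<mu>h\<close> = 0.\<close>

lemma rate_lower_near:
  assumes "\<eta> > 0"
  obtains \<kappa> \<delta> where "\<kappa> > 0" "\<delta> > 0" "\<kappa> < lam"
    "\<And>L \<mu>. \<bar>L - lam\<bar> < \<kappa> \<Longrightarrow> \<mu> \<in> {\<mu>h..\<mu>h + \<delta>} \<Longrightarrow> rate S L \<mu> \<ge> rate S lam \<mu>h * exp (- \<eta>)"
proof -
  have fst: "(fst \<longlongrightarrow> lam) (nhds (lam, \<mu>h))" and snd: "(snd \<longlongrightarrow> \<mu>h) (nhds (lam, \<mu>h))"
    using tendsto_fst[OF filterlim_ident, of "(lam, \<mu>h)"] tendsto_snd[OF filterlim_ident, of "(lam, \<mu>h)"] by auto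
  have "((\<lambda>p. rate S (fst p) (snd p)) \<longlongrightarrow> rate S lam \<mu>h) (nhds (lam, \<mu>h))"
    unfolding rate_def using lam_pos fst snd by (intro tendsto_intros) auto
  moreover have "rate S lam \<mu>h * exp (- \<eta>) < rate S lam \<mu>h" using assms rate_\<mu>h_pos by simp
  ultimately have "\<forall>\<^sub>F p in nhds (lam, \<mu>h). rate S lam \<mu>h * exp (- \<eta>) < rate S (fst p) (snd p)"
    by (rule order_tendstoD)
  then obtain e where e: "e > 0" "\<And>p. dist p (lam, \<mu>h) < e \<Longrightarrow> rate S lam \<mu>h * exp (- \<eta>) < rate S (fst p) (snd p)"
    unfolding eventually_nhds_metric by blast
  show ?thesis
  proof (rule that[of "min (e / 2) (lam / 2)" "e / 3"])
    fix L \<mu> assume *: "\<bar>L - lam\<bar> < min (e / 2) (lam / 2)" "\<mu> \<in> {\<mu>h..\<mu>h + e / 3}"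
    have "dist (L, \<mu>) (lam, \<mu>h) \<le> dist L lam + dist \<mu> \<mu>h"
      unfolding dist_Pair_Pair by (rule sqrt_sum_squares_le_sum) auto
    also have "\<dots> < e" using * e(1) by (auto simp: dist_real_def)
    finally show "rate S L \<mu> \<ge> rate S lam \<mu>h * exp (- \<eta>)" using e(2)[of "(L, \<mu>)"] by simp
  qed (use e lam_pos in auto)
qed

end

section \<open>Gaussian integrals\<close>

lemma deg_poly_PiE:
  assumes "finite T"
  shows "deg_poly n ({..<n} \<rightarrow>\<^sub>E T) x = phi T x ^ n"
proof -
  have "phi T x ^ n = (\<Prod>v<n. \<Sum>k\<in>T. x ^ k / fact k)"
    using assms by (simp add: phi_finite)
  also have "\<dots> = (\<Sum>d\<in>{..<n} \<rightarrow>\<^sub>E T. \<Prod>v<n. x ^ d v / fact (d v))"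
    using assms by (intro prod_sum_PiE) auto
  finally show ?thesis by (simp add: deg_poly_def prod_dividef power_sum)
qed

lemma deg_poly_mono:
  assumes "finite D'" "D \<subseteq> D'" "x \<ge> 0"
  shows "deg_poly n D x \<le> deg_poly n D' x"
  unfolding deg_poly_def using assms by (intro sum_mono2) (auto intro!: divide_nonneg_nonneg prod_nonneg)

text \<open>Markov's inequality for independent degrees: on \<open>D\<close> the tilting weight is
  at least 1, and its sum over all sequences factorises over the vertices. With exponential
  \<open>g\<close> this is a Chernoff bound.\<close>

lemma deg_poly_tilt:
  assumes T: "finite T" and D: "D \<subseteq> {..<n} \<rightarrow>\<^sub>E T" and x: "x \<ge> 0" and a: "a \<ge> 0"
    and g: "\<And>k. k \<in> T \<Longrightarrow> g k \<ge> 0" and le: "\<And>d. d \<in> D \<Longrightarrow> 1 \<le> a * (\<Prod>v<n. g (d v))"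
  shows "deg_poly n D x \<le> a * (\<Sum>k\<in>T. g k * (x ^ k / fact k)) ^ n"
proof -
  let ?t = "\<lambda>d. x ^ (\<Sum>v<n. d v) / (\<Prod>v<n. fact (d v))"
  have t: "?t d \<ge> 0" for d using x by (auto intro!: divide_nonneg_nonneg prod_nonneg)
  have fin: "finite ({..<n} \<rightarrow>\<^sub>E T)" using T by (simp add: finite_PiE)
  have "deg_poly n D x \<le> (\<Sum>d\<in>D. a * (\<Prod>v<n. g (d v)) * ?t d)"
    unfolding deg_poly_def
    by (intro sum_mono) (use mult_right_mono[OF le t] in auto)
  also have "\<dots> \<le> (\<Sum>d\<in>{..<n} \<rightarrow>\<^sub>E T. a * (\<Prod>v<n. g (d v)) * ?t d)"
  proof (rule sum_mono2[OF fin D])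
    fix d assume "d \<in> ({..<n} \<rightarrow>\<^sub>E T) - D"
    hence "d v \<in> T" if "v < n" for v using that by auto
    hence "(\<Prod>v<n. g (d v)) \<ge> 0" using g by (intro prod_nonneg) auto
    thus "0 \<le> a * (\<Prod>v<n. g (d v)) * ?t d" using t[of d] a by (intro mult_nonneg_nonneg)
  qed
  also have "\<dots> = a * (\<Sum>d\<in>{..<n} \<rightarrow>\<^sub>E T. \<Prod>v<n. g (d v) * (x ^ d v / fact (d v)))"
    unfolding sum_distrib_left by (intro sum.cong refl) (simp add: prod.distrib prod_dividef power_sum)
  also have "(\<Sum>d\<in>{..<n} \<rightarrow>\<^sub>E T. \<Prod>v<n. g (d v) * (x ^ d v / fact (d v))) =
      (\<Prod>v<n. \<Sum>k\<in>T. g k * (x ^ k / fact k))"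
    using T by (intro prod_sum_PiE[symmetric]) auto
  finally show ?thesis by simp
qed

lemma deg_poly_even_part_le:
  assumes "x \<ge> 0"
  shows "(deg_poly n D x + deg_poly n D (- x)) / 2 \<le> deg_poly n D x"
proof -
  have "deg_poly n D (- x) \<le> deg_poly n D x"
    unfolding deg_poly_def
  proof (rule sum_mono)
    fix d assume "d \<in> D"
    have "(- x) ^ k \<le> x ^ k" for k
      using assms by (cases "even k") (auto simp: power_minus_odd)
    thus "(- x) ^ (\<Sum>v<n. d v) / (\<Prod>v<n. fact (d v)) \<le> x ^ (\<Sum>v<n. d v) / (\<Prod>v<n. fact (d v))"
      by (intro divide_right_mono prod_nonneg) auto
  qed
  thus ?thesis by simp
qed

lemma deg_fun_S_graphs:
  assumes "G \<in> S_graphs S n"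
  shows "deg_fun n G \<in> {..<n} \<rightarrow>\<^sub>E (S \<inter> {..<n})"
proof -
  have "vdegree G v < n" if "v < n" for v
    using vdegree_le[of G n v] assms that by (simp add: S_graphs_def)
  thus ?thesis using assms by (auto simp: deg_fun_def S_graphs_def)
qed

lemma gaussian_integral:
  assumes "c > 0"
  shows "has_bochner_integral lborel (\<lambda>z. exp (- (c * z\<^sup>2 / 2)) / sqrt (2 * pi)) (1 / sqrt c)"
proof -
  have "has_bochner_integral lborel (\<lambda>z. (1 / sqrt c) * normal_density 0 (1 / sqrt c) z) ((1 / sqrt c) * 1)"
    using assms by (intro has_bochner_integral_mult_right) (simp add: has_bochner_integral_iff)
  moreover have "(1 / sqrt c) * normal_density 0 (1 / sqrt c) z = exp (- (c * z\<^sup>2 / 2)) / sqrt (2 * pi)" for z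
    using assms by (simp add: normal_density_def power_divide real_sqrt_divide)
  ultimately show ?thesis by simp
qed

text \<open>With \<mu> = sqrt q * \<bar>z\<bar> the penalty n \<mu>^2 / (2 L) is n q / L times the
  exponent z^2 / 2 of the density. What is left over is constant for L = n q and a decaying Gaussian
  for L > n q.\<close>

lemma gauss_phi_eq:
  assumes "q > 0" "L > 0"
  shows "std_normal_density z * phi S (sqrt q * \<bar>z\<bar>) ^ n =
    rate S L (sqrt q * \<bar>z\<bar>) ^ n * (exp (- ((1 - n * q / L) * z\<^sup>2 / 2)) / sqrt (2 * pi))"
proof -
  have "rate S L (sqrt q * \<bar>z\<bar>) ^ n = phi S (sqrt q * \<bar>z\<bar>) ^ n * exp (- (n * q / L * z\<^sup>2 / 2))"
    using assms by (simp add: rate_def power_mult_distrib exp_of_nat_mult[symmetric])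
  hence "rate S L (sqrt q * \<bar>z\<bar>) ^ n * (exp (- ((1 - n * q / L) * z\<^sup>2 / 2)) / sqrt (2 * pi)) =
     phi S (sqrt q * \<bar>z\<bar>) ^ n * (exp (- (n * q / L * z\<^sup>2 / 2)) * exp (- ((1 - n * q / L) * z\<^sup>2 / 2))) / sqrt (2 * pi)"
    by simp
  also have "exp (- (n * q / L * z\<^sup>2 / 2)) * exp (- ((1 - n * q / L) * z\<^sup>2 / 2)) = exp (- (z\<^sup>2 / 2))"
    unfolding exp_add[symmetric] by (simp add: field_simps)
  finally show ?thesis by (simp add: std_normal_density_def)
qed

context unique_maximizer
begin

definition near :: "real \<Rightarrow> real \<Rightarrow> real set" where
  "near \<delta> q = {z. \<bar>sqrt q * \<bar>z\<bar> - \<mu>h\<bar> \<le> \<delta>}"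

text \<open>The common yardstick: upper bounds for events and the lower bound for the partition
  function are both expressed by it, so it cancels in conditional probabilities.\<close>

definition peak :: "real \<Rightarrow> nat \<Rightarrow> real \<Rightarrow> real" where
  "peak \<delta> n q = (\<integral>z. indicator (near \<delta> q) z * (std_normal_density z * phi S (sqrt q * \<bar>z\<bar>) ^ n) \<partial>lborel)"

lemma integrable_peak:
  assumes "q > 0"
  shows "integrable lborel (\<lambda>z. indicator (near \<delta> q) z * (std_normal_density z * phi S (sqrt q * \<bar>z\<bar>) ^ n))"
proof -
  have "closed (near \<delta> q)"
    unfolding near_def by (intro closed_Collect_le continuous_intros)
  moreover have "bounded (near \<delta> q)"
  proof -
    have "\<bar>z\<bar> \<le> (\<mu>h + \<delta>) / sqrt q" if "z \<in> near \<delta> q" for z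
    proof -
      have "sqrt q * \<bar>z\<bar> \<le> \<mu>h + \<delta>" using that by (simp add: near_def abs_le_iff)
      thus ?thesis using assms by (simp add: pos_le_divide_eq mult.commute)
    qed
    thus ?thesis unfolding bounded_iff by auto
  qed
  ultimately have "compact (near \<delta> q)" by (simp add: compact_eq_bounded_closed)
  hence "integrable lborel (\<lambda>z. indicator (near \<delta> q) z *\<^sub>R (std_normal_density z * phi S (sqrt q * \<bar>z\<bar>) ^ n))"
    by (intro borel_integrable_compact) (auto simp: std_normal_density_def intro!: continuous_intros)
  thus ?thesis by simp
qed

text \<open>
  Replacing \<open>lam\<close> by \<open>lam + \<kappa>\<close> in the rate leaves a Gaussian factor that makes the part away from
  \<open>\<mu>h\<close> integrable.
\<close>

lemma integral_le_peak:
  assumes q: "q > 0" and \<kappa>: "\<kappa> > 0" "n * q \<le> lam + \<kappa> / 2" and t: "t \<ge> 0"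
    and far: "\<And>\<mu>. \<mu> \<ge> 0 \<Longrightarrow> \<bar>\<mu> - \<mu>h\<bar> > \<delta> \<Longrightarrow> rate S (lam + \<kappa>) \<mu> \<le> t"
    and I: "has_bochner_integral lborel (\<lambda>z. std_normal_density z * \<Psi> z) I"
    and \<Psi>: "\<And>z. \<Psi> z \<le> phi S (sqrt q * \<bar>z\<bar>) ^ n"
      "\<And>z. z \<in> near \<delta> q \<Longrightarrow> \<Psi> z \<le> b * phi S (sqrt q * \<bar>z\<bar>) ^ n"
  shows "I \<le> b * peak \<delta> n q + t ^ n / sqrt (\<kappa> / (2 * (lam + \<kappa>)))"
proof -
  \<comment> \<open>From n q \<le> lam + \<kappa> / 2 the leftover coefficient 1 - n q / (lam +
    \<kappa>) is at least this c.\<close>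
  define c where "c = \<kappa> / (2 * (lam + \<kappa>))"
  have c: "c > 0" using \<kappa> lam_pos by (simp add: c_def)
  have c': "1 - n * q / (lam + \<kappa>) \<ge> c"
  proof -
    have "n * q / (lam + \<kappa>) \<le> (lam + \<kappa> / 2) / (lam + \<kappa>)"
      using \<kappa> lam_pos by (intro divide_right_mono) auto
    also have "\<dots> = 1 - c" using \<kappa> lam_pos by (simp add: c_def field_simps)
    finally show ?thesis by simp
  qed
  let ?e = "\<lambda>z. exp (- (c * z\<^sup>2 / 2)) / sqrt (2 * pi)"
  let ?p = "\<lambda>z. indicator (near \<delta> q) z * (std_normal_density z * phi S (sqrt q * \<bar>z\<bar>) ^ n)"
  have rhs: "has_bochner_integral lborel (\<lambda>z. b * ?p z + t ^ n * ?e z) (b * peak \<delta> n q + t ^ n * (1 / sqrt c))"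
    by (intro has_bochner_integral_add has_bochner_integral_mult_right gaussian_integral c)
      (simp_all add: has_bochner_integral_iff peak_def integrable_peak q)
  have pw: "std_normal_density z * \<Psi> z \<le> b * ?p z + t ^ n * ?e z" for z
  proof (cases "z \<in> near \<delta> q")
    case True
    have "std_normal_density z * \<Psi> z \<le> std_normal_density z * (b * phi S (sqrt q * \<bar>z\<bar>) ^ n)"
      using \<Psi>(2)[OF True] by (intro mult_left_mono) auto
    also have "\<dots> = b * ?p z" using True by simp
    also have "\<dots> \<le> b * ?p z + t ^ n * ?e z" using t by simp
    finally show ?thesis .
  next
    case False
    have "std_normal_density z * \<Psi> z \<le> std_normal_density z * phi S (sqrt q * \<bar>z\<bar>) ^ n"
      using \<Psi>(1)[of z] by (intro mult_left_mono) auto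
    also have "\<dots> = rate S (lam + \<kappa>) (sqrt q * \<bar>z\<bar>) ^ n *
        (exp (- ((1 - n * q / (lam + \<kappa>)) * z\<^sup>2 / 2)) / sqrt (2 * pi))"
      using q \<kappa> lam_pos by (intro gauss_phi_eq) auto
    also have "\<dots> \<le> t ^ n * ?e z"
    proof (intro mult_mono power_mono divide_right_mono)
      show "rate S (lam + \<kappa>) (sqrt q * \<bar>z\<bar>) \<le> t"
        using False q by (intro far) (auto simp: near_def)
      show "exp (- ((1 - n * q / (lam + \<kappa>)) * z\<^sup>2 / 2)) \<le> exp (- (c * z\<^sup>2 / 2))"
        using c' by (auto intro!: mult_right_mono)
    qed (use t q in \<open>auto intro!: rate_nonneg\<close>)
    finally show ?thesis using False by simp
  qed
  have "I = (\<integral>z. std_normal_density z * \<Psi> z \<partial>lborel)" using I by (simp add: has_bochner_integral_iff)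
  also have "\<dots> \<le> (\<integral>z. b * ?p z + t ^ n * ?e z \<partial>lborel)"
    by (rule integral_mono) (use I rhs pw in \<open>auto simp: has_bochner_integral_iff\<close>)
  also have "\<dots> = b * peak \<delta> n q + t ^ n * (1 / sqrt c)"
    using rhs by (simp add: has_bochner_integral_iff)
  finally show ?thesis by (simp add: c_def)
qed

lemma peak_le_integral:
  assumes q: "q > 0"
    and I: "has_bochner_integral lborel (\<lambda>z. std_normal_density z * \<Psi> z) I"
    and \<Psi>: "\<And>z. \<Psi> z \<ge> 0" "\<And>z. z \<in> near \<delta> q \<Longrightarrow> c * phi S (sqrt q * \<bar>z\<bar>) ^ n \<le> \<Psi> z"
  shows "c * peak \<delta> n q \<le> I"
proof -
  let ?p = "\<lambda>z. indicator (near \<delta> q) z * (std_normal_density z * phi S (sqrt q * \<bar>z\<bar>) ^ n)"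
  have "c * peak \<delta> n q = (\<integral>z. c * ?p z \<partial>lborel)" by (simp add: peak_def)
  also have "\<dots> \<le> (\<integral>z. std_normal_density z * \<Psi> z \<partial>lborel)"
  proof (rule integral_mono)
    show "integrable lborel (\<lambda>z. c * ?p z)"
      using integrable_peak[OF q] by (intro integrable_mult_right) auto
    show "c * ?p z \<le> std_normal_density z * \<Psi> z" for z
    proof (cases "z \<in> near \<delta> q")
      case True
      have "std_normal_density z * (c * phi S (sqrt q * \<bar>z\<bar>) ^ n) \<le> std_normal_density z * \<Psi> z"
        using \<Psi>(2)[OF True] by (intro mult_left_mono) auto
      thus ?thesis using True by (simp add: mult_ac)
    qed (use \<Psi>(1) in simp)
  qed (use I in \<open>simp add: has_bochner_integral_iff\<close>)
  also have "\<dots> = I" using I by (simp add: has_bochner_integral_iff)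
  finally show ?thesis .
qed

text \<open>While z runs through a unit interval starting at \<open>\<mu>h / sqrt q\<close>, \<mu>
  moves by \<open>sqrt q\<close> only and stays where the rate is at least t. With L = n q the
  leftover Gaussian factor is exactly 1 / sqrt (2 pi).\<close>

lemma peak_ge:
  assumes q: "q > 0" and n: "n > 0" and \<delta>': "0 < \<delta>'" "\<delta>' \<le> \<delta>" "sqrt q \<le> \<delta>'" and t: "t \<ge> 0"
    and lower: "\<And>\<mu>. \<mu> \<in> {\<mu>h..\<mu>h + \<delta>'} \<Longrightarrow> rate S (n * q) \<mu> \<ge> t"
  shows "t ^ n / sqrt (2 * pi) \<le> peak \<delta> n q"
proof -
  define a where "a = \<mu>h / sqrt q"
  have a: "a \<ge> 0" using q \<mu>h_nonneg by (simp add: a_def)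
  let ?p = "\<lambda>z. indicator (near \<delta> q) z * (std_normal_density z * phi S (sqrt q * \<bar>z\<bar>) ^ n)"
  have "t ^ n / sqrt (2 * pi) = (\<integral>z. indicator {a..a + 1} z * (t ^ n / sqrt (2 * pi)) \<partial>lborel)"
    by simp
  also have "\<dots> \<le> (\<integral>z. ?p z \<partial>lborel)"
  proof (rule integral_mono)
    show "indicator {a..a + 1} z * (t ^ n / sqrt (2 * pi)) \<le> ?p z" for z
    proof (cases "z \<in> {a..a + 1}")
      case True
      have z: "\<bar>z\<bar> = z" using True a by auto
      have "sqrt q * a \<le> sqrt q * z" "sqrt q * z \<le> sqrt q * (a + 1)" using True q by auto
      moreover have "sqrt q * a = \<mu>h" using q by (simp add: a_def)
      ultimately have \<mu>: "sqrt q * \<bar>z\<bar> \<in> {\<mu>h..\<mu>h + \<delta>'}" using z \<delta>' by (auto simp: distrib_left)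
      hence "z \<in> near \<delta> q" using \<delta>' by (auto simp: near_def)
      moreover have "t ^ n \<le> rate S (n * q) (sqrt q * \<bar>z\<bar>) ^ n"
        using lower[OF \<mu>] t by (intro power_mono) auto
      moreover have "std_normal_density z * phi S (sqrt q * \<bar>z\<bar>) ^ n =
          rate S (n * q) (sqrt q * \<bar>z\<bar>) ^ n * (1 / sqrt (2 * pi))"
        using gauss_phi_eq[of q "n * q" z S n] q n by simp
      ultimately show ?thesis using True by (simp add: divide_right_mono)
    next
      case False
      thus ?thesis using q by (auto simp: phi_nonneg indicator_def)
    qed
  qed (use integrable_peak[OF q] in auto)
  finally show ?thesis by (simp add: peak_def)
qed

end

section \<open>Loss factor and parity\<close>

lemma eventually_S_sequentially:
  "eventually P sequentially \<Longrightarrow> eventually P (S_sequentially S)"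
  unfolding S_sequentially_def by (rule filter_leD[OF inf_le1])

lemma eventually_S_graphs_nonempty: "\<forall>\<^sub>F n in S_sequentially S. S_graphs S n \<noteq> {}"
  unfolding S_sequentially_def by (simp add: eventually_inf_principal)

lemma filterlim_S_sequentially: "filterlim f F sequentially \<Longrightarrow> filterlim f F (S_sequentially S)"
  unfolding S_sequentially_def by (rule filterlim_mono[OF _ order_refl inf_le1])

lemma eventually_real_S_sequentially:
  "\<forall>\<^sub>F x::real in at_top. P x \<Longrightarrow> \<forall>\<^sub>F n in S_sequentially S. P (real n)"
  by (intro eventually_S_sequentially eventually_compose_filterlim[OF _ filterlim_real_sequentially])

lemma filterlim_real_S_sequentially:
  "(f \<longlongrightarrow> l) (at_top :: real filter) \<Longrightarrow> ((\<lambda>n. f (real n)) \<longlongrightarrow> l) (S_sequentially S)"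
  by (intro filterlim_S_sequentially filterlim_compose[OF _ filterlim_real_sequentially])

definition odds :: "(nat \<Rightarrow> real) \<Rightarrow> nat \<Rightarrow> real" where
  "odds lams n = (lams n / real n) / (1 - lams n / real n)"

text \<open>At this level exp(-\<Delta>) is at most n^(- ln n), below every fixed power of 1 / n,
  while \<Delta>^2 * ln n grows only like (ln n)^5.\<close>

definition trunc_level :: "nat \<Rightarrow> nat" where
  "trunc_level n = nat \<lceil>(ln (real n))\<^sup>2\<rceil>"

text \<open>
  The factor of \<open>config_weight_le_graph_weight\<close> for \<open>m0 = 20 \<Delta>\<^sup>2 + 20\<close> and \<open>q * n\<^sup>2 \<le> C * n\<close>.
\<close>

definition loss :: "real \<Rightarrow> nat \<Rightarrow> real" where
  "loss C n = 2 * real (n * trunc_level n) ^ (12 * (trunc_level n)\<^sup>2) +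
     real (20 * (trunc_level n)\<^sup>2 + 20) * (1 + C * real n) ^ (20 * (trunc_level n)\<^sup>2 + 20)"

lemma trunc_level_bounds: "(ln (real n))\<^sup>2 \<le> real (trunc_level n)" "real (trunc_level n) \<le> (ln (real n))\<^sup>2 + 1"
proof -
  have "real (trunc_level n) = real_of_int \<lceil>(ln (real n))\<^sup>2\<rceil>"
    by (simp add: trunc_level_def)
  thus "(ln (real n))\<^sup>2 \<le> real (trunc_level n)" "real (trunc_level n) \<le> (ln (real n))\<^sup>2 + 1"
    by linarith+
qed

lemma power_le_exp:
  assumes "0 < x" "x \<le> exp y" "real k \<le> z" "y \<ge> 0"
  shows "x ^ k \<le> exp (z * y)"
proof -
  have "x ^ k \<le> exp y ^ k" using assms by (intro power_mono) auto
  also have "\<dots> = exp (real k * y)" by (simp add: exp_of_nat_mult)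
  also have "\<dots> \<le> exp (z * y)" using assms by (simp add: mult_right_mono)
  finally show ?thesis .
qed

text \<open>The logarithm of the loss is of order \<Delta>^2 * ln n; raising the exponent from 5 to
  6 absorbs the constants. The real function \<open>D\<close> bounds the integer level, so that the
  asymptotic comparison is one between functions of a real variable.\<close>

lemma loss_le:
  assumes "C > 0" "K > 0"
  shows "\<forall>\<^sub>F n in S_sequentially S. loss C n * K \<le> exp (ln (real n) ^ 6)"
proof -
  define D where "D = (\<lambda>x::real. (ln x)\<^sup>2 + 1)"
  have "\<forall>\<^sub>F x in at_top. (2 * exp (12 * (D x)\<^sup>2 * ln (x * D x)) +
      (20 * (D x)\<^sup>2 + 20) * exp ((20 * (D x)\<^sup>2 + 20) * ln (1 + C * x))) * K \<le> exp (ln x ^ 6)"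
    unfolding D_def using assms by real_asymp
  from eventually_real_S_sequentially[OF this] eventually_S_sequentially[OF eventually_ge_at_top[of 3]]
  show ?thesis
  proof eventually_elim
    case (elim n)
    let ?u = "2 * exp (12 * (D (real n))\<^sup>2 * ln (real n * D (real n))) +
      (20 * (D (real n))\<^sup>2 + 20) * exp ((20 * (D (real n))\<^sup>2 + 20) * ln (1 + C * real n))"
    have D1: "D (real n) \<ge> 1" by (simp add: D_def)
    have t: "real (trunc_level n) \<le> D (real n)" using trunc_level_bounds[of n] by (simp add: D_def)
    have t2: "real ((trunc_level n)\<^sup>2) \<le> (D (real n))\<^sup>2" using t by (simp add: power_mono)
    have "ln (real n) > 0" using elim by simp
    hence "(ln (real n))\<^sup>2 > 0" by simp
    hence "trunc_level n \<ge> 1" using trunc_level_bounds(1)[of n] by (cases "trunc_level n") auto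
    hence "real (n * trunc_level n) ^ (12 * (trunc_level n)\<^sup>2) \<le> exp (12 * (D (real n))\<^sup>2 * ln (real n * D (real n)))"
      using elim D1 t t2
    proof (intro power_le_exp)
      have "1 * 1 \<le> real n * D (real n)" using elim D1 by (intro mult_mono) auto
      thus "0 \<le> ln (real n * D (real n))" by simp
    qed auto
    moreover have "real (20 * (trunc_level n)\<^sup>2 + 20) * (1 + C * real n) ^ (20 * (trunc_level n)\<^sup>2 + 20) \<le>
      (20 * (D (real n))\<^sup>2 + 20) * exp ((20 * (D (real n))\<^sup>2 + 20) * ln (1 + C * real n))"
    proof (intro mult_mono power_le_exp)
      have "0 < 1 + C * real n" using assms by (intro add_pos_nonneg) auto
      thus "0 < 1 + C * real n" "1 + C * real n \<le> exp (ln (1 + C * real n))" by simp_all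
    qed (use t2 assms in auto)
    ultimately have "loss C n \<le> ?u"
      unfolding loss_def by linarith
    hence "loss C n * K \<le> ?u * K"
      using assms by (intro mult_right_mono) auto
    thus ?case using elim by linarith
  qed
qed

lemma loss_pos:
  assumes "C > 0" shows "loss C n > 0"
proof -
  have "1 + C * real n > 0" using assms by (intro add_pos_nonneg) auto
  hence "real (20 * (trunc_level n)\<^sup>2 + 20) * (1 + C * real n) ^ (20 * (trunc_level n)\<^sup>2 + 20) > 0"
    by (intro mult_pos_pos zero_less_power) (simp_all del: of_nat_add of_nat_mult)
  thus ?thesis unfolding loss_def by (intro add_nonneg_pos) auto
qed

section \<open>Parity: lower bounds for the even part of an n-th power\<close>

lemma abs_phi_minus_le:
  assumes "finite T" "x \<ge> 0" shows "\<bar>phi T (- x)\<bar> \<le> phi T x"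
proof -
  have "\<bar>\<Sum>k\<in>T. (- x) ^ k / fact k\<bar> \<le> (\<Sum>k\<in>T. \<bar>(- x) ^ k / fact k\<bar>)" by (rule sum_abs)
  thus ?thesis using assms by (simp add: phi_finite power_abs)
qed

lemma power_add_power_minus_nonneg:
  assumes "\<bar>w\<bar> \<le> (y::real)" shows "y ^ n + w ^ n \<ge> 0"
proof -
  have "\<bar>w\<bar> ^ n \<le> y ^ n" using assms by (intro power_mono) auto
  thus ?thesis using abs_ge_minus_self[of "w ^ n"] by (simp add: power_abs)
qed

text \<open>Meant for y = phi T \<mu> and w = phi T (- \<mu>). If w is negative, a single factor of
  \<bar>w\<bar>^n is bounded by y - 2 \<tau> and the others by y; this already leaves a constant
  fraction of y^n.\<close>

lemma power_add_power_ge: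
  fixes w y \<tau> M :: real
  assumes w: "\<bar>w\<bar> \<le> y" "w \<ge> 2 * \<tau> - y" and y: "0 < y" "y \<le> M" and \<tau>: "\<tau> > 0" and n: "n > 0"
  shows "y ^ n + w ^ n \<ge> min 1 (2 * \<tau> / M) * y ^ n"
proof (cases "w \<ge> 0")
  case True
  have "min 1 (2 * \<tau> / M) * y ^ n \<le> 1 * y ^ n" using y by (intro mult_right_mono) auto
  thus ?thesis using True by (simp add: add_increasing2)
next
  case False
  obtain k where k: "n = Suc k" using n by (cases n) auto
  have "\<bar>w\<bar> ^ n \<le> (y - 2 * \<tau>) * y ^ k"
    unfolding k power_Suc using False w by (intro mult_mono power_mono) auto
  hence "y ^ n + w ^ n \<ge> 2 * \<tau> * y ^ k"
  proof -
    have "- (w ^ n) \<le> \<bar>w\<bar> ^ n" using abs_ge_minus_self[of "w ^ n"] by (simp only: power_abs)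
    moreover have "(y - 2 * \<tau>) * y ^ k = y ^ n - 2 * \<tau> * y ^ k" by (simp add: k algebra_simps)
    ultimately show ?thesis using \<open>\<bar>w\<bar> ^ n \<le> (y - 2 * \<tau>) * y ^ k\<close> by linarith
  qed
  moreover have "2 * \<tau> / M * y ^ n \<le> 2 * \<tau> * y ^ k"
  proof -
    have "2 * \<tau> / M * y ^ n = (y / M) * (2 * \<tau> * y ^ k)" by (simp add: k)
    also have "\<dots> \<le> 1 * (2 * \<tau> * y ^ k)" using y \<tau> by (intro mult_right_mono) auto
    finally show ?thesis by simp
  qed
  moreover have "min 1 (2 * \<tau> / M) * y ^ n \<le> 2 * \<tau> / M * y ^ n" using y by (intro mult_right_mono) auto
  ultimately show ?thesis by linarith
qed

text \<open>In \<open>phi T x + phi T (- x)\<close> odd terms cancel and even ones double, so any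
  single even term is a lower bound.\<close>

lemma phi_minus_ge:
  assumes "finite T" "s \<in> T" "even s" "x \<ge> 0"
  shows "phi T (- x) \<ge> 2 * (x ^ s / fact s) - phi T x"
proof -
  have "2 * (x ^ s / fact s) = ((- x) ^ s + x ^ s) / fact s" using assms by simp
  also have "\<dots> \<le> (\<Sum>k\<in>T. ((- x) ^ k + x ^ k) / fact k)"
  proof (rule member_le_sum)
    fix k show "0 \<le> ((- x) ^ k + x ^ k) / fact k"
      using assms by (cases "even k") auto
  qed (use assms in auto)
  also have "\<dots> = phi T (- x) + phi T x"
    using assms by (simp add: phi_finite add_divide_distrib sum.distrib)
  finally show ?thesis by simp
qed

lemma even_if_S_graph_odd:
  assumes "S_graphs S n \<noteq> {}" "\<And>s. s \<in> S \<Longrightarrow> odd s"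
  shows "even n"
proof -
  obtain G where G: "G \<subseteq> all_edges n" "\<And>v. v < n \<Longrightarrow> vdegree G v \<in> S"
    using assms by (auto simp: S_graphs_def)
  have "even (\<Sum>v<n. vdegree G v)" using handshake[OF G(1)] by simp
  hence "even (card {v \<in> {..<n}. odd (vdegree G v)})" by (simp add: even_sum_iff)
  also have "{v \<in> {..<n}. odd (vdegree G v)} = {..<n}" using G assms by auto
  finally show ?thesis by simp
qed

context unique_maximizer
begin

abbreviation "F \<equiv> S_sequentially S"

lemma eventually_odds:
  assumes lim: "(lams \<longlongrightarrow> lam) F"
  shows "((\<lambda>n. lams n / real n) \<longlongrightarrow> 0) F"
    and "\<forall>\<^sub>F n in F. 0 < lams n / real n \<and> lams n / real n < 1 \<and> 0 < odds lams n"
    and "((\<lambda>n. real n * odds lams n) \<longlongrightarrow> lam) F"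
    and "(odds lams \<longlongrightarrow> 0) F"
proof -
  have inv: "((\<lambda>n. 1 / real n) \<longlongrightarrow> 0) F"
    by (intro filterlim_S_sequentially lim_1_over_n)
  from tendsto_mult[OF lim inv] show p: "((\<lambda>n. lams n / real n) \<longlongrightarrow> 0) F" by simp
  have n0: "\<forall>\<^sub>F n in F. n > 0" by (intro eventually_S_sequentially eventually_gt_at_top)
  have l0: "\<forall>\<^sub>F n in F. lams n > 0" by (rule order_tendstoD(1)[OF lim lam_pos])
  have p1: "\<forall>\<^sub>F n in F. lams n / real n < 1" by (rule order_tendstoD(2)[OF p]) simp
  show ev: "\<forall>\<^sub>F n in F. 0 < lams n / real n \<and> lams n / real n < 1 \<and> 0 < odds lams n"
    using n0 l0 p1 by eventually_elim (simp add: odds_def)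
  have "((\<lambda>n. lams n / (1 - lams n / real n)) \<longlongrightarrow> lam / (1 - 0)) F"
    by (intro tendsto_intros lim p) auto
  moreover have "\<forall>\<^sub>F n in F. lams n / (1 - lams n / real n) = real n * odds lams n"
    using n0 by eventually_elim (simp add: odds_def)
  ultimately show "((\<lambda>n. real n * odds lams n) \<longlongrightarrow> lam) F"
    using tendsto_cong by force
  have "((\<lambda>n. (lams n / real n) / (1 - lams n / real n)) \<longlongrightarrow> 0 / (1 - 0)) F"
    by (intro tendsto_intros p) auto
  thus "(odds lams \<longlongrightarrow> 0) F" by (simp add: odds_def[abs_def])
qed

lemma phi_near_pos:
  obtains \<delta> m where "\<delta> > 0" "\<delta> \<le> 1" "m > 0" "\<And>\<mu>. \<bar>\<mu> - \<mu>h\<bar> \<le> \<delta> \<Longrightarrow> phi S \<mu> \<ge> m"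
proof -
  have "(phi S \<longlongrightarrow> phi S \<mu>h) (nhds \<mu>h)" using isCont_phi[of \<mu>h S] by (simp add: isCont_def tendsto_at_iff_tendsto_nhds)
  hence "\<forall>\<^sub>F \<mu> in nhds \<mu>h. phi S \<mu>h / 2 < phi S \<mu>"
    by (rule order_tendstoD) (use phi_\<mu>h_pos in simp)
  then obtain d where d: "d > 0" "\<And>\<mu>. dist \<mu> \<mu>h < d \<Longrightarrow> phi S \<mu>h / 2 < phi S \<mu>"
    unfolding eventually_nhds_metric by blast
  show ?thesis
  proof (rule that[of "min (d / 2) 1" "phi S \<mu>h / 2"])
    fix \<mu> assume "\<bar>\<mu> - \<mu>h\<bar> \<le> min (d / 2) 1"
    thus "phi S \<mu>h / 2 \<le> phi S \<mu>" using d(2)[of \<mu>] d(1) by (simp add: dist_real_def)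
  qed (use d phi_\<mu>h_pos in auto)
qed

text \<open>
  For odd \<open>n\<close> the handshake lemma provides an even \<open>s \<in> S\<close>, and its term keeps \<open>phi S (- \<mu>)\<close> away
  from \<open>- phi S \<mu>\<close>.
\<close>

lemma even_part_lower:
  obtains \<delta>0 c0 where "\<delta>0 > 0" "c0 > 0"
    "\<forall>\<^sub>F n in F. \<forall>\<mu>\<ge>0. \<bar>\<mu> - \<mu>h\<bar> \<le> \<delta>0 \<longrightarrow> c0 * phi S \<mu> ^ n \<le>
       (phi (S \<inter> {..trunc_level n}) \<mu> ^ n + phi (S \<inter> {..trunc_level n}) (- \<mu>) ^ n) / 2"
proof -
  obtain \<delta>1 m where \<delta>1: "\<delta>1 > 0" "\<delta>1 \<le> 1" "m > 0" "\<And>\<mu>. \<bar>\<mu> - \<mu>h\<bar> \<le> \<delta>1 \<Longrightarrow> phi S \<mu> \<ge> m"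
    using phi_near_pos by blast
  define M where "M = exp (\<mu>h + 1)"
  \<comment> \<open>If \<open>\<mu>h\<close> = 0, the even element is 0, whose term is constantly 1;
    otherwise the term of any even s stays positive for \<mu> \<ge> \<open>\<mu>h / 2\<close>. If S
    has no even element the values are placeholders.\<close>
  obtain s \<tau> \<delta>2 where s: "\<tau> > 0" "\<delta>2 > 0" "(\<exists>s\<in>S. even s) \<Longrightarrow> s \<in> S \<and> even s \<and> (\<forall>\<mu>\<ge>0. \<bar>\<mu> - \<mu>h\<bar> \<le> \<delta>2 \<longrightarrow> \<mu> ^ s / fact s \<ge> \<tau>)"
  proof (cases "\<mu>h = 0")
    case True
    show ?thesis by (rule that[of 1 1 0]) (use \<mu>h_0[OF True] in auto)
  next
    case False
    show ?thesis
    proof (cases "\<exists>s\<in>S. even s")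
      case True
      then obtain s where s: "s \<in> S" "even s" by blast
      show ?thesis
      proof (rule that[of "(\<mu>h / 2) ^ s / fact s" "\<mu>h / 2" s])
        have "(\<mu>h / 2) ^ s / fact s \<le> \<mu> ^ s / fact s" if "\<bar>\<mu> - \<mu>h\<bar> \<le> \<mu>h / 2" for \<mu>
        proof -
          have "\<mu>h / 2 \<le> \<mu>" using that by linarith
          thus ?thesis using \<mu>h_nonneg by (intro divide_right_mono power_mono) auto
        qed
        thus "s \<in> S \<and> even s \<and> (\<forall>\<mu>\<ge>0. \<bar>\<mu> - \<mu>h\<bar> \<le> \<mu>h / 2 \<longrightarrow> (\<mu>h / 2) ^ s / fact s \<le> \<mu> ^ s / fact s)"
          using s by blast
      qed (use False \<mu>h_nonneg in auto)
    qed (use that[of 1 1 0] in auto)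
  qed
  define \<delta>0 where "\<delta>0 = min \<delta>1 \<delta>2"
  define c1 where "c1 = min 1 (2 * \<tau> / M)"
  define E where "E = exp (exp 1 * (\<mu>h + 1))"
  have c1: "c1 > 0" using s by (simp add: c1_def M_def)
  \<comment> \<open>A relative truncation error of 1 / (2n) costs only a factor 1 / 2 in the n-th
    power, by Bernoulli's inequality. The level must also reach s.\<close>
  have "\<forall>\<^sub>F x in at_top. exp (- (ln x)\<^sup>2) * E \<le> m / (2 * x) \<and> real s \<le> (ln x)\<^sup>2 \<and> x > 0"
    using \<open>m > 0\<close> unfolding E_def by (intro eventually_conj) real_asymp+
  hence ev: "\<forall>\<^sub>F n in F. exp (- (ln (real n))\<^sup>2) * E \<le> m / (2 * real n) \<and> real s \<le> (ln (real n))\<^sup>2 \<and> real n > 0"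
    by (rule eventually_real_S_sequentially)
  have "\<forall>\<^sub>F n in F. \<forall>\<mu>\<ge>0. \<bar>\<mu> - \<mu>h\<bar> \<le> \<delta>0 \<longrightarrow> c1 / 4 * phi S \<mu> ^ n \<le>
       (phi (S \<inter> {..trunc_level n}) \<mu> ^ n + phi (S \<inter> {..trunc_level n}) (- \<mu>) ^ n) / 2"
    using ev eventually_S_graphs_nonempty[of S]
  proof eventually_elim
    case (elim n)
    define T where "T = S \<inter> {..trunc_level n}"
    have fT: "finite T" by (simp add: T_def)
    have n: "n > 0" using elim by simp
    show ?case
    proof (intro allI impI)
      fix \<mu> assume \<mu>: "\<mu> \<ge> 0" "\<bar>\<mu> - \<mu>h\<bar> \<le> \<delta>0"
      have \<mu>le: "\<mu> \<le> \<mu>h + 1" using \<mu> \<delta>1 by (auto simp: \<delta>0_def abs_le_iff)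
      have \<phi>: "phi S \<mu> \<ge> m" using \<mu> by (intro \<delta>1) (auto simp: \<delta>0_def)
      have "exp (- real (trunc_level n)) * exp (exp 1 * \<mu>) \<le> exp (- (ln (real n))\<^sup>2) * E"
        unfolding E_def using trunc_level_bounds[of n] \<mu>le by (intro mult_mono) auto
      also have "\<dots> \<le> m / (2 * real n)" using elim by simp
      also have "\<dots> \<le> phi S \<mu> / (2 * real n)" using \<phi> by (intro divide_right_mono) auto
      finally have "phi S \<mu> \<le> phi T \<mu> + phi S \<mu> / (2 * real n)"
        using phi_le_truncated[OF \<mu>(1), of S "trunc_level n"] by (simp add: T_def)
      hence T: "phi S \<mu> * (1 + - 1 / (2 * real n)) \<le> phi T \<mu>" by (simp add: algebra_simps)
      have "1 / 2 * phi S \<mu> ^ n \<le> (1 + - 1 / (2 * real n)) ^ n * phi S \<mu> ^ n"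
      proof (intro mult_right_mono)
        have "1 + real n * (- 1 / (2 * real n)) \<le> (1 + - 1 / (2 * real n)) ^ n"
          using n by (intro Bernoulli_inequality) (simp add: field_simps)
        thus "1 / 2 \<le> (1 + - 1 / (2 * real n)) ^ n" using n by simp
      qed (use \<phi> \<open>m > 0\<close> in auto)
      also have "\<dots> = (phi S \<mu> * (1 + - 1 / (2 * real n))) ^ n" by (simp add: power_mult_distrib mult.commute)
      also have "\<dots> \<le> phi T \<mu> ^ n"
        using T \<phi> \<open>m > 0\<close> n by (intro power_mono mult_nonneg_nonneg) (auto simp: field_simps)
      finally have half: "1 / 2 * phi S \<mu> ^ n \<le> phi T \<mu> ^ n" .
      have "0 < phi S \<mu> * (1 + - 1 / (2 * real n))"
        using \<phi> \<open>m > 0\<close> n by (intro mult_pos_pos) (auto simp: field_simps)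
      hence Tpos: "phi T \<mu> > 0" using T by linarith
      have "phi T \<mu> \<le> exp \<mu>" using \<mu> by (rule_tac phi_le_exp) 
      also have "\<dots> \<le> M" using \<mu>le by (simp add: M_def)
      finally have TM: "phi T \<mu> \<le> M" .
      have "c1 * phi T \<mu> ^ n \<le> phi T \<mu> ^ n + phi T (- \<mu>) ^ n"
      proof (cases "\<exists>s\<in>S. even s")
        case True
        have "s \<le> trunc_level n" using elim trunc_level_bounds(1)[of n] by linarith
        hence sT: "s \<in> T" "even s" "\<mu> ^ s / fact s \<ge> \<tau>" using s(3)[OF True] \<mu> by (auto simp: T_def \<delta>0_def)
        have "phi T (- \<mu>) \<ge> 2 * \<tau> - phi T \<mu>" using phi_minus_ge[OF fT sT(1,2) \<mu>(1)] sT(3) by linarith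
        thus ?thesis unfolding c1_def
          by (intro power_add_power_ge abs_phi_minus_le fT \<mu> Tpos TM s n)
      next
        case False
        hence "even n" using elim even_if_S_graph_odd[of S n] by blast
        hence "phi T (- \<mu>) ^ n \<ge> 0" by (simp add: zero_le_even_power)
        moreover have "c1 * phi T \<mu> ^ n \<le> 1 * phi T \<mu> ^ n"
          using Tpos by (intro mult_right_mono) (auto simp: c1_def)
        ultimately show ?thesis by simp
      qed
      moreover have "c1 * (1 / 2 * phi S \<mu> ^ n) \<le> c1 * phi T \<mu> ^ n" using half c1 by (intro mult_left_mono) auto
      ultimately show "c1 / 4 * phi S \<mu> ^ n \<le>
        (phi (S \<inter> {..trunc_level n}) \<mu> ^ n + phi (S \<inter> {..trunc_level n}) (- \<mu>) ^ n) / 2"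
        unfolding T_def by simp
    qed
  qed
  moreover have "\<delta>0 > 0" using \<delta>1 s by (simp add: \<delta>0_def)
  ultimately show ?thesis using that[of \<delta>0 "c1 / 4"] c1 by simp
qed

section \<open>Comparison with the independent model\<close>

definition Z :: "(nat \<Rightarrow> real) \<Rightarrow> nat \<Rightarrow> nat set set set \<Rightarrow> real" where
  "Z lams n X = graph_weight (odds lams n) (X \<inter> S_graphs S n)"

definition degs :: "nat \<Rightarrow> nat set set set \<Rightarrow> (nat \<Rightarrow> nat) set" where
  "degs n X = deg_fun n ` (X \<inter> S_graphs S n)"

lemma degs_subset: "degs n X \<subseteq> {..<n} \<rightarrow>\<^sub>E (S \<inter> {..<n})"
  using deg_fun_S_graphs unfolding degs_def by blast

lemma deg_poly_degs_le:
  assumes "\<mu> \<ge> 0" shows "deg_poly n (degs n X) \<mu> \<le> phi S \<mu> ^ n"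
proof -
  have "deg_poly n (degs n X) \<mu> \<le> deg_poly n ({..<n} \<rightarrow>\<^sub>E (S \<inter> {..<n})) \<mu>"
    by (intro deg_poly_mono degs_subset assms finite_PiE) auto
  also have "\<dots> = phi (S \<inter> {..<n}) \<mu> ^ n" by (rule deg_poly_PiE) simp
  also have "\<dots> \<le> phi S \<mu> ^ n" using assms by (intro power_mono phi_mono phi_nonneg) auto
  finally show ?thesis .
qed

lemma deg_poly_even_abs:
  "deg_poly n D (sqrt q * z) + deg_poly n D (- (sqrt q * z)) =
   deg_poly n D (sqrt q * \<bar>z\<bar>) + deg_poly n D (- (sqrt q * \<bar>z\<bar>))"
  by (cases "z \<ge> 0") auto

text \<open>Upper half of the comparison: a bound \<open>b\<close> for the independent model, valid
  for every \<mu> near \<open>\<mu>h\<close>, passes to graphs through the Gaussian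
  integral.\<close>

lemma Z_le:
  assumes "odds lams n > 0" "\<kappa> > 0" "n * odds lams n \<le> lam + \<kappa> / 2" "t \<ge> 0"
    and "\<And>\<mu>. \<mu> \<ge> 0 \<Longrightarrow> \<bar>\<mu> - \<mu>h\<bar> > \<delta> \<Longrightarrow> rate S (lam + \<kappa>) \<mu> \<le> t"
    and b: "\<And>\<mu>. \<mu> \<ge> 0 \<Longrightarrow> \<bar>\<mu> - \<mu>h\<bar> \<le> \<delta> \<Longrightarrow> deg_poly n (degs n X) \<mu> \<le> b * phi S \<mu> ^ n"
  shows "Z lams n X \<le> b * peak \<delta> n (odds lams n) + t ^ n / sqrt (\<kappa> / (2 * (lam + \<kappa>)))"
proof -
  define q where "q = odds lams n"
  let ?\<Psi> = "\<lambda>z. (deg_poly n (degs n X) (sqrt q * z) + deg_poly n (degs n X) (- (sqrt q * z))) / 2"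
  have le: "?\<Psi> z \<le> deg_poly n (degs n X) (sqrt q * \<bar>z\<bar>)" for z
    unfolding deg_poly_even_abs[of n _ q z] using assms(1) by (intro deg_poly_even_part_le) (simp add: q_def)
  have "Z lams n X \<le> config_weight n q (degs n X)"
    unfolding Z_def degs_def q_def[symmetric] using assms(1)
    by (intro graph_weight_le_config_weight) (auto simp: S_graphs_def q_def)
  also have "\<dots> \<le> b * peak \<delta> n q + t ^ n / sqrt (\<kappa> / (2 * (lam + \<kappa>)))"
  proof (rule integral_le_peak[where \<Psi> = ?\<Psi>])
    show "has_bochner_integral lborel (\<lambda>z. std_normal_density z * ?\<Psi> z) (config_weight n q (degs n X))"
      using assms(1) by (intro has_bochner_integral_config_weight) (simp add: q_def)
    fix z
    have z: "sqrt q * \<bar>z\<bar> \<ge> 0" using assms(1) by (simp add: q_def)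
    show "?\<Psi> z \<le> phi S (sqrt q * \<bar>z\<bar>) ^ n"
      using le[of z] deg_poly_degs_le[OF z, of n X] by linarith
    show "?\<Psi> z \<le> b * phi S (sqrt q * \<bar>z\<bar>) ^ n" if "z \<in> near \<delta> q"
      using le[of z] b[OF z] that by (simp add: near_def)
  qed (use assms in \<open>auto simp: q_def\<close>)
  finally show ?thesis by (simp add: q_def)
qed

text \<open>Lower half: the truncated degree sequences alone suffice. Truncation and parity cost a
  constant near \<open>\<mu>h\<close> (\<open>even_part_lower\<close>), and simplicity of the graphs
  costs \<open>loss\<close>. The constants are fixed before \<open>lams\<close>.\<close>

lemma peak_le_Z:
  obtains \<delta>0 c0 C where "\<delta>0 > 0" "c0 > 0" "C > 0"
    "\<And>lams. (lams \<longlongrightarrow> lam) F \<Longrightarrow> \<forall>\<^sub>F n in F. \<forall>\<delta>\<le>\<delta>0.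
       c0 * peak \<delta> n (odds lams n) \<le> loss C n * Z lams n UNIV"
proof -
  obtain \<delta>0 c0 where c0: "\<delta>0 > 0" "c0 > 0"
    "\<forall>\<^sub>F n in F. \<forall>\<mu>\<ge>0. \<bar>\<mu> - \<mu>h\<bar> \<le> \<delta>0 \<longrightarrow> c0 * phi S \<mu> ^ n \<le>
       (phi (S \<inter> {..trunc_level n}) \<mu> ^ n + phi (S \<inter> {..trunc_level n}) (- \<mu>) ^ n) / 2"
    using even_part_lower by blast
  define C where "C = lam + 1"
  have C: "C > 0" using lam_pos by (simp add: C_def)
  show ?thesis
  proof (rule that[OF c0(1,2) C])
    fix lams :: "nat \<Rightarrow> real" assume lim: "(lams \<longlongrightarrow> lam) F"
    \<comment> \<open>Ensures 2 m0 \<le> n for m0 = 20 \<Delta>^2 + 20, which exceeds the threshold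
      8 \<Delta>^2 + 2 \<Delta> of the switching argument; n \<ge> 3 makes \<Delta> at least
      1.\<close>
    have "\<forall>\<^sub>F x::real in at_top. 2 * (20 * ((ln x)\<^sup>2 + 1)\<^sup>2 + 20) \<le> x \<and> x \<ge> 3"
      by (intro eventually_conj) real_asymp+
    hence ev: "\<forall>\<^sub>F n in F. 2 * (20 * ((ln (real n))\<^sup>2 + 1)\<^sup>2 + 20) \<le> real n \<and> real n \<ge> 3"
      by (rule eventually_real_S_sequentially)
    have "\<forall>\<^sub>F n in F. real n * odds lams n < C"
      using eventually_odds(3)[OF lim] by (rule order_tendstoD) (simp add: C_def)
    with c0(3) ev eventually_odds(2)[OF lim]
    show "\<forall>\<^sub>F n in F. \<forall>\<delta>\<le>\<delta>0. c0 * peak \<delta> n (odds lams n) \<le> loss C n * Z lams n UNIV"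
    proof eventually_elim
      case (elim n)
      define q where "q = odds lams n"
      define \<Delta> where "\<Delta> = trunc_level n"
      define T where "T = S \<inter> {..\<Delta>}"
      define D where "D = ({..<n} \<rightarrow>\<^sub>E T)"
      define m0 where "m0 = 20 * \<Delta>\<^sup>2 + 20"
      have q: "q > 0" using elim by (simp add: q_def)
      have fT: "finite T" by (simp add: T_def)
      have "ln (real n) > 0" using elim by simp
      hence "(ln (real n))\<^sup>2 > 0" by simp
      hence \<Delta>: "\<Delta> \<ge> 1" unfolding \<Delta>_def using trunc_level_bounds(1)[of n] by (cases "trunc_level n") auto
      have "real \<Delta> \<le> (ln (real n))\<^sup>2 + 1" unfolding \<Delta>_def by (rule trunc_level_bounds)
      hence "(real \<Delta>)\<^sup>2 \<le> ((ln (real n))\<^sup>2 + 1)\<^sup>2" by (intro power_mono) auto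
      moreover have "real (2 * m0) = 40 * (real \<Delta>)\<^sup>2 + 40" by (simp add: m0_def)
      ultimately have "real (2 * m0) \<le> real n" using elim by argo
      hence nm: "2 * m0 \<le> n" by (simp only: of_nat_le_iff)
      have m0: "m0 > 2 * ((\<Delta> + 1) * \<Delta>) + 6 * \<Delta>\<^sup>2"
      proof -
        have "\<Delta> \<le> \<Delta>\<^sup>2" by (simp add: power2_eq_square)
        moreover have "2 * ((\<Delta> + 1) * \<Delta>) = 2 * \<Delta>\<^sup>2 + 2 * \<Delta>" by (simp add: power2_eq_square)
        ultimately show ?thesis by (simp add: m0_def)
      qed
      let ?\<Psi> = "\<lambda>z. (deg_poly n D (sqrt q * z) + deg_poly n D (- (sqrt q * z))) / 2"
      have \<Psi>: "?\<Psi> z = (phi T (sqrt q * \<bar>z\<bar>) ^ n + phi T (- (sqrt q * \<bar>z\<bar>)) ^ n) / 2" for z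
        unfolding D_def deg_poly_PiE[OF fT] by (cases "z \<ge> 0") auto
      have Z0: "Z lams n UNIV \<ge> 0"
        unfolding Z_def graph_weight_def using q by (intro sum_nonneg) (simp add: q_def)
      have "config_weight n q D \<le>
        (2 * real (n * \<Delta>) ^ (12 * \<Delta>\<^sup>2) + m0 * (1 + q * real n ^ 2) ^ m0) * graph_weight q (S_graphs S n)"
        unfolding D_def
        by (rule config_weight_le_graph_weight) (use q \<Delta> m0 nm in \<open>auto simp: T_def\<close>)
      also have "graph_weight q (S_graphs S n) = Z lams n UNIV" by (simp add: Z_def q_def)
      also have "(2 * real (n * \<Delta>) ^ (12 * \<Delta>\<^sup>2) + m0 * (1 + q * real n ^ 2) ^ m0) * Z lams n UNIV
        \<le> loss C n * Z lams n UNIV"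
      proof (rule mult_right_mono[OF _ Z0])
        have "q * real n ^ 2 = (real n * q) * real n" by (simp add: power2_eq_square)
        also have "\<dots> \<le> C * real n" using elim by (intro mult_right_mono) (auto simp: q_def)
        finally have "(1 + q * real n ^ 2) ^ m0 \<le> (1 + C * real n) ^ m0"
          using q by (intro power_mono) auto
        thus "2 * real (n * \<Delta>) ^ (12 * \<Delta>\<^sup>2) + m0 * (1 + q * real n ^ 2) ^ m0 \<le> loss C n"
          unfolding loss_def \<Delta>_def[symmetric] m0_def[symmetric] by (simp add: mult_left_mono)
      qed
      finally have up: "config_weight n q D \<le> loss C n * Z lams n UNIV" .
      show ?case
      proof (intro allI impI)
        fix \<delta> assume \<delta>: "\<delta> \<le> \<delta>0"
        have "c0 * peak \<delta> n q \<le> config_weight n q D"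
        proof (rule peak_le_integral[where \<Psi> = ?\<Psi>])
          show "has_bochner_integral lborel (\<lambda>z. std_normal_density z * ?\<Psi> z) (config_weight n q D)"
            using q by (intro has_bochner_integral_config_weight) simp
          fix z
          have z: "sqrt q * \<bar>z\<bar> \<ge> 0" using q by simp
          show "0 \<le> ?\<Psi> z" unfolding \<Psi>
            using power_add_power_minus_nonneg[OF abs_phi_minus_le[OF fT z], of n] by simp
          show "c0 * phi S (sqrt q * \<bar>z\<bar>) ^ n \<le> ?\<Psi> z" if "z \<in> near \<delta> q"
            unfolding \<Psi> T_def \<Delta>_def using elim(1) z that \<delta> by (auto simp: near_def)
        qed (rule q)
        thus "c0 * peak \<delta> n (odds lams n) \<le> loss C n * Z lams n UNIV" using up by (simp add: q_def)
      qed
    qed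
  qed
qed

lemma eventually_peak_ge:
  assumes "\<delta> > 0" "\<eta> > 0" and lim: "(lams \<longlongrightarrow> lam) F"
  shows "\<forall>\<^sub>F n in F. (rate S lam \<mu>h * exp (- \<eta>)) ^ n / sqrt (2 * pi) \<le> peak \<delta> n (odds lams n)"
proof -
  obtain \<kappa> \<delta>2 where \<kappa>: "\<kappa> > 0" "\<delta>2 > 0" "\<kappa> < lam"
    "\<And>L \<mu>. \<bar>L - lam\<bar> < \<kappa> \<Longrightarrow> \<mu> \<in> {\<mu>h..\<mu>h + \<delta>2} \<Longrightarrow> rate S L \<mu> \<ge> rate S lam \<mu>h * exp (- \<eta>)"
    using rate_lower_near[OF \<open>\<eta> > 0\<close>] by blast
  define \<delta>' where "\<delta>' = min \<delta> \<delta>2"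
  have \<delta>': "\<delta>' > 0" "\<delta>' \<le> \<delta>" "\<delta>' \<le> \<delta>2" using assms \<kappa> by (auto simp: \<delta>'_def)
  have "\<forall>\<^sub>F n in F. dist (real n * odds lams n) lam < \<kappa>"
    using eventually_odds(3)[OF lim] \<kappa>(1) by (rule tendstoD)
  moreover have "\<forall>\<^sub>F n in F. odds lams n < \<delta>'\<^sup>2"
    using eventually_odds(4)[OF lim] by (rule order_tendstoD) (use \<delta>' in simp)
  moreover have "\<forall>\<^sub>F n in F. n > 0" by (intro eventually_S_sequentially eventually_gt_at_top)
  ultimately show ?thesis using eventually_odds(2)[OF lim]
  proof eventually_elim
    case (elim n)
    show ?case
    proof (rule peak_ge[where \<delta>' = \<delta>'])
      show "sqrt (odds lams n) \<le> \<delta>'"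
        using elim \<delta>' by (intro real_le_lsqrt) auto
      show "rate S lam \<mu>h * exp (- \<eta>) \<le> rate S (n * odds lams n) \<mu>" if "\<mu> \<in> {\<mu>h..\<mu>h + \<delta>'}" for \<mu>
        using \<kappa>(4)[of "n * odds lams n" \<mu>] elim that \<delta>' by (auto simp: dist_real_def)
    qed (use elim \<delta>' rate_\<mu>h_pos in auto)
  qed
qed

text \<open>Away from \<open>\<mu>h\<close> the rate is uniformly below its maximum, while
  \<open>peak\<close> nearly reaches the n-th power of the maximum; the far part is therefore an
  exponentially small multiple of \<open>peak\<close>.\<close>

lemma Z_le_peak:
  assumes \<delta>: "\<delta> > 0"
  obtains c C where "c > 0" "C > 0"
    "\<And>lams. (lams \<longlongrightarrow> lam) F \<Longrightarrow> \<forall>\<^sub>F n in F. \<forall>X b.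
       (\<forall>\<mu>\<ge>0. \<bar>\<mu> - \<mu>h\<bar> \<le> \<delta> \<longrightarrow> deg_poly n (degs n X) \<mu> \<le> b * phi S \<mu> ^ n) \<longrightarrow>
       Z lams n X \<le> (b + C * exp (- c * real n)) * peak \<delta> n (odds lams n)"
proof -
  define r where "r = rate S lam \<mu>h"
  have r: "r > 0" using rate_\<mu>h_pos by (simp add: r_def)
  define A where "A = {\<mu>. 0 \<le> \<mu>} \<inter> {\<mu>. \<delta> \<le> \<bar>\<mu> - \<mu>h\<bar>}"
  have "closed A" unfolding A_def by (intro closed_Int closed_Collect_le continuous_intros)
  moreover have "A \<subseteq> {0..}" by (auto simp: A_def)
  moreover have "rate S lam \<mu> < r" if "\<mu> \<in> A" for \<mu>
    using that \<delta> rate_less[of \<mu>] by (auto simp: A_def r_def)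
  ultimately obtain \<kappa> t where t: "\<kappa> > 0" "0 < t" "t < r" "\<And>\<mu>. \<mu> \<in> A \<Longrightarrow> rate S (lam + \<kappa>) \<mu> \<le> t"
    using rate_uniform_bound[of A r] r by blast
  \<comment> \<open>Since t = r exp(-2 \<eta>), one factor exp(-\<eta> n) pays for the lower bound
    of \<open>peak\<close> and the other remains as decay.\<close>
  define \<eta> where "\<eta> = ln (r / t) / 2"
  have \<eta>: "\<eta> > 0" using t r by (simp add: \<eta>_def)
  have "exp (2 * \<eta>) = r / t" using t r by (simp add: \<eta>_def)
  hence "t = r * exp (- (2 * \<eta>))" using t r by (simp add: exp_minus field_simps)
  also have "exp (- (2 * \<eta>)) = exp (- \<eta>) * exp (- \<eta>)" by (simp flip: exp_add)
  finally have t_eq: "t = r * exp (- \<eta>) * exp (- \<eta>)" by simp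
  define C where "C = sqrt (2 * pi) / sqrt (\<kappa> / (2 * (lam + \<kappa>)))"
  have C: "C > 0" using t lam_pos by (simp add: C_def)
  show ?thesis
  proof (rule that[OF \<eta> C])
    fix lams :: "nat \<Rightarrow> real" assume lim: "(lams \<longlongrightarrow> lam) F"
    have "\<forall>\<^sub>F n in F. real n * odds lams n < lam + \<kappa> / 2"
      using eventually_odds(3)[OF lim] by (rule order_tendstoD) (use t in simp)
    with eventually_peak_ge[OF \<delta> \<eta> lim] eventually_odds(2)[OF lim]
    show "\<forall>\<^sub>F n in F. \<forall>X b.
       (\<forall>\<mu>\<ge>0. \<bar>\<mu> - \<mu>h\<bar> \<le> \<delta> \<longrightarrow> deg_poly n (degs n X) \<mu> \<le> b * phi S \<mu> ^ n) \<longrightarrow>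
       Z lams n X \<le> (b + C * exp (- \<eta> * real n)) * peak \<delta> n (odds lams n)"
    proof eventually_elim
      case (elim n)
      show ?case
      proof (intro allI impI)
        fix X b assume *: "\<forall>\<mu>\<ge>0. \<bar>\<mu> - \<mu>h\<bar> \<le> \<delta> \<longrightarrow> deg_poly n (degs n X) \<mu> \<le> b * phi S \<mu> ^ n"
        let ?p = "peak \<delta> n (odds lams n)"
        have "Z lams n X \<le> b * ?p + t ^ n / sqrt (\<kappa> / (2 * (lam + \<kappa>)))"
        proof (rule Z_le)
          show "rate S (lam + \<kappa>) \<mu> \<le> t" if "\<mu> \<ge> 0" "\<bar>\<mu> - \<mu>h\<bar> > \<delta>" for \<mu>
            using that by (intro t) (auto simp: A_def)
        qed (use elim t * in auto)
        also have "t ^ n = (r * exp (- \<eta>)) ^ n * exp (- \<eta> * real n)"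
          unfolding t_eq power_mult_distrib[of _ "exp (- \<eta>)"] by (simp add: exp_of_nat_mult[symmetric] mult.commute)
        also have "\<dots> / sqrt (\<kappa> / (2 * (lam + \<kappa>))) =
            (r * exp (- \<eta>)) ^ n / sqrt (2 * pi) * (C * exp (- \<eta> * real n))"
          by (simp add: C_def)
        also have "\<dots> \<le> ?p * (C * exp (- \<eta> * real n))"
          using elim C by (intro mult_right_mono) (auto simp: r_def)
        finally show "Z lams n X \<le> (b + C * exp (- \<eta> * real n)) * ?p" by (simp add: algebra_simps)
      qed
    qed
  qed
qed

abbreviation "pr lams n \<equiv> measure_pmf.prob (gnpS n (lams n / real n) S)"

text \<open>The order of quantifiers matters: \<open>X\<close> and \<open>b\<close> come after the
  eventual n, so events may vary with n, and c comes before \<open>lams\<close>, so it does not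
  depend on the sequence.\<close>

definition tilting_bound :: "real \<Rightarrow> real \<Rightarrow> bool" where
  "tilting_bound \<delta> c \<longleftrightarrow> (\<forall>lams. (lams \<longlongrightarrow> lam) F \<longrightarrow> (\<forall>\<^sub>F n in F. \<forall>X b. b \<ge> 0 \<longrightarrow>
     (\<forall>\<mu>\<ge>0. \<bar>\<mu> - \<mu>h\<bar> \<le> \<delta> \<longrightarrow> deg_poly n (degs n X) \<mu> \<le> b * phi S \<mu> ^ n) \<longrightarrow>
     pr lams n X \<le> exp (ln (real n) ^ 6) * (b + exp (- c * real n))))"

text \<open>The quotient of \<open>Z_le_peak\<close> and \<open>peak_le_Z\<close>, in which
  \<open>peak\<close> cancels; the loss and the constants go into exp((ln n)^6).\<close>

theorem prob_bound:
  obtains \<delta>0 where "\<delta>0 > 0" "\<And>\<delta>. 0 < \<delta> \<Longrightarrow> \<delta> \<le> \<delta>0 \<Longrightarrow> \<exists>c>0. tilting_bound \<delta> c"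
proof -
  obtain \<delta>0 c0 C0 where 0: "\<delta>0 > 0" "c0 > 0" "C0 > 0"
    "\<And>lams. (lams \<longlongrightarrow> lam) F \<Longrightarrow> \<forall>\<^sub>F n in F. \<forall>\<delta>\<le>\<delta>0.
       c0 * peak \<delta> n (odds lams n) \<le> loss C0 n * Z lams n UNIV"
    using peak_le_Z by blast
  show ?thesis
  proof (rule that[OF 0(1)])
    fix \<delta> assume \<delta>: "0 < \<delta>" "\<delta> \<le> \<delta>0"
    obtain c C where C: "c > 0" "C > 0"
      "\<And>lams. (lams \<longlongrightarrow> lam) F \<Longrightarrow> \<forall>\<^sub>F n in F. \<forall>X b.
       (\<forall>\<mu>\<ge>0. \<bar>\<mu> - \<mu>h\<bar> \<le> \<delta> \<longrightarrow> deg_poly n (degs n X) \<mu> \<le> b * phi S \<mu> ^ n) \<longrightarrow>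
       Z lams n X \<le> (b + C * exp (- c * real n)) * peak \<delta> n (odds lams n)"
      using Z_le_peak[OF \<delta>(1)] by blast
    define K where "K = max 1 C / c0"
    have K: "K > 0" using 0 by (simp add: K_def)
    show "\<exists>c>0. tilting_bound \<delta> c"
      unfolding tilting_bound_def
    proof (intro exI[of _ c] conjI C allI impI)
      fix lams :: "nat \<Rightarrow> real" assume lim: "(lams \<longlongrightarrow> lam) F"
      show "\<forall>\<^sub>F n in F. \<forall>X b. b \<ge> 0 \<longrightarrow>
       (\<forall>\<mu>\<ge>0. \<bar>\<mu> - \<mu>h\<bar> \<le> \<delta> \<longrightarrow> deg_poly n (degs n X) \<mu> \<le> b * phi S \<mu> ^ n) \<longrightarrow>
       pr lams n X \<le> exp (ln (real n) ^ 6) * (b + exp (- c * real n))"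
        using C(3)[OF lim] 0(4)[OF lim] loss_le[OF 0(3) K]
          eventually_odds(2)[OF lim] eventually_S_graphs_nonempty[of S]
      proof eventually_elim
        case (elim n)
        show ?case
        proof (intro allI impI)
          fix X b assume b: "b \<ge> 0"
            and *: "\<forall>\<mu>\<ge>0. \<bar>\<mu> - \<mu>h\<bar> \<le> \<delta> \<longrightarrow> deg_poly n (degs n X) \<mu> \<le> b * phi S \<mu> ^ n"
          let ?p = "peak \<delta> n (odds lams n)" and ?e = "exp (- c * real n)"
          have Zpos: "Z lams n UNIV > 0"
            unfolding Z_def graph_weight_def using elim by (intro sum_pos) auto
          have "pr lams n X = Z lams n X / Z lams n UNIV"
            using elim by (subst prob_gnpS) (auto simp: Z_def odds_def)
          also have "\<dots> \<le> (b + C * ?e) * ?p / Z lams n UNIV"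
            using elim(1) * Zpos by (intro divide_right_mono) auto
          also have "\<dots> \<le> (b + C * ?e) * (loss C0 n * Z lams n UNIV / c0) / Z lams n UNIV"
            using elim(2) \<delta> 0 Zpos b C by (intro divide_right_mono mult_left_mono) (auto simp: field_simps)
          also have "\<dots> = loss C0 n * ((b + C * ?e) / c0)" using Zpos by simp
          also have "\<dots> \<le> loss C0 n * (K * (b + ?e))"
          proof (rule mult_left_mono)
            have "b + C * ?e \<le> max 1 C * b + max 1 C * ?e"
              using b mult_right_mono[of 1 "max 1 C" b] by (intro add_mono mult_right_mono) auto
            hence "(b + C * ?e) / c0 \<le> (max 1 C * b + max 1 C * ?e) / c0"
              using 0(2) by (intro divide_right_mono) auto
            also have "\<dots> = K * (b + ?e)" by (simp add: K_def distrib_left add_divide_distrib)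
            finally show "(b + C * ?e) / c0 \<le> K * (b + ?e)" .
          qed (use loss_pos[OF 0(3)] in \<open>simp add: less_imp_le\<close>)
          also have "\<dots> = loss C0 n * K * (b + ?e)" by simp
          also have "\<dots> \<le> exp (ln (real n) ^ 6) * (b + ?e)"
            using elim(3) b by (intro mult_right_mono) auto
          finally show "pr lams n X \<le> exp (ln (real n) ^ 6) * (b + ?e)" .
        qed
      qed
    qed
  qed
qed

section \<open>Exponential growth rate of the partition function\<close>

lemma eventually_Z_bounds:
  assumes \<eta>: "\<eta> > 0" and lim: "(lams \<longlongrightarrow> lam) F"
  shows "\<forall>\<^sub>F n in F. (rate S lam \<mu>h * exp (- \<eta>)) ^ n \<le> Z lams n UNIV \<and>
     Z lams n UNIV \<le> (rate S lam \<mu>h * exp \<eta>) ^ n"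
proof -
  define r where "r = rate S lam \<mu>h"
  have r: "r > 0" using rate_\<mu>h_pos by (simp add: r_def)
  have ex: "exp (x / 2) * exp (x / 2) = exp x" for x :: real by (simp flip: exp_add)
  have "rate S lam \<mu> < r * exp (\<eta> / 2)" if "\<mu> \<in> {0..}" for \<mu>
  proof -
    have "rate S lam \<mu> \<le> r * 1" using rate_le[of \<mu>] that by (simp add: r_def)
    also have "\<dots> < r * exp (\<eta> / 2)" using r \<eta> by (intro mult_strict_left_mono) auto
    finally show ?thesis .
  qed
  then obtain \<kappa> t where t: "\<kappa> > 0" "0 < t" "t < r * exp (\<eta> / 2)"
      "\<And>\<mu>. \<mu> \<in> {0..} \<Longrightarrow> rate S (lam + \<kappa>) \<mu> \<le> t"
    using rate_uniform_bound[of "{0..}" "r * exp (\<eta> / 2)"] r by (auto simp del: atLeast_iff)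
  define c where "c = sqrt (\<kappa> / (2 * (lam + \<kappa>)))"
  have c: "c > 0" using t lam_pos by (simp add: c_def)
  obtain \<delta>0 c0 C0 where 0: "\<delta>0 > 0" "c0 > 0" "C0 > 0"
    "\<And>lams. (lams \<longlongrightarrow> lam) F \<Longrightarrow> \<forall>\<^sub>F n in F. \<forall>\<delta>\<le>\<delta>0.
       c0 * peak \<delta> n (odds lams n) \<le> loss C0 n * Z lams n UNIV"
    using peak_le_Z by blast
  define K where "K = sqrt (2 * pi) / c0"
  have K: "K > 0" using 0 by (simp add: K_def)
  have "\<forall>\<^sub>F x in at_top. exp (ln x ^ 6) \<le> exp (\<eta> / 2 * x) \<and> 1 / c \<le> exp (\<eta> / 2 * x)"
    using \<eta> c by (intro eventually_conj) real_asymp+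
  hence ev: "\<forall>\<^sub>F n in F. exp (ln (real n) ^ 6) \<le> exp (\<eta> / 2 * real n) \<and> 1 / c \<le> exp (\<eta> / 2 * real n)"
    by (rule eventually_real_S_sequentially)
  have ev2: "\<forall>\<^sub>F n in F. real n * odds lams n < lam + \<kappa> / 2"
    using eventually_odds(3)[OF lim] by (rule order_tendstoD) (use t in simp)
  have \<eta>2: "\<eta> / 2 > 0" using \<eta> by simp
  have pow: "exp (x / 2) ^ n = exp (x / 2 * real n)" for x :: real and n :: nat
    by (simp add: exp_of_nat_mult[symmetric] mult.commute)
  from 0(4)[OF lim] loss_le[OF 0(3) K]
    eventually_peak_ge[OF 0(1) \<eta>2 lim] eventually_odds(2)[OF lim] ev ev2 show ?thesis
  proof eventually_elim
    case (elim n)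
    have Z0: "Z lams n UNIV \<ge> 0"
      unfolding Z_def graph_weight_def using elim by (intro sum_nonneg) auto
    \<comment> \<open>With radius -1 no \<mu> is near \<open>\<mu>h\<close>: the near condition is
      vacuous, so b = 0 is allowed, and the bound t on the rate holds for all \<mu> \<ge> 0.\<close>
    have "Z lams n UNIV \<le> 0 * peak (-1) n (odds lams n) + t ^ n / sqrt (\<kappa> / (2 * (lam + \<kappa>)))"
      by (rule Z_le) (use elim t in auto)
    also have "\<dots> = t ^ n * (1 / c)" by (simp add: c_def)
    also have "\<dots> \<le> (r * exp (\<eta> / 2)) ^ n * exp (\<eta> / 2 * real n)"
      using t elim r c by (intro mult_mono power_mono) auto
    also have "\<dots> = (r * exp \<eta>) ^ n"
      unfolding pow[symmetric] power_mult_distrib[symmetric] mult.assoc ex ..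
    finally have up: "Z lams n UNIV \<le> (r * exp \<eta>) ^ n" .
    have "(r * exp (- \<eta> / 2)) ^ n \<le> sqrt (2 * pi) * peak \<delta>0 n (odds lams n)"
      using elim(3) by (simp add: r_def field_simps)
    also have "\<dots> \<le> sqrt (2 * pi) * (loss C0 n * Z lams n UNIV / c0)"
      using elim(1) 0 by (intro mult_left_mono) (auto simp: field_simps)
    also have "\<dots> = loss C0 n * K * Z lams n UNIV" by (simp add: K_def)
    also have "\<dots> \<le> exp (\<eta> / 2 * real n) * Z lams n UNIV"
      using elim Z0 by (intro mult_right_mono) linarith+
    finally have "(r * exp (- \<eta> / 2)) ^ n * exp (- \<eta> / 2 * real n) \<le>
        exp (\<eta> / 2 * real n) * Z lams n UNIV * exp (- \<eta> / 2 * real n)"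
      by (rule mult_right_mono) simp
    also have "\<dots> = Z lams n UNIV" by (simp add: mult_ac flip: exp_add)
    also have "(r * exp (- \<eta> / 2)) ^ n * exp (- \<eta> / 2 * real n) = (r * exp (- \<eta>)) ^ n"
      unfolding pow[symmetric] power_mult_distrib[symmetric] mult.assoc ex ..
    finally show ?case using up by (simp add: r_def)
  qed
qed

lemma log_prob_limit:
  assumes lim: "(lams \<longlongrightarrow> lam) F"
  shows "((\<lambda>n. 1 / real n * ln (measure_pmf.prob (gnp n (lams n / real n)) (S_graphs S n)))
           \<longlongrightarrow> psi S \<mu>h - lam / 2) F"
proof -
  define r where "r = rate S lam \<mu>h"
  have r: "r > 0" using rate_\<mu>h_pos by (simp add: r_def)
  define p where "p = (\<lambda>n. lams n / real n)"
  have psi: "psi S \<mu>h = ln r" unfolding r_def by (rule rate_pos_Eset(3)[OF \<mu>h_in_Eset])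
  have n0: "\<forall>\<^sub>F n in F. n > 0" by (intro eventually_S_sequentially eventually_gt_at_top)
  have Zlim: "((\<lambda>n. ln (Z lams n UNIV) / real n) \<longlongrightarrow> ln r) F"
  proof (rule tendstoI)
    fix e :: real assume "e > 0"
    hence e: "e / 2 > 0" by simp
    show "\<forall>\<^sub>F n in F. dist (ln (Z lams n UNIV) / real n) (ln r) < e"
      using eventually_Z_bounds[OF e lim] n0
    proof eventually_elim
      case (elim n)
      have pos: "(r * exp (- (e / 2))) ^ n > 0" using r by simp
      have "ln ((r * exp (- (e / 2))) ^ n) \<le> ln (Z lams n UNIV)"
        using elim pos by (intro ln_mono) (auto simp: r_def)
      moreover have "ln (Z lams n UNIV) \<le> ln ((r * exp (e / 2)) ^ n)"
        using elim pos by (intro ln_mono) (auto simp: r_def)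
      ultimately have "real n * (ln r - e / 2) \<le> ln (Z lams n UNIV)" "ln (Z lams n UNIV) \<le> real n * (ln r + e / 2)"
        using r by (simp_all add: ln_realpow ln_mult)
      hence "ln r - e / 2 \<le> ln (Z lams n UNIV) / real n" "ln (Z lams n UNIV) / real n \<le> ln r + e / 2"
        using elim by (simp_all add: field_simps)
      thus ?case using \<open>e > 0\<close> by (simp add: dist_real_def abs_less_iff)
    qed
  qed
  have "filterlim p (at 0) F"
    unfolding filterlim_at
  proof
    show "(p \<longlongrightarrow> 0) F" unfolding p_def by (rule eventually_odds(1)[OF lim])
    show "\<forall>\<^sub>F n in F. p n \<in> UNIV \<and> p n \<noteq> 0"
      using eventually_odds(2)[OF lim]
    proof eventually_elim
      case (elim n)
      hence "p n > 0" by (simp only: p_def)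
      thus ?case by simp
    qed
  qed
  moreover have "((\<lambda>x::real. ln (1 - x) / x) \<longlongrightarrow> -1) (at 0)" by real_asymp
  ultimately have "((\<lambda>n. ln (1 - p n) / p n) \<longlongrightarrow> -1) F"
    by (rule filterlim_compose[rotated])
  \<comment> \<open>This is ln((1 - p)^(n choose 2)) / n, rewritten with lams n = n p; as ln(1 - p)
    / p tends to -1, it supplies the term -lam / 2.\<close>
  hence "((\<lambda>n. (1 - 1 / real n) / 2 * (lams n * (ln (1 - p n) / p n))) \<longlongrightarrow> (1 - 0) / 2 * (lam * (-1))) F"
    by (intro tendsto_intros lim filterlim_S_sequentially[OF lim_1_over_n])  auto
  hence "((\<lambda>n. (1 - 1 / real n) / 2 * (lams n * (ln (1 - p n) / p n)) + ln (Z lams n UNIV) / real n) \<longlongrightarrow>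
      (1 - 0) / 2 * (lam * (-1)) + ln r) F"
    by (intro tendsto_add Zlim)
  moreover have "\<forall>\<^sub>F n in F. (1 - 1 / real n) / 2 * (lams n * (ln (1 - p n) / p n)) + ln (Z lams n UNIV) / real n =
      1 / real n * ln (measure_pmf.prob (gnp n (lams n / real n)) (S_graphs S n))"
    using n0 eventually_odds(2)[OF lim] eventually_S_graphs_nonempty[of S]
  proof eventually_elim
    case (elim n)
    have Zpos: "Z lams n UNIV > 0"
      unfolding Z_def graph_weight_def using elim by (intro sum_pos) auto
    have p: "0 < p n" "p n < 1" using elim by (auto simp: p_def)
    have "measure_pmf.prob (gnp n (lams n / real n)) (S_graphs S n) = (1 - p n) ^ (n choose 2) * Z lams n UNIV"
      unfolding p_def[symmetric] using p by (subst prob_gnp) (auto simp: S_graphs_def Z_def odds_def p_def)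
    hence "ln (measure_pmf.prob (gnp n (lams n / real n)) (S_graphs S n)) =
        real (n choose 2) * ln (1 - p n) + ln (Z lams n UNIV)"
      using p Zpos by (simp add: ln_mult ln_realpow)
    moreover have "real (n choose 2) = real n * (real n - 1) / 2"
    proof -
      have "even (n * (n - 1))" by (cases n) auto
      hence "n * (n - 1) = 2 * (n choose 2)" by (simp add: choose_two)
      from arg_cong[OF this, of real] show ?thesis using elim by (simp add: of_nat_diff)
    qed
    ultimately have L: "ln (measure_pmf.prob (gnp n (lams n / real n)) (S_graphs S n)) =
        real n * (real n - 1) / 2 * ln (1 - p n) + ln (Z lams n UNIV)" by simp
    have "lams n = real n * p n" using elim by (simp add: p_def)
    hence R: "lams n * (ln (1 - p n) / p n) = real n * ln (1 - p n)" using p by simp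
    show ?case unfolding L R using elim(1) by (simp add: field_simps)
  qed
  ultimately show ?thesis unfolding psi using tendsto_cong by force
qed

end

section \<open>Total variation distance\<close>

lemma integrable_pmf_nat_iff:
  fixes p :: "nat pmf" and f :: "nat \<Rightarrow> real"
  shows "integrable (measure_pmf p) f \<longleftrightarrow> summable (\<lambda>j. norm (pmf p j * f j))"
  unfolding measure_pmf_eq_density
  by (subst integrable_density) (auto simp: integrable_count_space_nat_iff)

lemma expectation_pmf_nat_sums:
  fixes p :: "nat pmf" and f :: "nat \<Rightarrow> real"
  assumes "integrable (measure_pmf p) f"
  shows "(\<lambda>j. pmf p j * f j) sums measure_pmf.expectation p f"
proof -
  have "measure_pmf.expectation p f = (\<integral>j. pmf p j * f j \<partial>count_space UNIV)"
    unfolding measure_pmf_eq_density by (subst integral_density) auto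
  moreover have "integrable (count_space UNIV) (\<lambda>j. pmf p j * f j)"
    using assms unfolding integrable_pmf_nat_iff integrable_count_space_nat_iff .
  ultimately show ?thesis using sums_integral_count_space_nat by metis
qed

lemma pmf_nat_sums_1: "pmf p sums 1" for p :: "nat pmf"
  using expectation_pmf_nat_sums[of p "\<lambda>_. 1"] by simp

lemma summable_dTV: "summable (\<lambda>j. \<bar>pmf p j - pmf q j\<bar>)"
proof (rule summable_comparison_test[OF _ summable_add])
  show "\<exists>N. \<forall>j\<ge>N. norm \<bar>pmf p j - pmf q j\<bar> \<le> pmf p j + pmf q j"
    by (intro exI[of _ 0]) (auto simp: abs_le_iff)
qed (use pmf_nat_sums_1 sums_summable in blast)+

lemma pmf_diff_le_dTV: "\<bar>pmf p j - pmf q j\<bar> \<le> 2 * dTV p q"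
proof -
  have "(\<Sum>i\<in>{j}. \<bar>pmf p i - pmf q i\<bar>) \<le> (\<Sum>i. \<bar>pmf p i - pmf q i\<bar>)"
    by (rule sum_le_suminf[OF summable_dTV]) auto
  thus ?thesis by (simp add: dTV_def)
qed

text \<open>
  Since both laws have total mass 1, the total variation distance is the total deficit of \<open>p\<close>
  relative to \<open>q\<close>; so a large distance forces a one-sided deficit at some small value.
\<close>

lemma dTV_deficit:
  fixes p q :: "nat pmf"
  assumes e: "\<epsilon> > 0" and K: "K > 0" "(\<Sum>j. pmf q (j + K)) \<le> \<epsilon> / 2" and d: "dTV p q \<ge> \<epsilon>"
  shows "\<exists>j<K. pmf p j \<le> pmf q j - \<epsilon> / (2 * real K)"
proof (rule ccontr)
  assume "\<not> ?thesis"
  hence small: "pmf q j - pmf p j < \<epsilon> / (2 * real K)" if "j < K" for j using that by force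
  have sq: "summable (pmf q)" "summable (pmf p)" using pmf_nat_sums_1 sums_summable by blast+
  define h where "h = (\<lambda>j. max 0 (pmf q j - pmf p j))"
  have h: "h = (\<lambda>j. (\<bar>pmf p j - pmf q j\<bar> + (pmf q j - pmf p j)) / 2)"
    by (auto simp: h_def fun_eq_iff max_def)
  have "(\<lambda>j. (\<bar>pmf p j - pmf q j\<bar> + (pmf q j - pmf p j)) / 2) sums (((\<Sum>j. \<bar>pmf p j - pmf q j\<bar>) + (1 - 1)) / 2)"
    by (intro sums_divide sums_add sums_diff pmf_nat_sums_1 summable_sums summable_dTV)
  hence hs: "h sums dTV p q" by (simp add: h dTV_def)
  hence "dTV p q = (\<Sum>j. h (j + K)) + (\<Sum>j<K. h j)"
    using suminf_split_initial_segment[of h K] by (simp add: sums_iff)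
  also have "(\<Sum>j<K. h j) < (\<Sum>j<K. \<epsilon> / (2 * real K))"
    using K e by (intro sum_strict_mono) (auto simp: h_def intro: small)
  also have "(\<Sum>j<K. \<epsilon> / (2 * real K)) = \<epsilon> / 2" using K by simp
  also have "(\<Sum>j. h (j + K)) \<le> (\<Sum>j. pmf q (j + K))"
  proof (rule suminf_le)
    show "h (j + K) \<le> pmf q (j + K)" for j by (simp add: h_def)
    show "summable (\<lambda>j. h (j + K))" using hs sums_summable summable_ignore_initial_segment by blast
    show "summable (\<lambda>j. pmf q (j + K))" using sq summable_ignore_initial_segment by blast
  qed
  finally show False using K d by simp
qed

lemma pow_le_fact_exp:
  assumes "x \<ge> (0::real)" shows "x ^ R \<le> fact R * exp x"
proof -
  have "x ^ R / fact R \<le> exp x"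
    using phi_term_le[of R "{R}" x] phi_le_exp[of x "{R}"] assms by simp
  thus ?thesis by (simp add: field_simps)
qed

lemma powr_le_power_nat:
  assumes "r > 0" "R \<ge> 1" "r \<le> real R" shows "real j powr r \<le> real j ^ R"
proof (cases "j = 0")
  case False
  hence "real j powr r \<le> real j powr real R" using assms by (intro powr_mono) auto
  thus ?thesis using False by (simp add: powr_realpow)
qed (use assms in auto)

text \<open>Bounding j^r by R! * e^j leaves an exponential series at e * \<mu>.\<close>

lemma summable_moment:
  assumes "r > 0" "\<mu> \<ge> 0"
  shows "summable (\<lambda>j. real j powr r * (\<mu> ^ j / fact j))"
proof -
  define R where "R = nat \<lceil>r\<rceil>"
  have R: "R \<ge> 1" "r \<le> real R" using assms by (auto simp: R_def le_nat_iff)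
  have "summable (\<lambda>j. fact R * ((exp 1 * \<mu>) ^ j /\<^sub>R fact j))"
    by (intro summable_mult summable_exp_generic)
  thus ?thesis
  proof (rule summable_comparison_test[rotated], intro exI[of _ 0] allI impI)
    fix j :: nat
    have "real j powr r * (\<mu> ^ j / fact j) \<le> (fact R * exp (real j)) * (\<mu> ^ j / fact j)"
      using powr_le_power_nat[of r R j] pow_le_fact_exp[of "real j" R] assms R
      by (intro mult_right_mono) auto
    also have "exp (real j) = exp 1 ^ j" by (simp flip: exp_of_nat_mult)
    finally show "norm (real j powr r * (\<mu> ^ j / fact j)) \<le> fact R * ((exp 1 * \<mu>) ^ j /\<^sub>R fact j)"
      using assms by (simp add: power_mult_distrib divide_inverse mult_ac)
  qed
qed

lemma n_deg_eq_0:
  assumes "G \<subseteq> all_edges n" "j \<ge> n" shows "n_deg n G j = 0"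
proof -
  have "vdegree G v \<noteq> j" if "v < n" for v
    using vdegree_le[OF assms(1), of v] assms(2) that by linarith
  hence "{v \<in> {..<n}. vdegree G v = j} = {}" by blast
  thus ?thesis by (simp only: n_deg_def card.empty)
qed

lemma sum_degrees_group:
  fixes f :: "nat \<Rightarrow> real"
  shows "(\<Sum>i\<in>{i. i < n \<and> vdegree G i \<le> K}. f (vdegree G i)) = (\<Sum>j\<le>K. f j * real (n_deg n G j))"
proof -
  let ?A = "{i. i < n \<and> vdegree G i \<le> K}"
  have "(\<Sum>i\<in>?A. f (vdegree G i)) = (\<Sum>j\<le>K. \<Sum>i\<in>{i \<in> ?A. vdegree G i = j}. f (vdegree G i))"
    by (rule sum.group[symmetric]) auto
  also have "\<dots> = (\<Sum>j\<le>K. f j * real (n_deg n G j))"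
  proof (rule sum.cong)
    fix j assume "j \<in> {..K}"
    hence "{i \<in> ?A. vdegree G i = j} = {v \<in> {..<n}. vdegree G v = j}" by auto
    thus "(\<Sum>i\<in>{i \<in> ?A. vdegree G i = j}. f (vdegree G i)) = f j * real (n_deg n G j)"
      by (simp add: n_deg_def mult.commute)
  qed simp
  finally show ?thesis .
qed

lemma moment_sums:
  assumes "G \<subseteq> all_edges n"
  shows "(\<lambda>j. real j powr r * real (n_deg n G j) / real n) sums (\<Sum>i<n. real (vdegree G i) powr r / real n)"
proof -
  have "(\<lambda>j. real j powr r * real (n_deg n G j) / real n) sums (\<Sum>j\<le>n. real j powr r * real (n_deg n G j) / real n)"
    by (rule sums_finite) (use n_deg_eq_0[OF assms] in auto)
  also have "(\<Sum>j\<le>n. real j powr r * real (n_deg n G j) / real n) =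
      (\<Sum>j\<le>n. real j powr r * real (n_deg n G j)) / real n"
    by (simp add: sum_divide_distrib)
  also have "\<dots> = (\<Sum>i\<in>{i. i < n \<and> vdegree G i \<le> n}. real (vdegree G i) powr r) / real n"
    by (subst sum_degrees_group) simp
  also have "{i. i < n \<and> vdegree G i \<le> n} = {..<n}"
  proof -
    have "vdegree G i \<le> n" for i using vdegree_le[OF assms, of i] by linarith
    thus ?thesis by auto
  qed
  finally show ?thesis by (simp add: sum_divide_distrib)
qed

lemma one_minus_exp_ge:
  assumes "s \<ge> (0::real)" shows "s - s\<^sup>2 \<le> 1 - exp (- s)"
proof -
  have "exp (- s) \<le> 1 / (1 + s)"
    using exp_ge_add_one_self[of s] assms by (simp add: exp_minus field_simps)
  also have "\<dots> \<le> 1 - s + s\<^sup>2"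
  proof -
    have "0 \<le> s ^ 3" using assms by simp
    hence "1 \<le> (1 - s + s\<^sup>2) * (1 + s)" by (simp add: algebra_simps power2_eq_square power3_eq_cube)
    thus ?thesis using assms by (subst pos_divide_le_eq) auto
  qed
  finally show ?thesis by simp
qed

lemma exp_le_linear:
  assumes "0 \<le> x" "x \<le> (1::real)" shows "exp x \<le> 1 + 2 * x"
proof -
  have "x\<^sup>2 \<le> x" using assms by (simp add: power2_eq_square mult_left_le)
  thus ?thesis using exp_bound[of x] assms by linarith
qed

context unique_maximizer
begin

section \<open>The limit law and deviations of the degree distribution\<close>

abbreviation \<rho> :: "nat \<Rightarrow> real" where "\<rho> j \<equiv> pmf (PoS S \<mu>h) j"

lemma \<rho>_eq: "\<rho> k = (if k \<in> S then \<mu>h ^ k / fact k / phi S \<mu>h else 0)"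
  by (rule pmf_PoS) (use \<mu>h_nonneg \<mu>h_0 S_nonempty in auto)

lemma summable_moment_\<rho>:
  assumes "r > 0" shows "summable (\<lambda>j. real j powr r * \<rho> j)"
proof (rule summable_comparison_test)
  show "summable (\<lambda>j. real j powr r * (\<mu>h ^ j / fact j) / phi S \<mu>h)"
    by (intro summable_divide summable_moment assms \<mu>h_nonneg)
  show "\<exists>N. \<forall>j\<ge>N. norm (real j powr r * \<rho> j) \<le> real j powr r * (\<mu>h ^ j / fact j) / phi S \<mu>h"
    using \<mu>h_nonneg phi_\<mu>h_pos by (auto simp: \<rho>_eq)
qed

lemma moment_\<rho>_sums:
  assumes "r > 0"
  shows "(\<lambda>j. real j powr r * \<rho> j) sums cond_expectation (Po \<mu>h) S (\<lambda>j. real j powr r)"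
proof -
  let ?P = "measure_pmf.prob (Po \<mu>h) S"
  have Po: "pmf (Po \<mu>h) j = \<mu>h ^ j / fact j * exp (- \<mu>h)" for j
    using \<mu>h_nonneg by (cases "\<mu>h = 0"; cases j) (simp_all add: Po_def)
  have ne: "set_pmf (Po \<mu>h) \<inter> S \<noteq> {}"
    using \<mu>h_nonneg \<mu>h_0 S_nonempty by (auto simp: Po_def)
  have \<rho>: "\<rho> j = (if j \<in> S then pmf (Po \<mu>h) j / ?P else 0)" for j
    unfolding PoS_def by (rule pmf_cond[OF ne])
  have "integrable (measure_pmf (Po \<mu>h)) (\<lambda>j. real j powr r * indicator S j)"
    unfolding integrable_pmf_nat_iff
  proof (rule summable_comparison_test)
    show "summable (\<lambda>j. real j powr r * (\<mu>h ^ j / fact j) * exp (- \<mu>h))"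
      by (intro summable_mult2 summable_moment assms \<mu>h_nonneg)
    show "\<exists>N. \<forall>j\<ge>N. norm (norm (pmf (Po \<mu>h) j * (real j powr r * indicator S j))) \<le>
        real j powr r * (\<mu>h ^ j / fact j) * exp (- \<mu>h)"
      using \<mu>h_nonneg by (intro exI[of _ 0]) (auto simp: Po indicator_def mult_ac)
  qed
  hence "(\<lambda>j. pmf (Po \<mu>h) j * (real j powr r * indicator S j) / ?P) sums cond_expectation (Po \<mu>h) S (\<lambda>j. real j powr r)"
    unfolding cond_expectation_def by (intro sums_divide expectation_pmf_nat_sums)
  moreover have "pmf (Po \<mu>h) j * (real j powr r * indicator S j) / ?P = real j powr r * \<rho> j" for j
    by (simp add: \<rho> indicator_def)
  ultimately show ?thesis by simp
qed

lemma cond_expectation_id: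
  "cond_expectation (Po \<mu>h) S real = \<mu>h * deriv (phi S) \<mu>h / phi S \<mu>h"
proof -
  have "(\<lambda>j. real j powr 1 * \<rho> j) sums cond_expectation (Po \<mu>h) S (\<lambda>j. real j powr 1)"
    by (rule moment_\<rho>_sums) simp
  hence "(\<lambda>j. real j * \<rho> j) sums cond_expectation (Po \<mu>h) S real" by simp
  moreover have "(\<lambda>j. real j * (phi_coeff S j * \<mu>h ^ j) / phi S \<mu>h) sums (\<mu>h * deriv (phi S) \<mu>h / phi S \<mu>h)"
    by (intro sums_divide deriv_phi_sums)
  moreover have "real j * (phi_coeff S j * \<mu>h ^ j) / phi S \<mu>h = real j * \<rho> j" for j
    by (simp add: \<rho>_eq phi_coeff_def)
  ultimately show ?thesis using sums_unique2 by force
qed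

text \<open>The conditioned law is carried by S-graphs, so inclusions of events may use facts about
  graphs such as the handshake identity.\<close>

lemma prob_mono_on_S_graphs:
  assumes lim: "(lams \<longlongrightarrow> lam) F"
  shows "\<forall>\<^sub>F n in F. n > 0 \<and> (\<forall>X Y. X \<inter> S_graphs S n \<subseteq> Y \<longrightarrow> pr lams n X \<le> pr lams n Y)"
proof -
  have "\<forall>\<^sub>F n in F. n > 0" by (intro eventually_S_sequentially eventually_gt_at_top)
  thus ?thesis using eventually_odds(2)[OF lim] eventually_S_graphs_nonempty[of S]
  proof eventually_elim
    case (elim n)
    let ?p = "lams n / real n"
    have q: "?p / (1 - ?p) \<ge> 0" using elim unfolding odds_def by linarith
    have w: "graph_weight (?p / (1 - ?p)) A \<ge> 0" for A
      unfolding graph_weight_def by (intro sum_nonneg zero_le_power q)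
    have "pr lams n X \<le> pr lams n Y" if "X \<inter> S_graphs S n \<subseteq> Y" for X Y
    proof -
      have "graph_weight (?p / (1 - ?p)) (X \<inter> S_graphs S n) \<le> graph_weight (?p / (1 - ?p)) (Y \<inter> S_graphs S n)"
        unfolding graph_weight_def using that by (intro sum_mono2 zero_le_power q) auto
      moreover have "pr lams n A = graph_weight (?p / (1 - ?p)) (A \<inter> S_graphs S n) / graph_weight (?p / (1 - ?p)) (S_graphs S n)" for A
        using elim by (intro prob_gnpS) auto
      ultimately show ?thesis using w by (simp add: divide_right_mono)
    qed
    thus ?case using elim by auto
  qed
qed

text \<open>Chernoff's lower-tail bound for the number of vertices of degree j, with tilt exp(-s) at
  j only. By \<open>close\<close> the mean fraction at \<mu> is at least a - \<epsilon> / 4, so a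
  fraction a - \<epsilon> is a real deficit even though \<mu> may differ from
  \<open>\<mu>h\<close>.\<close>

lemma deficit_deg_poly_le:
  assumes j: "j \<in> S" and e: "\<epsilon> > 0" and \<mu>: "\<mu> \<ge> 0" "phi S \<mu> > 0"
    and close: "\<mu> ^ j / fact j / phi S \<mu> \<ge> a - \<epsilon> / 4"
  shows "deg_poly n (degs n {G. real (n_deg n G j) / real n \<le> a - \<epsilon>}) \<mu> \<le> exp (- (\<epsilon>\<^sup>2 / 8) * real n) * phi S \<mu> ^ n"
proof -
  \<comment> \<open>The exponent per vertex will be at most s^2 - (3/4) \<epsilon> s; this s turns
    it into -\<epsilon>^2 / 8.\<close>
  define s where "s = \<epsilon> / 4"
  \<comment> \<open>Degrees are below n but j need not be; inserting it keeps the term that is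
    tilted in the sum.\<close>
  define T where "T = insert j (S \<inter> {..<n})"
  define x where "x = \<mu> ^ j / fact j / phi S \<mu>"
  define X where "X = {G. real (n_deg n G j) / real n \<le> a - \<epsilon>}"
  define g where "g = (\<lambda>k. if k = j then exp (- s) else 1 :: real)"
  have s: "s > 0" using e by (simp add: s_def)
  have fT: "finite T" and jT: "j \<in> T" and TS: "T \<subseteq> S" using j by (auto simp: T_def)
  have D: "degs n X \<subseteq> {..<n} \<rightarrow>\<^sub>E T"
    using degs_subset[of n X] unfolding T_def by (auto simp: PiE_def)
  have "deg_poly n (degs n X) \<mu> \<le> exp (s * (a - \<epsilon>) * real n) * (\<Sum>k\<in>T. g k * (\<mu> ^ k / fact k)) ^ n"
  proof (rule deg_poly_tilt[OF fT D \<mu>(1)])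
    fix d assume "d \<in> degs n X"
    then obtain G where G: "G \<in> X" "d = deg_fun n G" by (auto simp: degs_def)
    have "(\<Prod>v<n. g (d v)) = (\<Prod>v<n. if vdegree G v = j then exp (- s) else 1)"
      unfolding G(2) g_def by (intro prod.cong) (auto simp: deg_fun_def)
    also have "\<dots> = exp (- s) ^ n_deg n G j"
      by (simp add: prod.If_cases n_deg_def Int_def)
    also have "\<dots> = exp (- s * real (n_deg n G j))" by (simp add: exp_of_nat_mult[symmetric] mult.commute)
    finally have P: "(\<Prod>v<n. g (d v)) = exp (- s * real (n_deg n G j))" .
    have "real (n_deg n G j) \<le> (a - \<epsilon>) * real n"
    proof (cases "n = 0")
      case True
      thus ?thesis by (simp add: n_deg_def)
    next
      case False
      thus ?thesis using G(1) by (simp add: X_def pos_divide_le_eq)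
    qed
    hence "0 \<le> s * ((a - \<epsilon>) * real n - real (n_deg n G j))" using s by (intro mult_nonneg_nonneg) auto
    thus "1 \<le> exp (s * (a - \<epsilon>) * real n) * (\<Prod>v<n. g (d v))"
      unfolding P exp_add[symmetric] by (simp add: algebra_simps)
  qed (auto simp: g_def)
  also have "\<dots> \<le> exp (s * (a - \<epsilon>) * real n) * (phi S \<mu> * exp (- (s - s\<^sup>2) * x)) ^ n"
  proof (intro mult_left_mono power_mono)
    show "0 \<le> (\<Sum>k\<in>T. g k * (\<mu> ^ k / fact k))" using \<mu> by (intro sum_nonneg) (auto simp: g_def)
    have "(\<Sum>k\<in>T. g k * (\<mu> ^ k / fact k)) = (\<Sum>k\<in>T. \<mu> ^ k / fact k - (if k = j then (1 - exp (- s)) * (\<mu> ^ j / fact j) else 0))"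
      by (intro sum.cong) (auto simp: g_def left_diff_distrib diff_divide_distrib)
    also have "\<dots> = phi T \<mu> - (1 - exp (- s)) * (\<mu> ^ j / fact j)"
      using fT jT by (simp add: sum_subtractf phi_finite)
    also have "\<dots> \<le> phi S \<mu> - (s - s\<^sup>2) * (\<mu> ^ j / fact j)"
      using phi_mono[OF TS \<mu>(1)] mult_right_mono[OF one_minus_exp_ge[of s], of "\<mu> ^ j / fact j"] s \<mu> by simp
    also have "\<dots> = phi S \<mu> * (1 + - (s - s\<^sup>2) * x)"
      using \<mu> by (simp add: x_def field_simps)
    also have "\<dots> \<le> phi S \<mu> * exp (- (s - s\<^sup>2) * x)"
      using \<mu> by (intro mult_left_mono exp_ge_add_one_self) auto
    finally show "(\<Sum>k\<in>T. g k * (\<mu> ^ k / fact k)) \<le> phi S \<mu> * exp (- (s - s\<^sup>2) * x)" .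
  qed simp
  also have "\<dots> = exp (s * (a - \<epsilon>) * real n + real n * (- (s - s\<^sup>2) * x)) * phi S \<mu> ^ n"
    by (simp add: power_mult_distrib exp_add exp_of_nat_mult[symmetric])
  also have "\<dots> \<le> exp (- (\<epsilon>\<^sup>2 / 8) * real n) * phi S \<mu> ^ n"
  proof (intro mult_right_mono)
    have "x \<le> phi S \<mu> / phi S \<mu>"
      unfolding x_def using \<mu> by (intro divide_right_mono phi_term_le j) auto
    hence x: "0 \<le> x" "x \<le> 1" "x \<ge> a - \<epsilon> / 4"
      using \<mu> close by (simp_all add: x_def)
    have "s * (a - \<epsilon>) + (- (s - s\<^sup>2) * x) = s * (a - x) - s * \<epsilon> + s\<^sup>2 * x" by (simp add: algebra_simps)
    also have "\<dots> \<le> s * (\<epsilon> / 4) - s * \<epsilon> + s\<^sup>2 * 1"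
      using x s by (intro add_mono diff_mono mult_left_mono) auto
    also have "\<dots> = - (\<epsilon>\<^sup>2 / 8)" by (simp add: s_def power2_eq_square field_simps)
    finally have "(s * (a - \<epsilon>) + (- (s - s\<^sup>2) * x)) * real n \<le> - (\<epsilon>\<^sup>2 / 8) * real n"
      by (rule mult_right_mono) simp
    thus "exp (s * (a - \<epsilon>) * real n + real n * (- (s - s\<^sup>2) * x)) \<le> exp (- (\<epsilon>\<^sup>2 / 8) * real n)"
      by (simp add: algebra_simps)
  qed (use \<mu> in simp)
  finally show ?thesis by (simp add: X_def)
qed

text \<open>K cuts off the tail of the limit law, so a distance \<epsilon> forces a deficit e at one
  of finitely many values (\<open>dTV_deficit\<close>). For \<mu> close to \<open>\<mu>h\<close>
  these probabilities drop by less than e / 4, so the Chernoff bound is uniform; a union bound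
  finishes.\<close>

lemma dTV_large_deviation:
  assumes \<epsilon>: "\<epsilon> > 0"
  shows "\<exists>c>0. \<forall>lams. (lams \<longlongrightarrow> lam) F \<longrightarrow>
    (\<forall>\<^sub>F n in F. pr lams n {G. dTV (deg_dist n G) (PoS S \<mu>h) \<ge> \<epsilon>} \<le> exp (- c * real n))"
proof -
  have "(\<lambda>k. \<Sum>j. \<rho> (j + k)) \<longlonglongrightarrow> 0"
    using pmf_nat_sums_1[of "PoS S \<mu>h"] sums_summable by (intro suminf_exist_split2) blast
  hence "\<forall>\<^sub>F k in sequentially. (\<Sum>j. \<rho> (j + k)) < \<epsilon> / 2"
    by (rule order_tendstoD) (use \<epsilon> in simp)
  moreover have "\<forall>\<^sub>F k in sequentially. k > (0::nat)" by (rule eventually_gt_at_top)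
  ultimately have "\<forall>\<^sub>F k in sequentially. (\<Sum>j. \<rho> (j + k)) < \<epsilon> / 2 \<and> k > 0" by (rule eventually_conj)
  then obtain K where K: "(\<Sum>j. \<rho> (j + K)) < \<epsilon> / 2" "K > 0"
    using eventually_happens'[OF sequentially_bot] by blast
  define e where "e = \<epsilon> / (2 * real K)"
  have e: "e > 0" using \<epsilon> K by (simp add: e_def)
  obtain \<delta>1 m where \<delta>1: "\<delta>1 > 0" "\<delta>1 \<le> 1" "m > 0" "\<And>\<mu>. \<bar>\<mu> - \<mu>h\<bar> \<le> \<delta>1 \<Longrightarrow> phi S \<mu> \<ge> m"
    using phi_near_pos by blast
  obtain \<delta>0 where \<delta>0: "\<delta>0 > 0" "\<And>\<delta>. 0 < \<delta> \<Longrightarrow> \<delta> \<le> \<delta>0 \<Longrightarrow> \<exists>c>0. tilting_bound \<delta> c"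
    using prob_bound by blast
  have "\<forall>\<^sub>F \<mu> in nhds \<mu>h. \<forall>j\<in>S \<inter> {..<K}. \<mu> ^ j / fact j / phi S \<mu> > \<rho> j - e / 4"
  proof (rule eventually_ball_finite, simp, rule ballI)
    fix j assume j: "j \<in> S \<inter> {..<K}"
    have "((\<lambda>\<mu>. \<mu> ^ j / fact j / phi S \<mu>) \<longlongrightarrow> \<mu>h ^ j / fact j / phi S \<mu>h) (nhds \<mu>h)"
      using phi_\<mu>h_pos by (intro tendsto_intros filterlim_ident) auto
    moreover have "\<mu>h ^ j / fact j / phi S \<mu>h > \<rho> j - e / 4" using j e by (simp add: \<rho>_eq)
    ultimately show "\<forall>\<^sub>F \<mu> in nhds \<mu>h. \<mu> ^ j / fact j / phi S \<mu> > \<rho> j - e / 4"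
      by (rule order_tendstoD)
  qed
  then obtain \<delta>2 where \<delta>2: "\<delta>2 > 0"
    "\<And>\<mu> j. dist \<mu> \<mu>h < \<delta>2 \<Longrightarrow> j \<in> S \<Longrightarrow> j < K \<Longrightarrow> \<mu> ^ j / fact j / phi S \<mu> > \<rho> j - e / 4"
    unfolding eventually_nhds_metric by blast
  define \<delta> where "\<delta> = min \<delta>0 (min \<delta>1 (\<delta>2 / 2))"
  have \<delta>: "0 < \<delta>" "\<delta> \<le> \<delta>0" using \<delta>0 \<delta>1 \<delta>2 by (auto simp: \<delta>_def)
  obtain c where c: "c > 0" "\<And>lams. (lams \<longlongrightarrow> lam) F \<Longrightarrow> \<forall>\<^sub>F n in F. \<forall>X b. b \<ge> 0 \<longrightarrow>
       (\<forall>\<mu>\<ge>0. \<bar>\<mu> - \<mu>h\<bar> \<le> \<delta> \<longrightarrow> deg_poly n (degs n X) \<mu> \<le> b * phi S \<mu> ^ n) \<longrightarrow>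
       pr lams n X \<le> exp (ln (real n) ^ 6) * (b + exp (- c * real n))"
    using \<delta>0(2)[OF \<delta>] unfolding tilting_bound_def by blast
  \<comment> \<open>Half of the smaller rate is given up to absorb the number K of events and
    exp((ln n)^6).\<close>
  define c' where "c' = min (e\<^sup>2 / 8) c / 2"
  have c': "c' > 0" using e c by (simp add: c'_def)
  show ?thesis
  proof (intro exI[of _ c'] conjI c' allI impI)
    fix lams :: "nat \<Rightarrow> real" assume lim: "(lams \<longlongrightarrow> lam) F"
    define KK where "KK = real K"
    have "\<forall>\<^sub>F x::real in at_top. KK * (exp (ln x ^ 6) * (2 * exp (- (2 * c') * x))) \<le> exp (- c' * x)"
      using c' by real_asymp
    from c(2)[OF lim] prob_mono_on_S_graphs[OF lim] eventually_real_S_sequentially[OF this]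
    show "\<forall>\<^sub>F n in F. pr lams n {G. dTV (deg_dist n G) (PoS S \<mu>h) \<ge> \<epsilon>} \<le> exp (- c' * real n)"
    proof eventually_elim
      case (elim n)
      let ?X = "\<lambda>j. {G. real (n_deg n G j) / real n \<le> \<rho> j - e}"
      have sub: "{G. dTV (deg_dist n G) (PoS S \<mu>h) \<ge> \<epsilon>} \<subseteq> (\<Union>j\<in>S \<inter> {..<K}. ?X j)"
      proof
        fix G assume "G \<in> {G. dTV (deg_dist n G) (PoS S \<mu>h) \<ge> \<epsilon>}"
        then obtain j where j: "j < K" "pmf (deg_dist n G) j \<le> \<rho> j - e"
          using dTV_deficit[OF \<epsilon> K(2), of "PoS S \<mu>h" "deg_dist n G"] K(1) by (auto simp: e_def)
        moreover have "j \<in> S"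
        proof (rule ccontr)
          assume "j \<notin> S"
          hence "pmf (deg_dist n G) j \<le> - e" using j by (simp add: \<rho>_eq)
          thus False using pmf_nonneg[of "deg_dist n G" j] e by linarith
        qed
        ultimately show "G \<in> (\<Union>j\<in>S \<inter> {..<K}. ?X j)" using elim by (auto simp: pmf_deg_dist)
      qed
      have X: "pr lams n (?X j) \<le> exp (ln (real n) ^ 6) * (2 * exp (- (2 * c') * real n))"
        if "j \<in> S \<inter> {..<K}" for j
      proof -
        have "pr lams n (?X j) \<le> exp (ln (real n) ^ 6) * (exp (- (e\<^sup>2 / 8) * real n) + exp (- c * real n))"
        proof (rule elim(1)[rule_format])
          fix \<mu> assume \<mu>: "\<mu> \<ge> 0" "\<bar>\<mu> - \<mu>h\<bar> \<le> \<delta>"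
          have "phi S \<mu> \<ge> m" using \<mu> by (intro \<delta>1) (auto simp: \<delta>_def)
          moreover have "\<mu> ^ j / fact j / phi S \<mu> > \<rho> j - e / 4"
            by (rule \<delta>2(2)) (use \<mu> that \<delta>2(1) in \<open>auto simp: dist_real_def \<delta>_def\<close>)
          ultimately show "deg_poly n (degs n (?X j)) \<mu> \<le> exp (- (e\<^sup>2 / 8) * real n) * phi S \<mu> ^ n"
            using that \<mu> e \<delta>1(3) by (intro deficit_deg_poly_le) auto
        qed simp
        also have "\<dots> \<le> exp (ln (real n) ^ 6) * (exp (- (2 * c') * real n) + exp (- (2 * c') * real n))"
        proof -
          have le: "2 * c' \<le> e\<^sup>2 / 8" "2 * c' \<le> c" by (simp_all add: c'_def)
          have "exp (- a * real n) \<le> exp (- (2 * c') * real n)" if "2 * c' \<le> a" for a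
            unfolding exp_le_cancel_iff by (rule mult_right_mono) (use that in auto)
          from this[OF le(1)] this[OF le(2)] show ?thesis by (intro mult_left_mono add_mono) auto
        qed
        finally show ?thesis by simp
      qed
      have "pr lams n {G. dTV (deg_dist n G) (PoS S \<mu>h) \<ge> \<epsilon>} \<le> pr lams n (\<Union>j\<in>S \<inter> {..<K}. ?X j)"
        using sub by (intro measure_pmf.finite_measure_mono) auto
      also have "\<dots> \<le> (\<Sum>j\<in>S \<inter> {..<K}. pr lams n (?X j))"
        by (intro measure_pmf.finite_measure_subadditive_finite) auto
      also have "\<dots> \<le> (\<Sum>j\<in>S \<inter> {..<K}. exp (ln (real n) ^ 6) * (2 * exp (- (2 * c') * real n)))"
        by (intro sum_mono X)
      also have "\<dots> \<le> (\<Sum>j<K. exp (ln (real n) ^ 6) * (2 * exp (- (2 * c') * real n)))"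
        by (intro sum_mono2) auto
      also have "\<dots> \<le> exp (- c' * real n)" using elim by (simp add: KK_def)
      finally show ?case .
    qed
  qed
qed

section \<open>Moments\<close>

text \<open>
  The tilt is \<open>exp (\<theta> * k ^ R)\<close> for \<open>k \<le> D\<close> and \<open>exp k\<close> beyond, with \<open>\<theta> = D / (n * K)\<close>: then
  \<open>\<theta> * k ^ R \<le> 1\<close> for \<open>k \<le> D\<close>, so the tilt costs at most \<open>exp (1 + D / 2)\<close>, while both a degree above
  \<open>D\<close> and a large moment gain \<open>exp D\<close>.
\<close>

lemma moment_deg_poly_le:
  fixes D \<theta> K M1 M2 :: real
  assumes \<mu>: "0 \<le> \<mu>" "\<mu> \<le> \<mu>h + 1" "m \<le> phi S \<mu>" "m > 0"
    and M: "M1 = fact R * exp (exp 1 * (\<mu>h + 1))" "M2 = exp (exp 2 * (\<mu>h + 1))"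
    and K: "K \<ge> 1" "K \<ge> 4 * M1 / m" and n: "n > 0" and D: "D \<ge> 0" "D ^ Suc R \<le> real n"
    and small: "real n * exp (- D) * M2 / m \<le> 1"
  shows "deg_poly n (degs n {G. K * real n \<le> (\<Sum>i<n. real (vdegree G i) ^ R)}) \<mu> \<le> exp (1 - D / 2) * phi S \<mu> ^ n"
proof -
  define \<theta> where "\<theta> = D / (real n * K)"
  define T where "T = S \<inter> {..<n}"
  define X where "X = {G. K * real n \<le> (\<Sum>i<n. real (vdegree G i) ^ R)}"
  define g where "g = (\<lambda>k. if real k \<le> D then exp (\<theta> * real k ^ R) else exp (real k))"
  let ?w = "(2 * \<theta> * M1 + exp (- D) * M2) / m"
  have \<theta>: "\<theta> \<ge> 0" using D K n by (simp add: \<theta>_def)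
  have fT: "finite T" and TS: "T \<subseteq> S" by (auto simp: T_def)
  have M1: "M1 > 0" by (simp add: M)
  have g1: "g k \<ge> 1" for k using \<theta> by (auto simp: g_def)
  have "deg_poly n (degs n X) \<mu> \<le> exp (- D) * (\<Sum>k\<in>T. g k * (\<mu> ^ k / fact k)) ^ n"
  proof (rule deg_poly_tilt[OF fT _ \<mu>(1)])
    show "degs n X \<subseteq> {..<n} \<rightarrow>\<^sub>E T" unfolding T_def by (rule degs_subset)
    show "g k \<ge> 0" for k using g1[of k] by linarith
    fix d assume "d \<in> degs n X"
    then obtain G where G: "G \<in> X" "d = deg_fun n G" by (auto simp: degs_def)
    have d: "d v = vdegree G v" if "v < n" for v using that G by (simp add: deg_fun_def)
    have "exp D \<le> (\<Prod>v<n. g (d v))"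
    proof (cases "\<exists>v<n. real (d v) > D")
      case True
      then obtain v where v: "v < n" "real (d v) > D" by blast
      have "exp D \<le> g (d v)" using v by (simp add: g_def)
      also have "\<dots> = (\<Prod>w\<in>{v}. g (d w))" by simp
      also have "\<dots> \<le> (\<Prod>w<n. g (d w))"
        using v g1 by (intro prod_mono2) (auto intro: order_trans[OF zero_le_one])
      finally show ?thesis .
    next
      case False
      have "(\<Prod>v<n. g (d v)) = (\<Prod>v<n. exp (\<theta> * real (d v) ^ R))"
        using False by (intro prod.cong) (auto simp: g_def)
      also have "\<dots> = exp (\<theta> * (\<Sum>v<n. real (vdegree G v) ^ R))"
        using d by (simp add: exp_sum sum_distrib_left)
      finally have P: "(\<Prod>v<n. g (d v)) = exp (\<theta> * (\<Sum>v<n. real (vdegree G v) ^ R))" .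
      have "D = \<theta> * (K * real n)" using K n by (simp add: \<theta>_def)
      also have "\<dots> \<le> \<theta> * (\<Sum>v<n. real (vdegree G v) ^ R)"
        using G(1) \<theta> by (intro mult_left_mono) (auto simp: X_def)
      finally show ?thesis unfolding P by simp
    qed
    hence "exp (- D) * exp D \<le> exp (- D) * (\<Prod>v<n. g (d v))" by (intro mult_left_mono) auto
    thus "1 \<le> exp (- D) * (\<Prod>v<n. g (d v))" by (simp flip: exp_add)
  qed simp
  also have "\<dots> \<le> exp (- D) * (phi S \<mu> * exp ?w) ^ n"
  proof (intro mult_left_mono power_mono)
    show "0 \<le> (\<Sum>k\<in>T. g k * (\<mu> ^ k / fact k))"
      using \<mu> g1 by (intro sum_nonneg mult_nonneg_nonneg) (auto intro: order_trans[OF zero_le_one])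
    \<comment> \<open>For k \<le> D the exponential is linearised on [0, 1] and k^R bounded by R! *
      e^k; for k > D, e^k is at most e^(-D) * e^(2k). Both corrections become exponential series, at
      e * \<mu> and e^2 * \<mu>, hence \<open>M1\<close> and \<open>M2\<close>.\<close>
    have "(\<Sum>k\<in>T. g k * (\<mu> ^ k / fact k)) \<le>
        (\<Sum>k\<in>T. \<mu> ^ k / fact k + (2 * \<theta> * fact R) * ((exp 1 * \<mu>) ^ k / fact k) + exp (- D) * ((exp 2 * \<mu>) ^ k / fact k))"
    proof (rule sum_mono)
      fix k assume "k \<in> T"
      have e2: "exp 2 ^ k = exp (2 * real k)" by (simp flip: exp_of_nat_mult add: mult.commute)
      have e1: "exp 1 ^ k = exp (real k)" by (simp flip: exp_of_nat_mult)
      have "g k \<le> 1 + 2 * \<theta> * (fact R * exp (real k)) + exp (- D) * exp (2 * real k)"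
      proof (cases "real k \<le> D")
        case True
        have "real k ^ R * D \<le> D ^ R * D" using True D by (intro mult_right_mono power_mono) auto
        also have "\<dots> \<le> real n" using D by (simp add: mult.commute)
        also have "\<dots> \<le> real n * K" using K mult_left_mono[of 1 K "real n"] by simp
        finally have "\<theta> * real k ^ R \<le> 1"
          using n K by (simp add: \<theta>_def divide_le_eq mult.commute)
        hence "g k \<le> 1 + 2 * (\<theta> * real k ^ R)"
          using True \<theta> exp_le_linear[of "\<theta> * real k ^ R"] by (simp add: g_def)
        also have "\<theta> * real k ^ R \<le> \<theta> * (fact R * exp (real k))"
          using \<theta> by (intro mult_left_mono pow_le_fact_exp) auto
        finally show ?thesis by (simp add: add_increasing2)
      next
        case False
        hence "g k = exp (real k)" by (simp add: g_def)
        also have "\<dots> \<le> exp (- D) * exp (2 * real k)" using False by (simp flip: exp_add)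
        finally show ?thesis using \<theta> by (simp add: add_increasing)
      qed
      hence "g k * (\<mu> ^ k / fact k) \<le> (1 + 2 * \<theta> * (fact R * exp (real k)) + exp (- D) * exp (2 * real k)) * (\<mu> ^ k / fact k)"
        using \<mu> by (intro mult_right_mono) auto
      thus "g k * (\<mu> ^ k / fact k) \<le> \<mu> ^ k / fact k + (2 * \<theta> * fact R) * ((exp 1 * \<mu>) ^ k / fact k) +
          exp (- D) * ((exp 2 * \<mu>) ^ k / fact k)"
        unfolding power_mult_distrib e1 e2 by (simp add: algebra_simps)
    qed
    also have "\<dots> = phi T \<mu> + 2 * \<theta> * (fact R * phi T (exp 1 * \<mu>)) + exp (- D) * phi T (exp 2 * \<mu>)"
      using fT by (simp add: phi_finite sum.distrib sum_distrib_left mult_ac)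
    also have "\<dots> \<le> phi S \<mu> + 2 * \<theta> * M1 + exp (- D) * M2"
      unfolding M using \<theta> \<mu> TS
      by (intro add_mono mult_left_mono order_trans[OF phi_le_exp] phi_mono) auto
    also have "\<dots> = phi S \<mu> * 1 + m * ?w" using \<mu> by simp
    also have "\<dots> \<le> phi S \<mu> * 1 + phi S \<mu> * ?w"
      using \<mu> \<theta> M1 by (intro add_left_mono mult_right_mono) (auto simp: M)
    also have "\<dots> = phi S \<mu> * (1 + ?w)" by (simp only: distrib_left)
    also have "\<dots> \<le> phi S \<mu> * exp ?w"
      using \<mu> by (intro mult_left_mono exp_ge_add_one_self) auto
    finally show "(\<Sum>k\<in>T. g k * (\<mu> ^ k / fact k)) \<le> phi S \<mu> * exp ?w" .
  qed simp
  also have "\<dots> = exp (- D + real n * ?w) * phi S \<mu> ^ n"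
    unfolding exp_add power_mult_distrib exp_of_nat_mult by (simp only: mult_ac)
  also have "\<dots> \<le> exp (1 - D / 2) * phi S \<mu> ^ n"
  proof (rule mult_right_mono)
    \<comment> \<open>The choice K \<ge> 4 * M1 / m limits the first term to D / 2, half of the
      gain; the second is at most 1 by \<open>small\<close>.\<close>
    have "real n * ?w = D / 2 * (4 * M1 / m / K) + real n * exp (- D) * M2 / m"
      using n K \<mu> by (simp add: \<theta>_def field_simps)
    also have "D / 2 * (4 * M1 / m / K) \<le> D / 2 * 1"
    proof (rule mult_left_mono)
      have "4 * M1 / m / K \<le> K / K" using K by (intro divide_right_mono) auto
      thus "4 * M1 / m / K \<le> 1" using K by simp
    qed (use D in simp)
    also note small
    finally show "exp (- D + real n * ?w) \<le> exp (1 - D / 2)" by simp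
  qed (use \<mu> in simp)
  finally show ?thesis by (simp add: X_def)
qed

text \<open>The tilt requires D^(R + 1) \<le> n, so D = n^\<alpha> with \<alpha> = 1 / (R + 1). The
  resulting decay exp(- n^\<alpha> / 2) is only stretched exponential but still beats exp((ln
  n)^6).\<close>

lemma moment_bounded_in_prob:
  obtains C where "C > 0" "\<And>lams. (lams \<longlongrightarrow> lam) F \<Longrightarrow>
    ((\<lambda>n. pr lams n {G. C * real n \<le> (\<Sum>i<n. real (vdegree G i) ^ R)}) \<longlongrightarrow> 0) F"
proof -
  obtain \<delta>1 m where \<delta>1: "\<delta>1 > 0" "\<delta>1 \<le> 1" "m > 0" "\<And>\<mu>. \<bar>\<mu> - \<mu>h\<bar> \<le> \<delta>1 \<Longrightarrow> phi S \<mu> \<ge> m"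
    using phi_near_pos by blast
  obtain \<delta>0 where \<delta>0: "\<delta>0 > 0" "\<And>\<delta>. 0 < \<delta> \<Longrightarrow> \<delta> \<le> \<delta>0 \<Longrightarrow> \<exists>c>0. tilting_bound \<delta> c"
    using prob_bound by blast
  define \<delta> where "\<delta> = min \<delta>0 \<delta>1"
  have \<delta>: "0 < \<delta>" "\<delta> \<le> \<delta>0" using \<delta>0 \<delta>1 by (auto simp: \<delta>_def)
  obtain c where c: "c > 0" "\<And>lams. (lams \<longlongrightarrow> lam) F \<Longrightarrow> \<forall>\<^sub>F n in F. \<forall>X b. b \<ge> 0 \<longrightarrow>
       (\<forall>\<mu>\<ge>0. \<bar>\<mu> - \<mu>h\<bar> \<le> \<delta> \<longrightarrow> deg_poly n (degs n X) \<mu> \<le> b * phi S \<mu> ^ n) \<longrightarrow>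
       pr lams n X \<le> exp (ln (real n) ^ 6) * (b + exp (- c * real n))"
    using \<delta>0(2)[OF \<delta>] unfolding tilting_bound_def by blast
  define M1 M2 where "M1 = fact R * exp (exp 1 * (\<mu>h + 1))" and "M2 = exp (exp 2 * (\<mu>h + 1))"
  define K where "K = max 1 (4 * M1 / m)"
  define \<alpha> where "\<alpha> = 1 / real (Suc R)"
  have \<alpha>: "\<alpha> > 0" by (simp add: \<alpha>_def)
  define A where "A = M2 / m"
  have A: "A > 0" using \<delta>1 by (simp add: A_def M2_def)
  show ?thesis
  proof (rule that[of K])
    fix lams :: "nat \<Rightarrow> real" assume lim: "(lams \<longlongrightarrow> lam) F"
    have "((\<lambda>x::real. exp (ln x ^ 6) * exp (1 - x powr \<alpha> / 2)) \<longlongrightarrow> 0) at_top"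
      using \<alpha> by real_asymp
    moreover have "((\<lambda>x::real. exp (ln x ^ 6) * exp (- c * x)) \<longlongrightarrow> 0) at_top"
      using c(1) by real_asymp
    ultimately have "((\<lambda>x::real. exp (ln x ^ 6) * exp (1 - x powr \<alpha> / 2) + exp (ln x ^ 6) * exp (- c * x)) \<longlongrightarrow> 0 + 0) at_top"
      by (rule tendsto_add)
    hence "((\<lambda>x::real. exp (ln x ^ 6) * (exp (1 - x powr \<alpha> / 2) + exp (- c * x))) \<longlongrightarrow> 0) at_top"
      by (simp add: distrib_left)
    hence b0: "((\<lambda>n. exp (ln (real n) ^ 6) * (exp (1 - real n powr \<alpha> / 2) + exp (- c * real n))) \<longlongrightarrow> 0) F"
      by (rule filterlim_real_S_sequentially)
    have "\<forall>\<^sub>F x::real in at_top. x * exp (- (x powr \<alpha>)) * A \<le> 1"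
      using \<alpha> A by real_asymp
    from eventually_real_S_sequentially[OF this] c(2)[OF lim] prob_mono_on_S_graphs[OF lim]
    have "\<forall>\<^sub>F n in F. pr lams n {G. K * real n \<le> (\<Sum>i<n. real (vdegree G i) ^ R)} \<le>
        exp (ln (real n) ^ 6) * (exp (1 - real n powr \<alpha> / 2) + exp (- c * real n))"
    proof eventually_elim
      case (elim n)
      show ?case
      proof (rule elim(2)[rule_format])
        fix \<mu> assume \<mu>: "\<mu> \<ge> 0" "\<bar>\<mu> - \<mu>h\<bar> \<le> \<delta>"
        show "deg_poly n (degs n {G. K * real n \<le> (\<Sum>i<n. real (vdegree G i) ^ R)}) \<mu> \<le>
            exp (1 - real n powr \<alpha> / 2) * phi S \<mu> ^ n"
        proof (rule moment_deg_poly_le[OF \<mu>(1) _ _ \<delta>1(3) M1_def M2_def])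
          show "\<mu> \<le> \<mu>h + 1" using \<mu> \<delta>1 unfolding \<delta>_def by linarith
          show "m \<le> phi S \<mu>" using \<mu> by (intro \<delta>1) (simp add: \<delta>_def)
          have "(real n powr \<alpha>) ^ Suc R = real n powr (\<alpha> * real (Suc R))"
            unfolding powr_powr[symmetric] by (rule powr_realpow[symmetric]) (use elim in simp)
          also have "\<dots> = real n" using elim by (simp add: \<alpha>_def)
          finally show "(real n powr \<alpha>) ^ Suc R \<le> real n" by simp
          show "real n * exp (- (real n powr \<alpha>)) * M2 / m \<le> 1" using elim by (simp add: A_def)
        qed (use elim in \<open>auto simp: K_def\<close>)
      qed simp
    qed
    thus "((\<lambda>n. pr lams n {G. K * real n \<le> (\<Sum>i<n. real (vdegree G i) ^ R)}) \<longlongrightarrow> 0) F"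
      by (intro tendsto_sandwich[OF _ _ tendsto_const b0]) auto
  qed (simp add: K_def)
qed

section \<open>Convergence in probability of distribution, moments and edge density\<close>

lemma conv_dTV:
  assumes lim: "(lams \<longlongrightarrow> lam) F" and \<epsilon>: "\<epsilon> > 0"
  shows "((\<lambda>n. pr lams n {G. dTV (deg_dist n G) (PoS S \<mu>h) \<ge> \<epsilon>}) \<longlongrightarrow> 0) F"
proof -
  obtain c where c: "c > 0"
    "\<forall>\<^sub>F n in F. pr lams n {G. dTV (deg_dist n G) (PoS S \<mu>h) \<ge> \<epsilon>} \<le> exp (- c * real n)"
    using dTV_large_deviation[OF \<epsilon>] lim by blast
  have "((\<lambda>x::real. exp (- c * x)) \<longlongrightarrow> 0) at_top" using c(1) by real_asymp
  hence L: "((\<lambda>n. exp (- c * real n)) \<longlongrightarrow> 0) F" by (rule filterlim_real_S_sequentially)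
  show ?thesis by (rule tendsto_sandwich[OF _ c(2) tendsto_const L]) simp
qed

lemma conv_in_prob_sandwich:
  assumes lim: "(lams \<longlongrightarrow> lam) F"
    and U: "((\<lambda>n. pr lams n (U n)) \<longlongrightarrow> 0) F" and V: "((\<lambda>n. pr lams n (V n)) \<longlongrightarrow> 0) F"
    and sub: "\<And>n. n > 0 \<Longrightarrow> X n \<inter> S_graphs S n \<subseteq> U n \<union> V n"
  shows "((\<lambda>n. pr lams n (X n)) \<longlongrightarrow> 0) F"
proof -
  have "\<forall>\<^sub>F n in F. pr lams n (X n) \<le> pr lams n (U n) + pr lams n (V n)"
    using prob_mono_on_S_graphs[OF lim]
  proof eventually_elim
    case (elim n)
    hence "pr lams n (X n) \<le> pr lams n (U n \<union> V n)" using sub[of n] by blast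
    also have "\<dots> \<le> pr lams n (U n) + pr lams n (V n)"
      by (rule measure_Un_le) auto
    finally show ?case .
  qed
  moreover have "((\<lambda>n. pr lams n (U n) + pr lams n (V n)) \<longlongrightarrow> 0) F" using tendsto_add[OF U V] by simp
  ultimately show ?thesis by (rule tendsto_sandwich[rotated 2, OF tendsto_const, rotated -1]) simp
qed

lemma n_deg_close:
  assumes "n > 0" shows "\<bar>real (n_deg n G j) / real n - \<rho> j\<bar> \<le> 2 * dTV (deg_dist n G) (PoS S \<mu>h)"
  using pmf_diff_le_dTV[of "deg_dist n G" j "PoS S \<mu>h"] assms by (simp add: pmf_deg_dist)

lemma conv_n_deg:
  assumes lim: "(lams \<longlongrightarrow> lam) F"
  shows "conv_in_prob dist F (\<lambda>n. gnpS n (lams n / real n) S) (\<lambda>n G. real (n_deg n G j) / real n) (\<rho> j)"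
  unfolding conv_in_prob_def
proof (intro allI impI)
  fix \<epsilon> :: real assume "\<epsilon> > 0"
  hence e: "\<epsilon> / 2 > 0" by simp
  show "((\<lambda>n. pr lams n {G. \<epsilon> \<le> dist (real (n_deg n G j) / real n) (\<rho> j)}) \<longlongrightarrow> 0) F"
  proof (rule conv_in_prob_sandwich[OF lim conv_dTV[OF lim e] conv_dTV[OF lim e]], rule subsetI)
    fix n G assume "n > 0" "G \<in> {G. \<epsilon> \<le> dist (real (n_deg n G j) / real n) (\<rho> j)} \<inter> S_graphs S n"
    thus "G \<in> {G. \<epsilon> / 2 \<le> dTV (deg_dist n G) (PoS S \<mu>h)} \<union> {G. \<epsilon> / 2 \<le> dTV (deg_dist n G) (PoS S \<mu>h)}"
      using n_deg_close[of n G j] by (auto simp: dist_real_def)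
  qed
qed

text \<open>
  Degrees above \<open>K\<close> are controlled by a higher moment, those up to \<open>K\<close> by the total variation distance.
\<close>

lemma conv_moment:
  assumes lim: "(lams \<longlongrightarrow> lam) F" and r: "r > 0"
  shows "conv_in_prob dist F (\<lambda>n. gnpS n (lams n / real n) S)
    (\<lambda>n G. \<Sum>i<n. real (vdegree G i) powr r / real n) (\<Sum>j. real j powr r * \<rho> j)"
  unfolding conv_in_prob_def
proof (intro allI impI)
  fix \<epsilon> :: real assume \<epsilon>: "\<epsilon> > 0"
  define R where "R = nat \<lceil>r\<rceil>"
  have R: "R \<ge> 1" "r \<le> real R" using r by (auto simp: R_def le_nat_iff)
  \<comment> \<open>The order R + 1 exceeds r by at least 1, so for degrees above K the r-th power
    gains a factor 1 / K and the tail is at most C / K.\<close>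
  obtain C where C: "C > 0" "\<And>lams. (lams \<longlongrightarrow> lam) F \<Longrightarrow>
    ((\<lambda>n. pr lams n {G. C * real n \<le> (\<Sum>i<n. real (vdegree G i) ^ Suc R)}) \<longlongrightarrow> 0) F"
    using moment_bounded_in_prob by blast
  let ?a = "\<lambda>j. real j powr r * \<rho> j"
  have suma: "summable ?a" by (rule summable_moment_\<rho>[OF r])
  have "(\<lambda>k. \<Sum>j. ?a (j + k)) \<longlonglongrightarrow> 0" using suma by (rule suminf_exist_split2)
  hence "\<forall>\<^sub>F k in sequentially. (\<Sum>j. ?a (j + k)) < \<epsilon> / 4" by (rule order_tendstoD) (use \<epsilon> in simp)
  then obtain K1 where K1: "\<And>k. k \<ge> K1 \<Longrightarrow> (\<Sum>j. ?a (j + k)) < \<epsilon> / 4"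
    unfolding eventually_sequentially by blast
  obtain K2 where K2: "real K2 > 4 * C / \<epsilon>" using reals_Archimedean2 by blast
  define K where "K = Suc (max K1 K2)"
  have "K1 \<le> Suc K" by (simp add: K_def)
  hence K: "(\<Sum>j. ?a (j + Suc K)) < \<epsilon> / 4" by (rule K1)
  have K0: "K > 0" by (simp add: K_def)
  have "4 * C / \<epsilon> < real K" using K2 by (simp add: K_def max_def split: if_splits)
  hence CK: "C / real K < \<epsilon> / 4" using \<epsilon> K0 by (simp add: field_simps)
  \<comment> \<open>By \<open>n_deg_close\<close> the term of j \<le> K errs by at most 2 * j^r
    times the distance, so the total error is at most B * e.\<close>
  define B where "B = (\<Sum>j\<le>K. real j powr r * 2)"
  have B: "B \<ge> 0" unfolding B_def by (intro sum_nonneg) auto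
  define e where "e = \<epsilon> / (4 * (B + 1))"
  have "B + 1 > 0" using B by simp
  hence "(B + 1) * e = \<epsilon> / 4" unfolding e_def by (simp add: divide_eq_eq)
  moreover have "e > 0" using \<epsilon> B by (simp add: e_def)
  ultimately have e: "e > 0" "B * e < \<epsilon> / 4 + \<epsilon> / 4" using \<epsilon> by (simp_all add: distrib_right)
  show "((\<lambda>n. pr lams n {G. \<epsilon> \<le> dist (\<Sum>i<n. real (vdegree G i) powr r / real n) (\<Sum>j. ?a j)}) \<longlongrightarrow> 0) F"
  proof (rule conv_in_prob_sandwich[OF lim conv_dTV[OF lim e(1)] C(2)[OF lim]], rule subsetI)
    fix n G assume n: "n > 0" and "G \<in> {G. \<epsilon> \<le> dist (\<Sum>i<n. real (vdegree G i) powr r / real n) (\<Sum>j. ?a j)} \<inter> S_graphs S n"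
    hence G: "\<epsilon> \<le> \<bar>(\<Sum>i<n. real (vdegree G i) powr r / real n) - (\<Sum>j. ?a j)\<bar>" by (simp add: dist_real_def)
    show "G \<in> {G. e \<le> dTV (deg_dist n G) (PoS S \<mu>h)} \<union> {G. C * real n \<le> (\<Sum>i<n. real (vdegree G i) ^ Suc R)}"
    proof (rule ccontr)
      assume "\<not> ?thesis"
      hence tv: "dTV (deg_dist n G) (PoS S \<mu>h) < e" and mom: "(\<Sum>i<n. real (vdegree G i) ^ Suc R) < C * real n" by auto
      let ?d = "vdegree G"
      let ?T = "(\<Sum>i\<in>{i. i < n \<and> vdegree G i > K}. real (vdegree G i) powr r)"
      have "(\<Sum>i<n. real (?d i) powr r) =
          (\<Sum>i\<in>{i. i < n \<and> ?d i \<le> K} \<union> {i. i < n \<and> ?d i > K}. real (?d i) powr r)"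
        by (intro sum.cong) auto
      also have "\<dots> = (\<Sum>i\<in>{i. i < n \<and> ?d i \<le> K}. real (?d i) powr r) + ?T"
        by (intro sum.union_disjoint) auto
      also have "(\<Sum>i\<in>{i. i < n \<and> ?d i \<le> K}. real (?d i) powr r) = (\<Sum>j\<le>K. real j powr r * real (n_deg n G j))"
        by (rule sum_degrees_group)
      finally have split: "(\<Sum>i<n. real (?d i) powr r / real n) =
          (\<Sum>j\<le>K. real j powr r * (real (n_deg n G j) / real n)) + ?T / real n"
        by (simp add: sum_divide_distrib[symmetric] add_divide_distrib)
      have "?T \<le> (\<Sum>i\<in>{i. i < n \<and> ?d i > K}. real (?d i) ^ Suc R / real K)"
      proof (rule sum_mono)
        fix i assume i: "i \<in> {i. i < n \<and> ?d i > K}"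
        have "real (?d i) powr r * real K \<le> real (?d i) ^ R * real (?d i)"
          using i by (intro mult_mono powr_le_power_nat r R) auto
        thus "real (?d i) powr r \<le> real (?d i) ^ Suc R / real K"
          using K0 by (simp add: pos_le_divide_eq mult.commute)
      qed
      also have "\<dots> \<le> (\<Sum>i<n. real (?d i) ^ Suc R / real K)" by (intro sum_mono2) auto
      also have "\<dots> = (\<Sum>i<n. real (?d i) ^ Suc R) / real K" by (simp add: sum_divide_distrib)
      also have "\<dots> \<le> C * real n / real K" using mom by (intro divide_right_mono) auto
      finally have "?T / real n \<le> (C * real n / real K) / real n"
        by (rule divide_right_mono) simp
      also have "\<dots> = C / real K" using n by simp
      finally have tail: "?T / real n < \<epsilon> / 4" using CK by linarith
      have tail0: "0 \<le> ?T / real n"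
        by (intro divide_nonneg_nonneg sum_nonneg) auto
      have "(\<Sum>j. ?a j) = (\<Sum>j. ?a (j + Suc K)) + (\<Sum>j<Suc K. ?a j)"
        by (rule suminf_split_initial_segment[OF suma])
      hence sa: "(\<Sum>j. ?a j) = (\<Sum>j. ?a (j + Suc K)) + (\<Sum>j\<le>K. ?a j)" by (simp only: lessThan_Suc_atMost)
      have sa0: "0 \<le> (\<Sum>j. ?a (j + Suc K))"
        by (intro suminf_nonneg summable_ignore_initial_segment[OF suma]) auto
      have "\<bar>(\<Sum>j\<le>K. real j powr r * (real (n_deg n G j) / real n)) - (\<Sum>j\<le>K. ?a j)\<bar> =
          \<bar>\<Sum>j\<le>K. real j powr r * (real (n_deg n G j) / real n - \<rho> j)\<bar>"
        by (simp add: sum_subtractf right_diff_distrib)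
      also have "\<dots> \<le> (\<Sum>j\<le>K. \<bar>real j powr r * (real (n_deg n G j) / real n - \<rho> j)\<bar>)" by (rule sum_abs)
      also have "\<dots> \<le> (\<Sum>j\<le>K. real j powr r * 2 * e)"
      proof (rule sum_mono)
        fix j
        have "\<bar>real (n_deg n G j) / real n - \<rho> j\<bar> \<le> 2 * e" using n_deg_close[OF n, of G j] tv by linarith
        thus "\<bar>real j powr r * (real (n_deg n G j) / real n - \<rho> j)\<bar> \<le> real j powr r * 2 * e"
          by (simp add: abs_mult mult.assoc mult_left_mono)
      qed
      also have "\<dots> = B * e" by (simp add: B_def sum_distrib_right)
      finally have "\<bar>(\<Sum>j\<le>K. real j powr r * (real (n_deg n G j) / real n)) - (\<Sum>j\<le>K. ?a j)\<bar> < \<epsilon> / 4 + \<epsilon> / 4"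
        using e(2) by simp
      thus False using G split sa sa0 tail tail0 K \<epsilon> by linarith
    qed
  qed
qed

text \<open>By the handshake identity the edge density is half of the first moment, so the case r =
  1 with tolerance 2 \<epsilon> applies.\<close>

lemma conv_edges:
  assumes lim: "(lams \<longlongrightarrow> lam) F"
  shows "conv_in_prob dist F (\<lambda>n. gnpS n (lams n / real n) S)
    (\<lambda>n G. real (card G) / real n) (1/2 * cond_expectation (Po \<mu>h) S real)"
  unfolding conv_in_prob_def
proof (intro allI impI)
  fix \<epsilon> :: real assume "\<epsilon> > 0"
  hence e: "2 * \<epsilon> > 0" by simp
  let ?V = "\<lambda>n. {G. 2 * \<epsilon> \<le> dist (\<Sum>i<n. real (vdegree G i) powr 1 / real n) (\<Sum>j. real j powr 1 * \<rho> j)}"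
  have V: "((\<lambda>n. pr lams n (?V n)) \<longlongrightarrow> 0) F"
    using conv_moment[OF lim zero_less_one] e unfolding conv_in_prob_def by blast
  have ce: "(\<Sum>j. real j powr 1 * \<rho> j) = cond_expectation (Po \<mu>h) S real"
    using moment_\<rho>_sums[of 1] by (simp add: sums_iff)
  show "((\<lambda>n. pr lams n {G. \<epsilon> \<le> dist (real (card G) / real n) (1/2 * cond_expectation (Po \<mu>h) S real)}) \<longlongrightarrow> 0) F"
  proof (rule conv_in_prob_sandwich[OF lim V V], rule subsetI)
    fix n G
    assume "G \<in> {G. \<epsilon> \<le> dist (real (card G) / real n) (1/2 * cond_expectation (Po \<mu>h) S real)} \<inter> S_graphs S n"
    hence G: "G \<subseteq> all_edges n" "\<epsilon> \<le> \<bar>real (card G) / real n - 1/2 * cond_expectation (Po \<mu>h) S real\<bar>"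
      by (auto simp: S_graphs_def dist_real_def)
    have "(\<Sum>i<n. real (vdegree G i) powr 1 / real n) = real (\<Sum>i<n. vdegree G i) / real n"
      by (simp add: sum_divide_distrib)
    also have "\<dots> = 2 * (real (card G) / real n)" unfolding handshake[OF G(1)] by simp
    finally show "G \<in> ?V n \<union> ?V n" using G(2) unfolding ce by (simp add: dist_real_def)
  qed
qed

end

theorem theorem2p1:
  fixes S :: "nat set" and lam \<mu>h :: real
  assumes "S \<noteq> {}"
    and "lam > 0"
    and "is_arg_max (psi S) (\<lambda>\<mu>. \<mu> \<in> Eset S lam) \<mu>h"
    and "\<And>\<mu>. is_arg_max (psi S) (\<lambda>\<mu>. \<mu> \<in> Eset S lam) \<mu> \<Longrightarrow> \<mu> = \<mu>h"
  shows
    "(\<forall>lams :: nat \<Rightarrow> real. (lams \<longlongrightarrow> lam) (S_sequentially S) \<longrightarrow>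
        \<comment> \<open>(i)\<close>
        conv_in_prob dTV (S_sequentially S) (\<lambda>n. gnpS n (lams n / real n) S) deg_dist (PoS S \<mu>h) \<and>
        (\<forall>j\<in>S. conv_in_prob dist (S_sequentially S) (\<lambda>n. gnpS n (lams n / real n) S)
                  (\<lambda>n G. real (n_deg n G j) / real n) (pmf (PoS S \<mu>h) j) \<and>
               pmf (PoS S \<mu>h) j = (\<mu>h ^ j / fact j) / phi S \<mu>h) \<and>
        \<comment> \<open>(ii)\<close>
        (\<forall>r::real. r > 0 \<longrightarrow>
           (\<forall>n. \<forall>G. G \<subseteq> all_edges n \<longrightarrow>
              (\<lambda>j. real j powr r * real (n_deg n G j) / real n) sums
                (\<Sum>i<n. real (vdegree G i) powr r / real n)) \<and>
           conv_in_prob dist (S_sequentially S) (\<lambda>n. gnpS n (lams n / real n) S)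
             (\<lambda>n G. \<Sum>i<n. real (vdegree G i) powr r / real n)
             (\<Sum>j. real j powr r * pmf (PoS S \<mu>h) j) \<and>
           (\<lambda>j. real j powr r * pmf (PoS S \<mu>h) j) sums
             cond_expectation (Po \<mu>h) S (\<lambda>j. real j powr r)) \<and>
        conv_in_prob dist (S_sequentially S) (\<lambda>n. gnpS n (lams n / real n) S)
          (\<lambda>n G. real (card G) / real n) (1/2 * cond_expectation (Po \<mu>h) S real) \<and>
        1/2 * cond_expectation (Po \<mu>h) S real = \<mu>h * deriv (phi S) \<mu>h / (2 * phi S \<mu>h) \<and>
        \<comment> \<open>(iv)\<close>
        ((\<lambda>n. 1 / real n * ln (measure_pmf.prob (gnp n (lams n / real n)) (S_graphs S n)))
           \<longlongrightarrow> psi S \<mu>h - lam / 2) (S_sequentially S)) \<and>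
     \<comment> \<open>(iii): the constant \<open>c\<close> depends only on \<open>\<epsilon>\<close>, \<open>lam\<close> and \<open>S\<close>, not on the sequence \<open>lams\<close>\<close>
     (\<forall>\<epsilon>>0. \<exists>c>0. \<forall>lams :: nat \<Rightarrow> real. (lams \<longlongrightarrow> lam) (S_sequentially S) \<longrightarrow>
        (\<forall>\<^sub>F n in S_sequentially S.
           measure_pmf.prob (gnpS n (lams n / real n) S) {G. dTV (deg_dist n G) (PoS S \<mu>h) \<ge> \<epsilon>}
             \<le> exp (- c * real n)))"
proof -
  interpret unique_maximizer S lam \<mu>h
    using assms by unfold_locales
  show ?thesis
  proof (intro conjI allI impI ballI)
    fix lams :: "nat \<Rightarrow> real" assume lim: "(lams \<longlongrightarrow> lam) (S_sequentially S)"
    show "conv_in_prob dTV (S_sequentially S) (\<lambda>n. gnpS n (lams n / real n) S) deg_dist (PoS S \<mu>h)"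
      unfolding conv_in_prob_def using conv_dTV[OF lim] by blast
    show "conv_in_prob dist (S_sequentially S) (\<lambda>n. gnpS n (lams n / real n) S)
        (\<lambda>n G. real (n_deg n G j) / real n) (pmf (PoS S \<mu>h) j)" for j
      by (rule conv_n_deg[OF lim])
    show "pmf (PoS S \<mu>h) j = (\<mu>h ^ j / fact j) / phi S \<mu>h" if "j \<in> S" for j
      using that by (simp add: \<rho>_eq)
    show "conv_in_prob dist (S_sequentially S) (\<lambda>n. gnpS n (lams n / real n) S)
        (\<lambda>n G. \<Sum>i<n. real (vdegree G i) powr r / real n) (\<Sum>j. real j powr r * pmf (PoS S \<mu>h) j)" if "r > 0" for r
      by (rule conv_moment[OF lim that])
    show "conv_in_prob dist (S_sequentially S) (\<lambda>n. gnpS n (lams n / real n) S)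
        (\<lambda>n G. real (card G) / real n) (1/2 * cond_expectation (Po \<mu>h) S real)"
      by (rule conv_edges[OF lim])
    show "1/2 * cond_expectation (Po \<mu>h) S real = \<mu>h * deriv (phi S) \<mu>h / (2 * phi S \<mu>h)"
      unfolding cond_expectation_id by simp
    show "((\<lambda>n. 1 / real n * ln (measure_pmf.prob (gnp n (lams n / real n)) (S_graphs S n)))
        \<longlongrightarrow> psi S \<mu>h - lam / 2) (S_sequentially S)"
      by (rule log_prob_limit[OF lim])
  next
    fix r :: real and n G assume "G \<subseteq> all_edges n"
    thus "(\<lambda>j. real j powr r * real (n_deg n G j) / real n) sums (\<Sum>i<n. real (vdegree G i) powr r / real n)"
      by (rule moment_sums)
  next
    fix r :: real assume "r > 0"
    thus "(\<lambda>j. real j powr r * pmf (PoS S \<mu>h) j) sums cond_expectation (Po \<mu>h) S (\<lambda>j. real j powr r)"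
      by (rule moment_\<rho>_sums)
  next
    fix \<epsilon> :: real assume "\<epsilon> > 0"
    thus "\<exists>c>0. \<forall>lams. (lams \<longlongrightarrow> lam) (S_sequentially S) \<longrightarrow> (\<forall>\<^sub>F n in S_sequentially S.
        measure_pmf.prob (gnpS n (lams n / real n) S) {G. dTV (deg_dist n G) (PoS S \<mu>h) \<ge> \<epsilon>} \<le> exp (- c * real n))"
      by (rule dTV_large_deviation)
  qed
qed

end
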